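(* Let $k\ge 2$ be a fixed integer. Given a temporal digraph $\mathcal{G}=(G,\gamma,\lambda)$ with lifetime $\mathsf{T}$ and temporal vertex set $V_T$, and subsets $R_1,\dots,R_k\subseteq V_T$, it is $\mathsf{NP}$-complete to decide whether $\mathcal{G}$ has $k$ pairwise t-edge-disjoint vertex-spanning branchings rooted at $R_1,\dots,R_k$ respectively, and it is also $\mathsf{NP}$-complete to decide whether $\mathcal{G}$ has $k$ pairwise edge-disjoint vertex-spanning branchings rooted at $R_1,\dots,R_k$ respectively; both hold even if $\mathsf{T}=2$ and $G$ is a DAG. Furthermore, with $n=|V(G)|$ and $m=|E(G)|$, neither problem admits an algorithm running in time $O^*(2^{o(n+m)})$ unless the Exponential Time Hypothesis fails.
   Context: A temporal digraph is a triple $\mathcal{G}=(G,\gamma,\lambda)$ where $G$ is a finite digraph, $\gamma(v)\subseteq\mathbb{N}$ for each $v\in V(G)$, and $\lambda(e)\subseteq\mathbb{N}\times\mathbb{N}$ for each $e\in E(G)$, such that if $(t,t')\in\lambda(uv)$ then $t\le t'$, $t\in\gamma(u)$, $t'\in\gamma(v)$. The lifetime is $\mathsf{T}=\max\bigcup_v\gamma(v)$. Temporal vertices: $V_T=\{(v,t):t\in\gamma(v)\}$; temporal edges: $(u,t)(v,t')$ for $uv\in E(G)$, $(t,t')\in\lambda(uv)$. A temporal walk is a sequence of temporal vertices and temporal edges in which each temporal edge goes from the preceding to the following temporal vertex, and any two consecutive temporal vertices are $(v,t),(v,t+1)$. A temporal subdigraph is $(G',\gamma',\lambda')$ with $G'\subseteq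 G,\gamma'\subseteq\gamma,\lambda'\subseteq\lambda$. For $R\subseteq V_T$, a temporal subdigraph $\mathcal{B}$ is a vertex-spanning branching with root $R$ if for each $u\in V(G)$ there is exactly one temporal walk in $\mathcal{B}$ from a vertex of $R$ to some temporal vertex of the form $(u,i)\in V_T$. Branchings $(G_1,\gamma_1,\lambda_1),(G_2,\gamma_2,\lambda_2)$ are t-edge-disjoint if $\lambda_1(e)\cap\lambda_2(e)=\emptyset$ for all $e\in E(G)$, and edge-disjoint if $E(G_1)\cap E(G_2)=\emptyset$. $O^*$ suppresses polynomial factors in the input size. *)

theory Defs
  imports
    "Graph_Theory.Digraph_Component"
    "HOL-Computational_Algebra.Polynomial"
    "HOL-Library.Landau_Symbols"
begin

section \<open>Turing machines\<close>

text \<open>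
  Deterministic multi-tape machines with two-way infinite tapes.  States are the numbers below
  \<^term>\<open>states\<close>: 0 is the initial state, 1 and 2 are the accepting and the rejecting halting state.
  Tape symbols are the numbers below \<^term>\<open>symbols\<close>: 0 is the blank, 1 and 2 are the bits
  False and True.  A transition maps the state and the list of scanned symbols to the new state
  and, for every tape, the symbol to write and the head displacement.
\<close>

record tm =
  tapes :: nat
  states :: nat
  symbols :: nat
  trans :: "nat \<Rightarrow> nat list \<Rightarrow> nat \<times> (nat \<times> int) list"

definition wf_tm :: "tm \<Rightarrow> bool" where
  "wf_tm M \<longleftrightarrow> 1 \<le> tapes M \<and> 3 \<le> states M \<and> 3 \<le> symbols M \<and>
     (\<forall>q < states M. \<forall>as. length as = tapes M \<and> set as \<subseteq> {..<symbols M} \<longrightarrow>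
        fst (trans M q as) < states M \<and>
        length (snd (trans M q as)) = tapes M \<and>
        set (snd (trans M q as)) \<subseteq> {..<symbols M} \<times> {-1, 0, 1})"

type_synonym tape = "(int \<Rightarrow> nat) \<times> int" \<comment> \<open>cell contents and head position\<close>
type_synonym config = "nat \<times> tape list"

definition scan :: "tape \<Rightarrow> nat" where
  "scan tp = fst tp (snd tp)"

definition act :: "nat \<times> int \<Rightarrow> tape \<Rightarrow> tape" where
  "act a tp = ((fst tp)(snd tp := fst a), snd tp + snd a)"

definition halted :: "config \<Rightarrow> bool" where
  "halted c \<longleftrightarrow> fst c \<in> {1, 2}"

definition step :: "tm \<Rightarrow> config \<Rightarrow> config" where
  "step M c =
     (if halted c then c
      else let r = trans M (fst c) (map scan (snd c)) in (fst r, map2 act (snd r) (snd c)))"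

definition bit_symbol :: "bool \<Rightarrow> nat" where
  "bit_symbol b = (if b then 2 else 1)"

definition input_tape :: "bool list \<Rightarrow> tape" where
  "input_tape x =
     (\<lambda>p. if 0 \<le> p \<and> p < int (length x) then bit_symbol (x ! nat p) else 0, 0)"

text \<open>The i-th input string is on the i-th tape; the remaining tapes are blank.\<close>

definition init :: "tm \<Rightarrow> bool list list \<Rightarrow> config" where
  "init M xs = (0, map (\<lambda>i. input_tape (if i < length xs then xs ! i else [])) [0..<tapes M])"

definition run :: "tm \<Rightarrow> bool list list \<Rightarrow> nat \<Rightarrow> config" where
  "run M xs t = (step M ^^ t) (init M xs)"

text \<open>The machine halts within t steps, with verdict b.\<close>

definition answers :: "tm \<Rightarrow> bool list list \<Rightarrow> nat \<Rightarrow> bool \<Rightarrow> bool" where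
  "answers M xs t b \<longleftrightarrow> fst (run M xs t) = (if b then 1 else 2)"

text \<open>An output is the string of bits that starts at the head and is ended by a blank.\<close>

definition shows_output :: "tape \<Rightarrow> bool list \<Rightarrow> bool" where
  "shows_output tp y \<longleftrightarrow>
     (\<forall>i < length y. fst tp (snd tp + int i) = bit_symbol (y ! i)) \<and>
     fst tp (snd tp + int (length y)) = 0"

section \<open>NP-completeness and the Exponential Time Hypothesis\<close>

type_synonym language = "bool list set"

definition polytime_computable :: "(bool list \<Rightarrow> bool list) \<Rightarrow> bool" where
  "polytime_computable f \<longleftrightarrow>
     (\<exists>M (p :: nat poly). wf_tm M \<and>
        (\<forall>x. let c = run M [x] (poly p (length x))
             in halted c \<and> shows_output (last (snd c)) (f x)))"

definition polytime_reducible :: "language \<Rightarrow> language \<Rightarrow> bool" where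
  "polytime_reducible L L' \<longleftrightarrow>
     (\<exists>f. polytime_computable f \<and> (\<forall>x. x \<in> L \<longleftrightarrow> f x \<in> L'))"

definition NP :: "language set" where
  "NP = {L. \<exists>M (p :: nat poly) (q :: nat poly). wf_tm M \<and> 2 \<le> tapes M \<and>
     (\<forall>x. (\<forall>u. length u \<le> poly p (length x) \<longrightarrow> (\<exists>b. answers M [x, u] (poly q (length x)) b)) \<and>
          (x \<in> L \<longleftrightarrow>
             (\<exists>u. length u \<le> poly p (length x) \<and> answers M [x, u] (poly q (length x)) True)))}"

definition NP_hard :: "language \<Rightarrow> bool" where
  "NP_hard L \<longleftrightarrow> (\<forall>L' \<in> NP. polytime_reducible L' L)"

definition NP_complete :: "language \<Rightarrow> bool" where
  "NP_complete L \<longleftrightarrow> L \<in> NP \<and> NP_hard L"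

text \<open>
  A decision problem is given by an encoding of its instances, the set of its instances and the
  subset of its yes-instances.  Nothing is required on strings that encode no instance.
\<close>

definition solves_in_time ::
    "tm \<Rightarrow> ('a \<Rightarrow> bool list) \<Rightarrow> 'a set \<Rightarrow> 'a set \<Rightarrow> ('a \<Rightarrow> real) \<Rightarrow> bool" where
  "solves_in_time M enc Inst Yes T \<longleftrightarrow>
     wf_tm M \<and> (\<forall>I \<in> Inst. \<exists>t. real t \<le> T I \<and> answers M [enc I] t (I \<in> Yes))"

text \<open>Solvable in time \<open>O\<^sup>*(2\<^sup>g)\<close>: factors polynomial in the length of the encoding are ignored.\<close>

definition solvable_Ostar_exp ::
    "('a \<Rightarrow> bool list) \<Rightarrow> 'a set \<Rightarrow> 'a set \<Rightarrow> ('a \<Rightarrow> real) \<Rightarrow> bool" where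
  "solvable_Ostar_exp enc Inst Yes g \<longleftrightarrow>
     (\<exists>M (p :: nat poly).
        solves_in_time M enc Inst Yes (\<lambda>I. 2 powr g I * real (poly p (length (enc I)))))"

text \<open>Self-delimiting binary encodings.\<close>

fun nat_bits :: "nat \<Rightarrow> bool list" where \<comment> \<open>least significant bit first\<close>
  "nat_bits n = (if n = 0 then [] else odd n # nat_bits (n div 2))"

declare nat_bits.simps [simp del]

definition enc_bit :: "bool \<Rightarrow> bool list" where
  "enc_bit b = [b]"

definition enc_list :: "('a \<Rightarrow> bool list) \<Rightarrow> 'a list \<Rightarrow> bool list" where
  "enc_list e xs = concat (map (\<lambda>x. True # e x) xs) @ [False]"

definition enc_pair :: "('a \<Rightarrow> bool list) \<Rightarrow> ('b \<Rightarrow> bool list) \<Rightarrow> 'a \<times> 'b \<Rightarrow> bool list" where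
  "enc_pair e e' z = e (fst z) @ e' (snd z)"

definition enc_nat :: "nat \<Rightarrow> bool list" where
  "enc_nat n = enc_list enc_bit (nat_bits n)"

type_synonym cnf = "(bool \<times> nat) list list" \<comment> \<open>a literal is a sign and a variable\<close>

definition enc_cnf :: "cnf \<Rightarrow> bool list" where
  "enc_cnf = enc_list (enc_list (enc_pair enc_bit enc_nat))"

definition cnf_vars :: "cnf \<Rightarrow> nat set" where
  "cnf_vars F = (\<Union>C \<in> set F. snd ` set C)"

definition satisfiable :: "cnf \<Rightarrow> bool" where
  "satisfiable F \<longleftrightarrow> (\<exists>\<alpha> :: nat \<Rightarrow> bool. \<forall>C \<in> set F. \<exists>(b, x) \<in> set C. \<alpha> x = b)"

definition cnf3 :: "cnf set" where
  "cnf3 = {F. \<forall>C \<in> set F. length C \<le> 3}"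

definition ETH :: bool where
  "ETH \<longleftrightarrow> (\<exists>\<delta> > 0. \<not> solvable_Ostar_exp enc_cnf cnf3 {F \<in> cnf3. satisfiable F}
                        (\<lambda>F. \<delta> * real (card (cnf_vars F))))"

section \<open>Temporal digraphs\<close>

record 'v temporal_digraph =
  dg :: "'v pair_pre_digraph"
  gam :: "'v \<Rightarrow> nat set"
  lam :: "'v \<times> 'v \<Rightarrow> (nat \<times> nat) set"

text \<open>
  Time steps are positive integers, so that lifetime T means that there are T time steps.
  Outside of the vertices and arcs of the digraph, both time functions are empty.
\<close>

definition temporal_digraph :: "'v temporal_digraph \<Rightarrow> bool" where
  "temporal_digraph \<G> \<longleftrightarrow>
     pair_digraph (dg \<G>) \<and>
     (\<forall>v. finite (gam \<G> v) \<and> 0 \<notin> gam \<G> v) \<and>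
     (\<forall>v. v \<notin> pverts (dg \<G>) \<longrightarrow> gam \<G> v = {}) \<and>
     (\<forall>e. e \<notin> parcs (dg \<G>) \<longrightarrow> lam \<G> e = {}) \<and>
     (\<forall>u v t t'. (t, t') \<in> lam \<G> (u, v) \<longrightarrow> t \<le> t' \<and> t \<in> gam \<G> u \<and> t' \<in> gam \<G> v)"

definition has_lifetime :: "'v temporal_digraph \<Rightarrow> nat \<Rightarrow> bool" where
  "has_lifetime \<G> T \<longleftrightarrow>
     (\<Union>v \<in> pverts (dg \<G>). gam \<G> v) \<noteq> {} \<and> Max (\<Union>v \<in> pverts (dg \<G>). gam \<G> v) = T"

definition temporal_verts :: "'v temporal_digraph \<Rightarrow> ('v \<times> nat) set" where
  "temporal_verts \<G> = {(v, t). v \<in> pverts (dg \<G>) \<and> t \<in> gam \<G> v}"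

definition temporal_edges :: "'v temporal_digraph \<Rightarrow> (('v \<times> nat) \<times> ('v \<times> nat)) set" where
  "temporal_edges \<G> = {((u, t), (v, t')). (u, v) \<in> parcs (dg \<G>) \<and> (t, t') \<in> lam \<G> (u, v)}"

datatype 'v walk_item = TVert "'v \<times> nat" | TEdge "('v \<times> nat) \<times> ('v \<times> nat)"

inductive temporal_walk ::
    "'v temporal_digraph \<Rightarrow> 'v \<times> nat \<Rightarrow> 'v walk_item list \<Rightarrow> 'v \<times> nat \<Rightarrow> bool"
  for \<G> where
  single: "x \<in> temporal_verts \<G> \<Longrightarrow> temporal_walk \<G> x [TVert x] x"
| wait: "(v, t) \<in> temporal_verts \<G> \<Longrightarrow> temporal_walk \<G> (v, t + 1) w z \<Longrightarrow>
    temporal_walk \<G> (v, t) (TVert (v, t) # w) z"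
| traverse: "(x, y) \<in> temporal_edges \<G> \<Longrightarrow> x \<in> temporal_verts \<G> \<Longrightarrow> temporal_walk \<G> y w z \<Longrightarrow>
    temporal_walk \<G> x (TVert x # TEdge (x, y) # w) z"

definition temporal_subdigraph :: "'v temporal_digraph \<Rightarrow> 'v temporal_digraph \<Rightarrow> bool" where
  "temporal_subdigraph \<B> \<G> \<longleftrightarrow>
     temporal_digraph \<B> \<and> temporal_digraph \<G> \<and>
     subgraph (with_proj (dg \<B>)) (with_proj (dg \<G>)) \<and>
     (\<forall>v. gam \<B> v \<subseteq> gam \<G> v) \<and> (\<forall>e. lam \<B> e \<subseteq> lam \<G> e)"

definition vertex_spanning_branching ::
    "'v temporal_digraph \<Rightarrow> ('v \<times> nat) set \<Rightarrow> 'v temporal_digraph \<Rightarrow> bool" where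
  "vertex_spanning_branching \<G> R \<B> \<longleftrightarrow>
     temporal_subdigraph \<B> \<G> \<and>
     (\<forall>u \<in> pverts (dg \<G>). \<exists>!w. \<exists>r \<in> R. \<exists>i. (u, i) \<in> temporal_verts \<G> \<and> temporal_walk \<B> r w (u, i))"

definition t_edge_disjoint ::
    "'v temporal_digraph \<Rightarrow> 'v temporal_digraph \<Rightarrow> 'v temporal_digraph \<Rightarrow> bool" where
  "t_edge_disjoint \<G> \<B>1 \<B>2 \<longleftrightarrow> (\<forall>e \<in> parcs (dg \<G>). lam \<B>1 e \<inter> lam \<B>2 e = {})"

definition edge_disjoint ::
    "'v temporal_digraph \<Rightarrow> 'v temporal_digraph \<Rightarrow> 'v temporal_digraph \<Rightarrow> bool" where
  "edge_disjoint \<G> \<B>1 \<B>2 \<longleftrightarrow> parcs (dg \<B>1) \<inter> parcs (dg \<B>2) = {}"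

definition has_disjoint_branchings ::
    "('v temporal_digraph \<Rightarrow> 'v temporal_digraph \<Rightarrow> 'v temporal_digraph \<Rightarrow> bool) \<Rightarrow>
     'v temporal_digraph \<Rightarrow> ('v \<times> nat) set list \<Rightarrow> bool" where
  "has_disjoint_branchings D \<G> Rs \<longleftrightarrow>
     (\<exists>\<B> :: nat \<Rightarrow> 'v temporal_digraph.
        (\<forall>i < length Rs. vertex_spanning_branching \<G> (Rs ! i) (\<B> i)) \<and>
        (\<forall>i < length Rs. \<forall>j < length Rs. i \<noteq> j \<longrightarrow> D \<G> (\<B> i) (\<B> j)))"

section \<open>The decision problems\<close>

text \<open>
  An instance lists the vertices, the arcs, the temporal vertices, the temporal edges and the
  root sets.
\<close>

type_synonym branching_instance =
  "nat list \<times> (nat \<times> nat) list \<times> (nat \<times> nat) list \<times>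
   ((nat \<times> nat) \<times> (nat \<times> nat)) list \<times> (nat \<times> nat) list list"

definition enc_instance :: "branching_instance \<Rightarrow> bool list" where
  "enc_instance =
     (let enc2 = enc_pair enc_nat enc_nat in
      enc_pair (enc_list enc_nat) (enc_pair (enc_list enc2) (enc_pair (enc_list enc2)
        (enc_pair (enc_list (enc_pair enc2 enc2)) (enc_list (enc_list enc2))))))"

fun tdigraph_of :: "branching_instance \<Rightarrow> nat temporal_digraph" where
  "tdigraph_of (vs, es, tvs, tes, rs) =
     \<lparr> dg = \<lparr> pverts = set vs, parcs = set es \<rparr>,
       gam = (\<lambda>v. {t. (v, t) \<in> set tvs}),
       lam = (\<lambda>(u, v). {(t, t'). ((u, t), (v, t')) \<in> set tes}) \<rparr>"

fun roots_of :: "branching_instance \<Rightarrow> (nat \<times> nat) set list" where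
  "roots_of (vs, es, tvs, tes, rs) = map set rs"

definition branching_instances :: "nat \<Rightarrow> branching_instance set" where
  "branching_instances k =
     {I. temporal_digraph (tdigraph_of I) \<and> length (roots_of I) = k \<and>
         (\<forall>R \<in> set (roots_of I). R \<subseteq> temporal_verts (tdigraph_of I))}"

definition t_edge_disjoint_branchings :: "nat \<Rightarrow> branching_instance set" where
  "t_edge_disjoint_branchings k =
     {I \<in> branching_instances k.
        has_disjoint_branchings t_edge_disjoint (tdigraph_of I) (roots_of I)}"

definition edge_disjoint_branchings :: "nat \<Rightarrow> branching_instance set" where
  "edge_disjoint_branchings k =
     {I \<in> branching_instances k.
        has_disjoint_branchings edge_disjoint (tdigraph_of I) (roots_of I)}"

definition lifetime2_dag :: "branching_instance set" where
  "lifetime2_dag =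
     {I. has_lifetime (tdigraph_of I) 2 \<and> acyclic (parcs (dg (tdigraph_of I)))}"

definition order_plus_size :: "branching_instance \<Rightarrow> nat" where
  "order_plus_size I =
     card (pverts (dg (tdigraph_of I))) + card (parcs (dg (tdigraph_of I)))"

text \<open>Solvable in time \<open>O\<^sup>*(2\<^bsup>o(n+m)\<^esup>)\<close>.\<close>

definition subexponential :: "nat \<Rightarrow> branching_instance set \<Rightarrow> bool" where
  "subexponential k Yes \<longleftrightarrow>
     (\<exists>f :: nat \<Rightarrow> real. f \<in> o(\<lambda>N. real N) \<and>
        solvable_Ostar_exp enc_instance (branching_instances k) Yes (\<lambda>I. f (order_plus_size I)))"

end

theory Submission
  imports Defs
begin

text \<open>
  In a branching each vertex is reached at exactly one time and waiting is impossible, so that a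
  branching is a choice of one time for each vertex together with a forest of temporal edges.
  A vertex that is a root at several times is thus a variable, whose value is the time chosen, and a
  vertex without roots is a clause, which can only be reached from a literal that is satisfied. All
  branchings but the first are made trivial by taking every temporal vertex as a root. This reduces
  satisfiability, for variables with arbitrary finite domains, to the existence of the branchings.

  With two values and the clauses of a computation tableau this gives NP-hardness for DAGs of lifetime
  2. For the lower bound under the Exponential Time Hypothesis no sparsification is needed: the \<open>n\<close>
  variables of a 3-CNF are divided into \<open>q\<close> groups, and for any three groups there is a vertex whose
  times are the assignments to these groups that satisfy all clauses inside them. The remaining
  clauses only state that the assignments agree, so that the digraph has \<open>O(q\<^sup>3 n)\<close> vertices and arcs
  and the instance has size \<open>2\<close> to the power of \<open>O(n/q)\<close>, where \<open>q\<close> can be chosen after the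
  polynomials in all running times are known.

  Turing machines are obtained from programs on stacks of bits, one stack for each tape; data are binary
  trees in prefix code, and the functions computable in polynomial time on such trees are closed under
  composition and under iteration along a list if the intermediate results stay small.
\<close>


section \<open>Stack programs\<close>

text \<open>Waiting is excluded because the part of a walk before a wait already ends at the same
  vertex and would be a second walk to it. The obstacle to the lower bound is that a 3-CNF on N
  variables may have a number of clauses cubic in N, so that one vertex per clause makes n+m too
  large. The way out is that n+m counts vertices and arcs but not times: the values of a variable
  only cost input length, and O* forgives any polynomial in that. If reducing and deciding together
  take the e-th power of a budget of about 2^(N/q), then q above 2e/delta leaves 2^(delta N/2);
  since the digraph is linear in N for this fixed q, the term o(n+m) fits into the other half of the
  exponent. Only the NP-hardness reduction keeps the lifetime 2. Vertices and times are numbers, but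
  their binary digits spell names; thus constructions and checks are carried out on bit strings, and
  the only arithmetic needed on these numbers is the comparison of times.\<close>

type_synonym stacks = "nat \<Rightarrow> bool list"

text \<open>The symbol scanned when the head stands on the top of the stack. The blank 0 signals the
  empty stack, so that a test against a set of symbols can also detect emptiness.\<close>

definition top_symbol :: "bool list \<Rightarrow> nat" where
  "top_symbol xs = (case xs of [] \<Rightarrow> 0 | b # _ \<Rightarrow> bit_symbol b)"

datatype prog =
    Skip
  | Push nat bool
  | Pop nat
  | Seq prog prog (infixr ";;" 60)
  | Cond nat "nat set" prog prog
  | While nat "nat set" prog

text \<open>\<open>exec P s n s'\<close>: started in \<open>s\<close>, the program ends in \<open>s'\<close> after at most \<open>n\<close> machine steps.\<close>

inductive exec :: "prog \<Rightarrow> stacks \<Rightarrow> nat \<Rightarrow> stacks \<Rightarrow> bool" where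
  Skip: "exec Skip s n s"
| Push: "2 \<le> n \<Longrightarrow> s' = s(r := b # s r) \<Longrightarrow> exec (Push r b) s n s'"
| Pop: "1 \<le> n \<Longrightarrow> s' = s(r := tl (s r)) \<Longrightarrow> exec (Pop r) s n s'"
| Seq: "exec P s n s' \<Longrightarrow> exec Q s' m s'' \<Longrightarrow> n + m \<le> k \<Longrightarrow> exec (P ;; Q) s k s''"
| CondT: "top_symbol (s r) \<in> A \<Longrightarrow> exec P s n s' \<Longrightarrow> n + 2 \<le> k \<Longrightarrow> exec (Cond r A P Q) s k s'"
| CondF: "top_symbol (s r) \<notin> A \<Longrightarrow> exec Q s n s' \<Longrightarrow> n + 2 \<le> k \<Longrightarrow> exec (Cond r A P Q) s k s'"
| WhileF: "top_symbol (s r) \<notin> A \<Longrightarrow> 1 \<le> n \<Longrightarrow> exec (While r A P) s n s"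
| WhileT: "top_symbol (s r) \<in> A \<Longrightarrow> exec P s n s' \<Longrightarrow> exec (While r A P) s' m s'' \<Longrightarrow> n + m + 2 \<le> k \<Longrightarrow>
    exec (While r A P) s k s''"

fun regs :: "prog \<Rightarrow> nat set" where
  "regs Skip = {}"
| "regs (Push r b) = {r}"
| "regs (Pop r) = {r}"
| "regs (P ;; Q) = regs P \<union> regs Q"
| "regs (Cond r A P Q) = {r} \<union> regs P \<union> regs Q"
| "regs (While r A P) = {r} \<union> regs P"

lemma exec_mono: "exec P s n s' \<Longrightarrow> n \<le> m \<Longrightarrow> exec P s m s'"
  by (erule exec.cases) (auto intro: exec.intros)

text \<open>The running time bounds the growth of a stack; hence results computed in polynomial time
  have polynomial size (\<open>pb_sz\<close>).\<close>

lemma exec_length: "exec P s n s' \<Longrightarrow> length (s' r) \<le> length (s r) + n"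
  by (induction rule: exec.induct) auto

section \<open>Compiling stack programs to Turing machines\<close>

text \<open>An instruction acts on a single tape; it maps the scanned symbol to the symbol written,
  the displacement, and the next state.\<close>

type_synonym instr = "nat \<times> (nat \<Rightarrow> nat \<times> int \<times> nat)"

definition instr_trans :: "instr \<Rightarrow> nat list \<Rightarrow> nat \<times> (nat \<times> int) list" where
  "instr_trans i as =
     (let (w, d, q) = snd i (as ! fst i) in (q, (map (\<lambda>a. (a, 0)) as)[fst i := (w, d)]))"

fun plen :: "prog \<Rightarrow> nat" where
  "plen Skip = 0"
| "plen (Push r b) = 2"
| "plen (Pop r) = 1"
| "plen (P ;; Q) = plen P + plen Q"
| "plen (Cond r A P Q) = plen P + plen Q + 2"
| "plen (While r A P) = plen P + 2"

text \<open>The code of \<open>P\<close> occupies the states from \<open>a\<close> on and is left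
  through state \<open>a + plen P\<close>. A stack extends from the head to the right and everything
  to the left is blank: a push moves left and then writes, which takes two steps, and a pop blanks
  the top and moves right.\<close>

fun compile :: "nat \<Rightarrow> prog \<Rightarrow> instr list" where
  "compile a Skip = []"
| "compile a (Push r b) = [(r, \<lambda>x. (x, -1, a + 1)), (r, \<lambda>x. (bit_symbol b, 0, a + 2))]"
| "compile a (Pop r) = [(r, \<lambda>x. (0, 1, a + 1))]"
| "compile a (P ;; Q) = compile a P @ compile (a + plen P) Q"
| "compile a (Cond r A P Q) =
     (r, \<lambda>x. (x, 0, if x \<in> A then a + 1 else a + 2 + plen P)) # compile (a + 1) P @
     (r, \<lambda>x. (x, 0, a + 2 + plen P + plen Q)) # compile (a + 2 + plen P) Q"
| "compile a (While r A P) =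
     (r, \<lambda>x. (x, 0, if x \<in> A then a + 1 else a + 2 + plen P)) # compile (a + 1) P @
     [(r, \<lambda>x. (x, 0, a))]"

lemma length_compile [simp]: "length (compile a P) = plen P"
  by (induction P arbitrary: a) auto

text \<open>Tape contents relative to the head. A machine cannot distinguish tapes with equal views,
  so that absolute positions can be forgotten.\<close>

definition view :: "tape \<Rightarrow> int \<Rightarrow> nat" where
  "view tp = (\<lambda>i. fst tp (snd tp + i))"

definition stack_view :: "bool list \<Rightarrow> int \<Rightarrow> nat" where
  "stack_view xs p = (if 0 \<le> p \<and> p < int (length xs) then bit_symbol (xs ! nat p) else 0)"

lemma view_act: "view (act (w, d) tp) = (\<lambda>i. ((view tp)(0 := w)) (i + d))"
  by (auto simp: view_def act_def fun_eq_iff algebra_simps)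

lemma scan_view: "scan tp = view tp 0"
  by (simp add: scan_def view_def)

lemma act_idle: "act (scan tp, 0) tp = tp"
  by (simp add: act_def scan_def)

lemma view_input_tape: "view (input_tape xs) = stack_view xs"
  by (auto simp: view_def input_tape_def stack_view_def)

lemma stack_view_0: "stack_view xs 0 = top_symbol xs"
  by (cases xs) (auto simp: stack_view_def top_symbol_def)

lemma stack_view_Cons: "stack_view (b # xs) p = (if p = 0 then bit_symbol b else stack_view xs (p - 1))"
  by (auto simp: stack_view_def nth_Cons' nat_diff_distrib' nat_less_iff)

lemma stack_view_tl: "(if i + 1 = 0 then 0 else stack_view xs (i + 1)) = stack_view (tl xs) i"
proof (cases xs)
  case Nil
  then show ?thesis by (simp add: stack_view_def)
next
  case (Cons b ys)
  show ?thesis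
    unfolding Cons by (auto simp: stack_view_Cons) (simp add: stack_view_def)
qed

lemma view_push:
  "view tp = stack_view xs \<Longrightarrow> view (act (bit_symbol b, 0) (act (scan tp, -1) tp)) = stack_view (b # xs)"
  by (auto simp: view_act scan_view fun_eq_iff stack_view_Cons)

definition represents :: "tm \<Rightarrow> stacks \<Rightarrow> tape list \<Rightarrow> bool" where
  "represents M s tps \<longleftrightarrow> length tps = tapes M \<and> (\<forall>j < tapes M. view (tps ! j) = stack_view (s j))"

definition hosts :: "tm \<Rightarrow> nat \<Rightarrow> instr list \<Rightarrow> bool" where
  "hosts M a code \<longleftrightarrow> (\<forall>i < length code. trans M (a + i) = instr_trans (code ! i))"

lemma hosts_append:
  "hosts M a (xs @ ys) \<longleftrightarrow> hosts M a xs \<and> hosts M (a + length xs) ys"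
proof
  assume h: "hosts M a (xs @ ys)"
  have "trans M (a + length xs + i) = instr_trans (ys ! i)" if "i < length ys" for i
    using h[unfolded hosts_def, rule_format, of "length xs + i"] that by (simp add: add.assoc)
  moreover have "hosts M a xs"
    using h by (auto simp: hosts_def nth_append)
  ultimately show "hosts M a xs \<and> hosts M (a + length xs) ys" by (simp add: hosts_def)
next
  assume h: "hosts M a xs \<and> hosts M (a + length xs) ys"
  have "trans M (a + i) = instr_trans ((xs @ ys) ! i)" if i: "i < length (xs @ ys)" for i
  proof (cases "i < length xs")
    case True
    then show ?thesis using h by (auto simp: hosts_def nth_append)
  next
    case False
    then show ?thesis
      using i conjunct2[OF h, unfolded hosts_def, rule_format, of "i - length xs"]
      by (auto simp: nth_append)
  qed
  then show "hosts M a (xs @ ys)" by (simp add: hosts_def)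
qed

lemma hosts_Cons:
  "hosts M a (x # xs) \<longleftrightarrow> trans M a = instr_trans x \<and> hosts M (Suc a) xs"
  using hosts_append[of M a "[x]" xs] by (simp add: hosts_def)

lemma step_instr:
  assumes "3 \<le> q" "trans M q = instr_trans (r, f)" "r < length tps"
    "f (scan (tps ! r)) = (w, d, q')"
  shows "step M (q, tps) = (q', tps[r := act (w, d) (tps ! r)])"
proof -
  have "map2 act ((map (\<lambda>a. (a, 0)) (map scan tps))[r := (w, d)]) tps = tps[r := act (w, d) (tps ! r)]"
    by (rule nth_equalityI) (use assms(3) in \<open>auto simp: nth_list_update act_idle\<close>)
  moreover have "\<not> halted (q, tps)" using assms(1) by (simp add: halted_def)
  ultimately show ?thesis
    using assms(2-) by (simp add: step_def instr_trans_def Let_def)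
qed

lemma represents_update:
  assumes "represents M s tps" "r < tapes M" "view tp = stack_view xs"
  shows "represents M (s(r := xs)) (tps[r := tp])"
  using assms by (auto simp: represents_def nth_list_update)

lemma represents_scan:
  "represents M s tps \<Longrightarrow> r < tapes M \<Longrightarrow> scan (tps ! r) = top_symbol (s r)"
  by (simp add: represents_def scan_view stack_view_0)

text \<open>The assumption \<open>3 \<le> a\<close> keeps all code away from the halting states 1
  and 2, where \<open>step\<close> would do nothing.\<close>

lemma compile_correct:
  assumes "exec P s n s'" "hosts M a (compile a P)" "3 \<le> a" "regs P \<subseteq> {..<tapes M}" "represents M s tps"
  shows "\<exists>n' \<le> n. \<exists>tps'. (step M ^^ n') (a, tps) = (a + plen P, tps') \<and> represents M s' tps'"
  using assms
proof (induction arbitrary: a tps rule: exec.induct)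
  case (Skip s n)
  then show ?case by (intro exI[of _ 0]) auto
next
  case (Push n s' s r b)
  have r: "r < tapes M" "r < length tps" using Push.prems by (auto simp: represents_def)
  let ?tps1 = "tps[r := act (scan (tps ! r), -1) (tps ! r)]"
  let ?tp2 = "act (bit_symbol b, 0) (act (scan (tps ! r), -1) (tps ! r))"
  have 1: "step M (a, tps) = (a + 1, ?tps1)"
    by (rule step_instr) (use Push.prems r in \<open>auto simp: hosts_Cons\<close>)
  have 2: "step M (a + 1, ?tps1) = (a + 2, ?tps1[r := act (bit_symbol b, 0) (?tps1 ! r)])"
    by (rule step_instr) (use Push.prems r in \<open>auto simp: hosts_Cons\<close>)
  have eq: "?tps1[r := act (bit_symbol b, 0) (?tps1 ! r)] = tps[r := ?tp2]"
    using r by simp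
  have "view ?tp2 = stack_view (b # s r)"
    using Push.prems(4) r by (intro view_push) (auto simp: represents_def)
  then have "represents M s' (tps[r := ?tp2])"
    using Push.prems(4) Push.hyps(2) r by (auto intro: represents_update)
  moreover have "(step M ^^ 2) (a, tps) = (a + plen (Push r b), tps[r := ?tp2])"
    using 1 2 eq by (simp add: numeral_2_eq_2)
  ultimately show ?case using Push.hyps(1) by blast
next
  case (Pop n s' s r)
  have r: "r < tapes M" "r < length tps" using Pop.prems by (auto simp: represents_def)
  have 1: "step M (a, tps) = (a + 1, tps[r := act (0, 1) (tps ! r)])"
    by (rule step_instr) (use Pop.prems r in \<open>auto simp: hosts_Cons\<close>)
  have "view (act (0, 1) (tps ! r)) = stack_view (tl (s r))"
    using Pop.prems(4) r by (simp add: view_act represents_def stack_view_tl)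
  then have "represents M s' (tps[r := act (0, 1) (tps ! r)])"
    using Pop.prems(4) Pop.hyps(2) r by (auto intro: represents_update)
  with 1 Pop.hyps(1) show ?case by (intro exI[of _ 1]) auto
next
  case (Seq P s n s' Q m s'' k)
  from Seq.prems have hP: "hosts M a (compile a P)"
    and hQ: "hosts M (a + plen P) (compile (a + plen P) Q)" by (auto simp: hosts_append)
  from Seq.IH(1)[OF hP Seq.prems(2) _ Seq.prems(4)] Seq.prems(3)
  obtain n1 tps1 where n1: "n1 \<le> n" "(step M ^^ n1) (a, tps) = (a + plen P, tps1)" "represents M s' tps1"
    by auto
  from Seq.IH(2)[OF hQ _ _ n1(3)] Seq.prems(2,3)
  obtain n2 tps2 where n2: "n2 \<le> m" "(step M ^^ n2) (a + plen P, tps1) = (a + plen P + plen Q, tps2)"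
    "represents M s'' tps2" by auto
  have "(step M ^^ (n2 + n1)) (a, tps) = (a + plen (P ;; Q), tps2)"
    using n1 n2 by (simp add: funpow_add add.assoc)
  then show ?case using n1(1) n2(1,3) Seq.hyps(3) by (intro exI[of _ "n2 + n1"]) auto
next
  case (CondT s r A P n s' k Q)
  have r: "r < tapes M" "r < length tps" using CondT.prems by (auto simp: represents_def)
  from CondT.prems have hP: "hosts M (a + 1) (compile (a + 1) P)"
    and hJ: "trans M (a + 1 + plen P) = instr_trans (r, \<lambda>x. (x, 0, a + 2 + plen P + plen Q))"
    by (auto simp: hosts_append hosts_Cons)
  have tr: "trans M a = instr_trans (r, \<lambda>x. (x, 0, if x \<in> A then a + 1 else a + 2 + plen P))"
    using CondT.prems(1) by (simp add: hosts_Cons)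
  have 1: "step M (a, tps) = (a + 1, tps[r := act (scan (tps ! r), 0) (tps ! r)])"
    by (rule step_instr[OF _ tr]) (use CondT.prems CondT.hyps(1) r in \<open>auto simp: represents_scan\<close>)
  from CondT.IH[OF hP _ _ CondT.prems(4)] CondT.prems(2,3)
  obtain n1 tps1 where n1: "n1 \<le> n" "(step M ^^ n1) (a + 1, tps) = (a + 1 + plen P, tps1)"
    "represents M s' tps1" by auto
  have 2: "step M (a + 1 + plen P, tps1) =
      (a + 2 + plen P + plen Q, tps1[r := act (scan (tps1 ! r), 0) (tps1 ! r)])"
    by (rule step_instr[OF _ hJ]) (use n1 CondT.prems(2) r in \<open>auto simp: represents_def\<close>)
  have "(step M ^^ (1 + n1 + 1)) (a, tps) = (a + plen (Cond r A P Q), tps1)"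
    unfolding funpow_add using n1(2) 1 2 by (simp add: act_idle add_ac)
  then show ?case using n1(1,3) CondT.hyps(3) by (intro exI[of _ "1 + n1 + 1"]) auto
next
  case (CondF s r A Q n s' k P)
  have r: "r < tapes M" "r < length tps" using CondF.prems by (auto simp: represents_def)
  from CondF.prems have hQ: "hosts M (a + 2 + plen P) (compile (a + 2 + plen P) Q)"
    by (auto simp: hosts_append hosts_Cons)
  have tr: "trans M a = instr_trans (r, \<lambda>x. (x, 0, if x \<in> A then a + 1 else a + 2 + plen P))"
    using CondF.prems(1) by (simp add: hosts_Cons)
  have 1: "step M (a, tps) = (a + 2 + plen P, tps[r := act (scan (tps ! r), 0) (tps ! r)])"
    by (rule step_instr[OF _ tr]) (use CondF.prems CondF.hyps(1) r in \<open>auto simp: represents_scan\<close>)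
  from CondF.IH[OF hQ _ _ CondF.prems(4)] CondF.prems(2,3)
  obtain n1 tps1 where n1: "n1 \<le> n" "(step M ^^ n1) (a + 2 + plen P, tps) = (a + 2 + plen P + plen Q, tps1)"
    "represents M s' tps1" by auto
  have "(step M ^^ (n1 + 1)) (a, tps) = (a + plen (Cond r A P Q), tps1)"
    unfolding funpow_add using n1(2) 1 by (simp add: act_idle add_ac)
  then show ?case using n1(1,3) CondF.hyps(3) by (intro exI[of _ "n1 + 1"]) auto
next
  case (WhileF s r A n P)
  have r: "r < tapes M" "r < length tps" using WhileF.prems by (auto simp: represents_def)
  have tr: "trans M a = instr_trans (r, \<lambda>x. (x, 0, if x \<in> A then a + 1 else a + 2 + plen P))"
    using WhileF.prems(1) by (simp add: hosts_Cons)
  have 1: "step M (a, tps) = (a + 2 + plen P, tps[r := act (scan (tps ! r), 0) (tps ! r)])"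
    by (rule step_instr[OF _ tr]) (use WhileF.prems WhileF.hyps(1) r in \<open>auto simp: represents_scan\<close>)
  then show ?case using WhileF by (intro exI[of _ 1]) (auto simp: act_idle)
next
  case (WhileT s r A P n s' m s'' k)
  have r: "r < tapes M" "r < length tps" using WhileT.prems by (auto simp: represents_def)
  from WhileT.prems have hP: "hosts M (a + 1) (compile (a + 1) P)"
    and hJ: "trans M (a + 1 + plen P) = instr_trans (r, \<lambda>x. (x, 0, a))"
    by (auto simp: hosts_append hosts_Cons)
  have tr: "trans M a = instr_trans (r, \<lambda>x. (x, 0, if x \<in> A then a + 1 else a + 2 + plen P))"
    using WhileT.prems(1) by (simp add: hosts_Cons)
  have 1: "step M (a, tps) = (a + 1, tps[r := act (scan (tps ! r), 0) (tps ! r)])"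
    by (rule step_instr[OF _ tr]) (use WhileT.prems WhileT.hyps(1) r in \<open>auto simp: represents_scan\<close>)
  from WhileT.IH(1)[OF hP _ _ WhileT.prems(4)] WhileT.prems(2,3)
  obtain n1 tps1 where n1: "n1 \<le> n" "(step M ^^ n1) (a + 1, tps) = (a + 1 + plen P, tps1)"
    "represents M s' tps1" by auto
  have 2: "step M (a + 1 + plen P, tps1) = (a, tps1[r := act (scan (tps1 ! r), 0) (tps1 ! r)])"
    by (rule step_instr[OF _ hJ]) (use n1 WhileT.prems(2) r in \<open>auto simp: represents_def\<close>)
  from WhileT.IH(2)[OF WhileT.prems(1-3) n1(3)]
  obtain n2 tps2 where n2: "n2 \<le> m" "(step M ^^ n2) (a, tps1) = (a + plen (While r A P), tps2)"
    "represents M s'' tps2" by auto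
  have "(step M ^^ (n2 + 1 + n1 + 1)) (a, tps) = (a + plen (While r A P), tps2)"
    unfolding funpow_add using n1(2) n2(2) 1 2 by (simp add: act_idle)
  then show ?case using n1(1) n2(1,3) WhileT.hyps(4) by (intro exI[of _ "n2 + 1 + n1 + 1"]) auto
qed

text \<open>An instruction may write back whatever it scans, because a program can be embedded into
  a machine with more than three symbols; new symbols are below 3.\<close>

definition good_instr :: "nat \<Rightarrow> nat \<Rightarrow> instr \<Rightarrow> bool" where
  "good_instr K N i \<longleftrightarrow> fst i < K \<and>
     (\<forall>x w d q. snd i x = (w, d, q) \<longrightarrow> (w = x \<or> w < 3) \<and> d \<in> {-1, 0, 1} \<and> q < N)"

lemma good_instr_compile:
  "i \<in> set (compile a P) \<Longrightarrow> regs P \<subseteq> {..<K} \<Longrightarrow> a + plen P < N \<Longrightarrow> good_instr K N i"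
proof (induction P arbitrary: a)
  case (Seq P Q)
  then show ?case by fastforce
next
  case (Cond r A P Q)
  have "i \<in> set (compile (a + 1) P) \<Longrightarrow> good_instr K N i"
    using Cond by (intro Cond.IH(1)[of "a + 1"]) auto
  moreover have "i \<in> set (compile (a + 2 + plen P) Q) \<Longrightarrow> good_instr K N i"
    using Cond by (intro Cond.IH(2)[of "a + 2 + plen P"]) auto
  ultimately show ?case using Cond.prems by (auto simp: good_instr_def)
next
  case (While r A P)
  have "i \<in> set (compile (a + 1) P) \<Longrightarrow> good_instr K N i"
    using While by (intro While.IH[of "a + 1"]) auto
  then show ?case using While.prems by (auto simp: good_instr_def)
qed (auto simp: good_instr_def bit_symbol_def)

lemma instr_trans_wf:
  assumes "good_instr K N i" "3 \<le> S" "length as = K" "set as \<subseteq> {..<S}"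
  shows "fst (instr_trans i as) < N \<and> length (snd (instr_trans i as)) = K \<and>
    set (snd (instr_trans i as)) \<subseteq> {..<S} \<times> {-1, 0, 1}"
proof -
  obtain w d q where e: "snd i (as ! fst i) = (w, d, q)" by (metis prod_cases3)
  have i: "fst i < K" "w = as ! fst i \<or> w < 3" "d \<in> {-1, 0, 1}" "q < N"
    using assms(1) e by (auto simp: good_instr_def)
  have "as ! fst i < S" using i(1) assms(3,4) by (metis lessThan_iff nth_mem subsetD)
  then have "w < S" using i(2) assms(2) by auto
  moreover have "set (map (\<lambda>a. (a, 0::int)) as) \<subseteq> {..<S} \<times> {-1, 0, 1}" using assms(4) by auto
  ultimately have "set ((map (\<lambda>a. (a, 0::int)) as)[fst i := (w, d)]) \<subseteq> {..<S} \<times> {-1, 0, 1}"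
    using i(3) set_update_subset_insert[of "map (\<lambda>a. (a, 0::int)) as" "fst i" "(w, d)"] by blast
  then show ?thesis using i e assms(3) by (simp add: instr_trans_def)
qed

definition idle :: "nat \<Rightarrow> instr" where
  "idle q = (0, \<lambda>x. (x, 0, q))"

text \<open>States 1 and 2 halt, so that the code of a program starts at state 3.\<close>

definition code_of :: "prog \<Rightarrow> instr list" where
  "code_of P = [idle 3, idle 3, idle 3] @ compile 3 P"

lemma length_code_of [simp]: "length (code_of P) = plen P + 3"
  by (simp add: code_of_def)

lemma good_instr_code_of:
  "i \<in> set (code_of P) \<Longrightarrow> regs P \<subseteq> {..<K} \<Longrightarrow> 0 < K \<Longrightarrow> plen P + 3 < N \<Longrightarrow> good_instr K N i"
  using good_instr_compile[of i 3 P K N] by (auto simp: code_of_def idle_def good_instr_def[of _ _ "(0, _)"])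

lemma run_code_of:
  assumes h: "hosts M 0 (code_of P)" and e: "exec P s n s'" and "regs P \<subseteq> {..<tapes M}" "0 < tapes M"
    and s: "s = (\<lambda>i. if i < length xs then xs ! i else [])"
  shows "\<exists>n' \<le> n + 1. \<exists>tps'. run M xs n' = (plen P + 3, tps') \<and> represents M s' tps'"
proof -
  let ?tps = "snd (init M xs)"
  have r: "represents M s ?tps"
    by (auto simp: represents_def init_def view_input_tape s)
  have "trans M 0 = instr_trans (idle 3)"
    and hc: "hosts M 3 (compile 3 P)"
    using h by (auto simp: code_of_def hosts_Cons numeral_3_eq_3)
  then have "step M (0, ?tps) = (3, map2 act (snd (instr_trans (idle 3) (map scan ?tps))) ?tps)"
    by (simp add: step_def halted_def instr_trans_def idle_def Let_def)
  moreover have "map2 act (snd (instr_trans (idle 3) (map scan ?tps))) ?tps = ?tps"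
    using assms(4)
    by (intro nth_equalityI) (auto simp: instr_trans_def idle_def nth_list_update act_idle init_def)
  ultimately have 1: "step M (init M xs) = (3, ?tps)" by (simp add: init_def)
  from compile_correct[OF e hc _ assms(3) r]
  obtain n1 tps1 where "n1 \<le> n" "(step M ^^ n1) (3, ?tps) = (3 + plen P, tps1)" "represents M s' tps1"
    by auto
  then show ?thesis using 1
    by (intro exI[of _ "n1 + 1"])
      (auto simp: run_def funpow_Suc_right add.commute simp del: funpow.simps)
qed

lemma run_halted: "halted (run M xs n) \<Longrightarrow> n \<le> m \<Longrightarrow> run M xs m = run M xs n"
proof (induction m)
  case (Suc m)
  show ?case
  proof (cases "n = Suc m")
    case False
    then have "run M xs m = run M xs n" using Suc by auto
    then show ?thesis using Suc.prems(1) by (simp add: run_def step_def)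
  qed simp
qed (simp add: run_def)

text \<open>The instruction appended at the exit of the program turns the top bit of tape
  \<open>r\<close> into the verdict and halts.\<close>

definition machine :: "nat \<Rightarrow> prog \<Rightarrow> nat \<Rightarrow> tm" where
  "machine K P r = \<lparr>tapes = K, states = plen P + 4, symbols = 3,
     trans = (\<lambda>q. instr_trans ((code_of P @ [(r, \<lambda>x. (x, 0, if x = 2 then 1 else 2))]) ! q))\<rparr>"

lemma wf_machine:
  assumes "regs P \<subseteq> {..<K}" "r < K"
  shows "wf_tm (machine K P r)"
proof -
  let ?code = "code_of P @ [(r, \<lambda>x. (x, 0, if x = 2 then 1 else 2))]"
  have g: "good_instr K (plen P + 4) i" if "i \<in> set ?code" for i
    using that assms good_instr_code_of[of i P K "plen P + 4"] by (auto simp: good_instr_def)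
  have "good_instr K (plen P + 4) (?code ! q)" if "q < plen P + 4" for q
    using that by (intro g nth_mem) simp
  then show ?thesis
    using assms instr_trans_wf[of K "plen P + 4" _ 3]
    by (simp add: wf_tm_def machine_def)
qed

lemma run_machine:
  assumes "exec P s n s'" "regs P \<subseteq> {..<K}" "r < K"
    "s = (\<lambda>i. if i < length xs then xs ! i else [])" "n + 2 \<le> t"
  shows "fst (run (machine K P r) xs t) = (if top_symbol (s' r) = 2 then 1 else 2) \<and>
    represents (machine K P r) s' (snd (run (machine K P r) xs t))"
proof -
  let ?M = "machine K P r"
  let ?i = "(r, \<lambda>x. (x, 0::int, if x = 2 then 1 else 2)) :: instr"
  have h: "hosts ?M 0 (code_of P)"
    by (auto simp: hosts_def machine_def nth_append)
  have K: "tapes ?M = K" by (simp add: machine_def)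
  from run_code_of[OF h assms(1) _ _ assms(4)] assms(2,3) K
  obtain n' tps' where n': "n' \<le> n + 1" "run ?M xs n' = (plen P + 3, tps')" "represents ?M s' tps'"
    by auto
  have t: "trans ?M (plen P + 3) = instr_trans ?i"
    by (simp add: machine_def nth_append)
  have "step ?M (plen P + 3, tps') = (if top_symbol (s' r) = 2 then 1 else 2, tps'[r := act (scan (tps' ! r), 0) (tps' ! r)])"
    by (rule step_instr[OF _ t])
      (use n' assms(3) K represents_scan[OF n'(3), of r] in \<open>auto simp: represents_def\<close>)
  then have "run ?M xs (n' + 1) = (if top_symbol (s' r) = 2 then 1 else 2, tps')"
    using n'(2) by (simp add: run_def act_idle)
  moreover from this have "run ?M xs t = run ?M xs (n' + 1)"
    using n'(1) assms(5) by (intro run_halted) (auto simp: halted_def)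
  ultimately show ?thesis using n'(3) by simp
qed

text \<open>After the program has halted, the machine \<open>M\<close> is run on the tapes from \<open>K\<close> on.\<close>

definition then_shift :: "nat \<Rightarrow> nat \<Rightarrow> nat" where
  "then_shift e q = (if q = 1 \<or> q = 2 then q else e + q)"

definition then_machine :: "nat \<Rightarrow> prog \<Rightarrow> tm \<Rightarrow> tm" where
  "then_machine K P M = \<lparr>tapes = K + tapes M, states = plen P + 3 + states M, symbols = symbols M,
     trans = (\<lambda>q as. if q < plen P + 3 then instr_trans (code_of P ! q) as
       else (let r = trans M (q - (plen P + 3)) (drop K as)
             in (then_shift (plen P + 3) (fst r), map (\<lambda>a. (a, 0)) (take K as) @ snd r)))\<rparr>"

lemma wf_then_machine:
  assumes "regs P \<subseteq> {..<K + tapes M}" "wf_tm M"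
  shows "wf_tm (then_machine K P M)"
proof -
  have M: "1 \<le> tapes M" "3 \<le> states M" "3 \<le> symbols M"
    and MM: "\<And>q as. q < states M \<Longrightarrow> length as = tapes M \<Longrightarrow> set as \<subseteq> {..<symbols M} \<Longrightarrow>
      fst (trans M q as) < states M \<and> length (snd (trans M q as)) = tapes M \<and>
      set (snd (trans M q as)) \<subseteq> {..<symbols M} \<times> {-1, 0, 1}"
    using assms(2) by (auto simp: wf_tm_def)
  let ?e = "plen P + 3"
  have "fst (trans (then_machine K P M) q as) < ?e + states M \<and>
      length (snd (trans (then_machine K P M) q as)) = K + tapes M \<and>
      set (snd (trans (then_machine K P M) q as)) \<subseteq> {..<symbols M} \<times> {-1, 0, 1}"
    if q: "q < ?e + states M" and as: "length as = K + tapes M" "set as \<subseteq> {..<symbols M}" for q as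
  proof (cases "q < ?e")
    case True
    have "good_instr (K + tapes M) (?e + states M) (code_of P ! q)"
      using True assms(1) M by (intro good_instr_code_of[of _ P]) auto
    from instr_trans_wf[OF this M(3) as] True show ?thesis
      by (simp add: then_machine_def)
  next
    case False
    have "set (drop K as) \<subseteq> {..<symbols M}" using as(2) by (auto dest: in_set_dropD)
    then have w: "fst (trans M (q - ?e) (drop K as)) < states M"
      "length (snd (trans M (q - ?e) (drop K as))) = tapes M"
      "set (snd (trans M (q - ?e) (drop K as))) \<subseteq> {..<symbols M} \<times> {-1, 0, 1}"
      using MM[of "q - ?e" "drop K as"] q as False by auto
    have sh: "then_shift ?e p < ?e + states M" if "p < states M" for p
      using that M(2) by (simp add: then_shift_def)
    have "set (map (\<lambda>a. (a, 0::int)) (take K as)) \<subseteq> {..<symbols M} \<times> {-1, 0, 1}"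
      using as(2) by (auto dest: in_set_takeD)
    then show ?thesis using False as w(2,3) sh[OF w(1)]
      by (simp add: then_machine_def Let_def)
  qed
  then show ?thesis using M by (simp add: wf_tm_def then_machine_def)
qed

text \<open>Tapes are compared by \<open>view\<close> because the program leaves its output at some
  absolute position, whereas \<open>init\<close> places the input at 0.\<close>

definition then_sim :: "nat \<Rightarrow> prog \<Rightarrow> config \<Rightarrow> config \<Rightarrow> bool" where
  "then_sim K P c' c \<longleftrightarrow> fst c' = then_shift (plen P + 3) (fst c) \<and> K \<le> length (snd c') \<and>
     map view (drop K (snd c')) = map view (snd c)"

lemma then_sim_step:
  assumes "then_sim K P c' c"
  shows "then_sim K P (step (then_machine K P M) c') (step M c)"
proof (cases "halted c")
  case True
  then have "halted c'" using assms by (auto simp: halted_def then_sim_def then_shift_def)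
  with True assms show ?thesis by (simp add: step_def)
next
  case False
  obtain q tps' where c': "c' = (q, tps')" by (cases c')
  obtain p tps where c: "c = (p, tps)" by (cases c)
  have q: "q = plen P + 3 + p" and K: "K \<le> length tps'" and v: "map view (drop K tps') = map view tps"
    using assms False by (auto simp: then_sim_def then_shift_def c c' halted_def split: if_splits)
  have nh: "\<not> halted c'" using q c' by (simp add: halted_def)
  have sc: "drop K (map scan tps') = map scan tps"
  proof -
    have "map (\<lambda>f. f 0) (map view (drop K tps')) = map (\<lambda>f. f 0) (map view tps)" using v by simp
    then have "map scan (drop K tps') = map scan tps"
      by (simp add: comp_def scan_view[symmetric])
    then show ?thesis by (simp add: drop_map)
  qed
  let ?r = "trans M p (map scan tps)"
  have "map2 act (map (\<lambda>a. (a, 0)) (take K (map scan tps')) @ snd ?r) tps' =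
      map2 act (map (\<lambda>a. (a, 0)) (take K (map scan tps'))) (take K tps') @ map2 act (snd ?r) (drop K tps')"
    using K by (simp add: zip_append1)
  then have s': "step (then_machine K P M) c' = (then_shift (plen P + 3) (fst ?r),
      map2 act (map (\<lambda>a. (a, 0)) (take K (map scan tps'))) (take K tps') @ map2 act (snd ?r) (drop K tps'))"
    using nh q sc by (simp add: step_def c' then_machine_def Let_def)
  have s: "step M c = (fst ?r, map2 act (snd ?r) tps)"
    using False by (simp add: step_def c Let_def)
  have "map view (map2 act (snd ?r) (drop K tps')) = map view (map2 act (snd ?r) tps)"
  proof (rule nth_equalityI)
    show "length (map view (map2 act (snd ?r) (drop K tps'))) = length (map view (map2 act (snd ?r) tps))"
      using arg_cong[OF v, of length] by simp
  next
    fix i assume i: "i < length (map view (map2 act (snd ?r) (drop K tps')))"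
    then have i': "i < length tps" using arg_cong[OF v, of length] by simp
    have "view (drop K tps' ! i) = view (tps ! i)"
      using arg_cong[OF v, of "\<lambda>l. l ! i"] i i' by simp
    then show "map view (map2 act (snd ?r) (drop K tps')) ! i = map view (map2 act (snd ?r) tps) ! i"
      using i i' by (cases "snd ?r ! i") (simp add: view_act)
  qed
  then show ?thesis using K unfolding s s' by (simp add: then_sim_def)
qed

text \<open>Puts a compiled reduction in front of an arbitrary machine, about which only its answer
  on the reduced input is known. All its other tapes must have been left empty.\<close>

lemma answers_then_machine:
  assumes "exec P s n s'" "regs P \<subseteq> {..<K + tapes M}" "wf_tm M"
    "s = (\<lambda>i. if i < length xs then xs ! i else [])"
    "\<And>j. j < tapes M \<Longrightarrow> s' (K + j) = (if j = 0 then y else [])"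
    "answers M [y] t b"
  shows "\<exists>t' \<le> n + 1 + t. answers (then_machine K P M) xs t' b"
proof -
  let ?M = "then_machine K P M"
  have K: "tapes ?M = K + tapes M" by (simp add: then_machine_def)
  have h: "hosts ?M 0 (code_of P)"
    by (auto simp: hosts_def then_machine_def fun_eq_iff)
  have "1 \<le> tapes M" using assms(3) by (simp add: wf_tm_def)
  with run_code_of[OF h assms(1) _ _ assms(4)] assms(2) K
  obtain n' tps' where n': "n' \<le> n + 1" "run ?M xs n' = (plen P + 3, tps')" "represents ?M s' tps'"
    by auto
  have 0: "then_sim K P (plen P + 3, tps') (init M [y])"
    unfolding then_sim_def
  proof (intro conjI)
    show "map view (drop K (snd (plen P + 3, tps'))) = map view (snd (init M [y]))"
    proof (rule nth_equalityI)
      show "length (map view (drop K (snd (plen P + 3, tps')))) = length (map view (snd (init M [y])))"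
        using n'(3) K by (simp add: represents_def init_def)
    next
      fix i assume "i < length (map view (drop K (snd (plen P + 3, tps'))))"
      then have i: "i < tapes M" using n'(3) K by (auto simp: represents_def)
      then have "view (tps' ! (K + i)) = stack_view (s' (K + i))" using n'(3) K by (simp add: represents_def)
      then show "map view (drop K (snd (plen P + 3, tps'))) ! i = map view (snd (init M [y])) ! i"
        using i n'(3) K assms(5)[OF i] by (auto simp: represents_def init_def view_input_tape)
    qed
  qed (use n'(3) K in \<open>auto simp: represents_def then_shift_def init_def\<close>)
  have "then_sim K P ((step ?M ^^ m) (plen P + 3, tps')) (run M [y] m)" for m
    unfolding run_def by (induction m) (auto simp: 0 intro: then_sim_step)
  then have "then_sim K P (run ?M xs (t + n')) (run M [y] t)"
    using n'(2) by (simp add: run_def funpow_add)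
  then have "answers ?M xs (t + n') b"
    using assms(6) by (auto simp: answers_def then_sim_def then_shift_def)
  then show ?thesis using n'(1) by (intro exI[of _ "t + n'"]) auto
qed

section \<open>Data as binary trees\<close>

datatype tree = Leaf | Node tree tree

text \<open>In this preorder code a tree determines where it ends, so that trees can be stacked in
  one register without separators.\<close>

fun bits :: "tree \<Rightarrow> bool list" where
  "bits Leaf = [False]"
| "bits (Node a b) = True # bits a @ bits b"

fun tree_list :: "tree \<Rightarrow> tree list" where
  "tree_list Leaf = []"
| "tree_list (Node a b) = a # tree_list b"

class codable =
  fixes tree_of :: "'a \<Rightarrow> tree" and of_tree :: "tree \<Rightarrow> 'a"
  assumes of_tree_of [simp]: "of_tree (tree_of x) = x"

instantiation tree :: codable
begin
definition tree_of_tree :: "tree \<Rightarrow> tree" where [simp]: "tree_of_tree x = x"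
definition of_tree_tree :: "tree \<Rightarrow> tree" where [simp]: "of_tree_tree x = x"
instance by standard simp
end

instantiation bool :: codable
begin
definition tree_of_bool :: "bool \<Rightarrow> tree" where [simp]: "tree_of_bool b = (if b then Node Leaf Leaf else Leaf)"
definition of_tree_bool :: "tree \<Rightarrow> bool" where "of_tree_bool t = (t \<noteq> Leaf)"
instance by standard (simp add: of_tree_bool_def)
end

text \<open>Unary: these naturals are counters and ranks, bounded by polynomials. Vertices and time
  steps of instances are handled as bit lists instead.\<close>

instantiation nat :: codable
begin
primrec tree_of_nat :: "nat \<Rightarrow> tree" where
  "tree_of_nat 0 = Leaf"
| "tree_of_nat (Suc n) = Node Leaf (tree_of_nat n)"
definition of_tree_nat :: "tree \<Rightarrow> nat" where "of_tree_nat t = length (tree_list t)"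
instance
proof
  fix n :: nat
  show "of_tree (tree_of n) = n" unfolding of_tree_nat_def by (induction n) auto
qed
end

instantiation list :: (codable) codable
begin
primrec tree_of_list :: "'a list \<Rightarrow> tree" where
  "tree_of_list [] = Leaf"
| "tree_of_list (x # xs) = Node (tree_of x) (tree_of_list xs)"
definition of_tree_list :: "tree \<Rightarrow> 'a list" where "of_tree_list t = map of_tree (tree_list t)"
instance
proof
  fix xs :: "'a list"
  show "of_tree (tree_of xs) = xs" unfolding of_tree_list_def by (induction xs) auto
qed
end

fun car :: "tree \<Rightarrow> tree" where
  "car Leaf = Leaf"
| "car (Node a b) = a"

fun cdr :: "tree \<Rightarrow> tree" where
  "cdr Leaf = Leaf"
| "cdr (Node a b) = b"

instantiation prod :: (codable, codable) codable
begin
definition tree_of_prod :: "'a \<times> 'b \<Rightarrow> tree" where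
  "tree_of_prod z = Node (tree_of (fst z)) (tree_of (snd z))"
definition of_tree_prod :: "tree \<Rightarrow> 'a \<times> 'b" where
  "of_tree_prod t = (of_tree (car t), of_tree (cdr t))"
instance by standard (simp add: of_tree_prod_def tree_of_prod_def)
end

lemma tree_of_pair [simp]: "tree_of (x, y) = Node (tree_of x) (tree_of y)"
  by (simp add: tree_of_prod_def)

lemma tree_of_inj [simp]: "tree_of x = tree_of y \<longleftrightarrow> x = y"
  by (metis of_tree_of)

definition sz :: "'a::codable \<Rightarrow> nat" where
  "sz x = length (bits (tree_of x))"

lemma sz_simps [simp]:
  "sz (x, y) = 1 + sz x + sz y"
  "sz ([] :: 'a list) = 1"
  "sz (x # xs) = 1 + sz x + sz xs"
  "sz b = (if b then 3 else 1)"
  "sz (0::nat) = 1"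
  "sz (Suc n) = 2 + sz n"
  "sz Leaf = 1"
  "sz (Node t u) = 1 + sz t + sz u"
  for x :: "'a::codable" and y :: "'b::codable" and xs :: "'a list"
  by (auto simp: sz_def)

lemma sz_nat: "sz (n :: nat) = 2 * n + 1"
  by (induction n) auto

lemma sz_append: "sz (xs @ ys) + 1 = sz xs + sz ys"
  by (induction xs) auto

lemma sz_rev: "sz (rev xs) = sz xs"
proof (induction xs)
  case (Cons x xs)
  then show ?case using sz_append[of "rev xs" "[x]"] by simp
qed simp

lemma length_le_sz: "length xs < sz xs"
  by (induction xs) auto

lemma sz_mem: "x \<in> set xs \<Longrightarrow> sz x \<le> sz xs"
  by (induction xs) auto

lemma sz_list_le: "(\<And>x. x \<in> set xs \<Longrightarrow> sz x \<le> b) \<Longrightarrow> sz xs \<le> 1 + length xs * (b + 1)"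
  by (induction xs) (force simp: algebra_simps)+

section \<open>Polynomial bounds\<close>

text \<open>Since the base is at least 2, a single exponent also absorbs constant factors and
  summands, and no coefficients have to be carried along.\<close>

definition pb :: "('a \<Rightarrow> nat) \<Rightarrow> ('a \<Rightarrow> nat) \<Rightarrow> bool" where
  "pb S f \<longleftrightarrow> (\<exists>c. \<forall>x. f x \<le> (S x + 2) ^ c)"

lemma pb_mono: "pb S g \<Longrightarrow> (\<And>x. f x \<le> g x) \<Longrightarrow> pb S f"
  unfolding pb_def by (meson order_trans)

lemma pb_const: "pb S (\<lambda>x. k)"
proof -
  have "k \<le> (S x + 2) ^ k" for x
    using less_exp[of k] power_mono[of 2 "S x + 2" k] by linarith
  then show ?thesis unfolding pb_def by blast
qed

lemma pb_self: "pb S S"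
  unfolding pb_def by (intro exI[of _ 1]) simp

lemma pb_mult:
  assumes "pb S f" "pb S g"
  shows "pb S (\<lambda>x. f x * g x)"
proof -
  obtain a b where "\<And>x. f x \<le> (S x + 2) ^ a" "\<And>x. g x \<le> (S x + 2) ^ b"
    using assms unfolding pb_def by blast
  then have "f x * g x \<le> (S x + 2) ^ (a + b)" for x
    unfolding power_add by (intro mult_mono) auto
  then show ?thesis unfolding pb_def by blast
qed

text \<open>A sum is at most \<open>(f x + 1) * (g x + 1)\<close>, which reduces addition to
  multiplication.\<close>

lemma pb_add:
  assumes "pb S f" "pb S g"
  shows "pb S (\<lambda>x. f x + g x)"
proof -
  have "pb S (\<lambda>x. (f x + 1) * (g x + 1))" if "pb S (\<lambda>x. f x + 1)" "pb S (\<lambda>x. g x + 1)"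
    using pb_mult that by blast
  moreover have "pb S (\<lambda>x. f x + 1)" if f: "pb S f" for f
  proof -
    obtain a where "\<And>x. f x \<le> (S x + 2) ^ a" using f unfolding pb_def by blast
    moreover have "(1::nat) \<le> (S x + 2) ^ a" for x by simp
    ultimately have "f x + 1 \<le> (S x + 2) ^ a * 2" for x
      by (metis add_mono mult_2_right)
    also have "(S x + 2) ^ a * 2 \<le> (S x + 2) ^ (a + 1)" for x by simp
    finally show ?thesis unfolding pb_def by blast
  qed
  ultimately have "pb S (\<lambda>x. (f x + 1) * (g x + 1))" using assms by blast
  then show ?thesis by (rule pb_mono) simp
qed

lemma pb_power: "pb S f \<Longrightarrow> pb S (\<lambda>x. f x ^ c)"
  by (induction c) (auto intro: pb_mult pb_const)

lemmas pb_intros = pb_const pb_add pb_mult pb_power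

lemma pb_poly:
  assumes "pb S f"
  shows "pb S (\<lambda>x. poly (p :: nat poly) (f x))"
proof (induction p)
  case (pCons a p)
  then show ?case by (simp add: pb_intros assms)
qed (simp add: pb_const)

section \<open>Tree operations on stacks\<close>

text \<open>Register 2 holds a stack of trees; 3, 4 and 5 are scratch registers.\<close>

lemma top_iff: "top_symbol xs = 2 \<longleftrightarrow> xs \<noteq> [] \<and> hd xs" "top_symbol xs = Suc 0 \<longleftrightarrow> xs \<noteq> [] \<and> \<not> hd xs"
  by (auto simp: top_symbol_def bit_symbol_def split: list.splits)

text \<open>Register 5 counts in unary the subtrees still to be read: a node replaces one by two, a
  leaf removes one. The code of the tree arrives reversed on \<open>t\<close>.\<close>

definition pop_tree :: "nat \<Rightarrow> prog" where
  "pop_tree t = Push 5 True ;; While 5 {2} (Cond 2 {2}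
     (Pop 2 ;; Push t True ;; Push 5 True) (Pop 2 ;; Push t False ;; Pop 5))"

text \<open>In continuation style: an execution of the remaining loop is extended by the part that
  consumes \<open>u\<close>. The two subtrees of a node can then be chained inside a single loop.
  The constant 9 per bit is at most 7 steps of the body and 2 of the loop.\<close>

lemma pop_tree_loop:
  assumes "t \<notin> {2, 5}" "s 2 = bits u @ r" "s 5 = True # c"
    "exec (While 5 {2} (Cond 2 {2} (Pop 2 ;; Push t True ;; Push 5 True) (Pop 2 ;; Push t False ;; Pop 5)))
      (s(2 := r, t := rev (bits u) @ s t, 5 := c)) n s'"
  shows "exec (While 5 {2} (Cond 2 {2} (Pop 2 ;; Push t True ;; Push 5 True) (Pop 2 ;; Push t False ;; Pop 5)))
      s (n + 9 * length (bits u)) s'"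
  using assms(2-)
proof (induction u arbitrary: s r c n)
  case Leaf
  have eq: "s(2 := r, t := rev (bits Leaf) @ s t, 5 := c) =
      (s(2 := r))(t := False # s t, 5 := c)" by simp
  have 1: "exec (Cond 2 {2} (Pop 2 ;; Push t True ;; Push 5 True) (Pop 2 ;; Push t False ;; Pop 5))
      s 6 ((s(2 := r))(t := False # s t, 5 := c))"
    apply (rule exec.CondF[of _ _ _ _ 4])
    subgoal using Leaf by (simp add: top_iff)
    subgoal
      apply (rule exec.Seq[OF exec.Pop[OF order_refl refl] exec.Seq[OF exec.Push[OF order_refl refl] exec.Pop[of 1]]])
      using Leaf assms(1) by (auto simp: fun_eq_iff)
    subgoal by simp
    done
  show ?case
    by (rule exec.WhileT[OF _ 1 Leaf(3)[unfolded eq]]) (use Leaf in \<open>auto simp: top_iff\<close>)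
next
  case (Node u1 u2)
  let ?W = "While 5 {2} (Cond 2 {2} (Pop 2 ;; Push t True ;; Push 5 True) (Pop 2 ;; Push t False ;; Pop 5))"
  let ?s1 = "s(2 := bits u1 @ bits u2 @ r, t := True # s t, 5 := True # True # c)"
  let ?s2 = "?s1(2 := bits u2 @ r, t := rev (bits u1) @ ?s1 t, 5 := True # c)"
  let ?s3 = "?s2(2 := r, t := rev (bits u2) @ ?s2 t, 5 := c)"
  have eq: "?s3 = s(2 := r, t := rev (bits (Node u1 u2)) @ s t, 5 := c)"
    using assms(1) by (auto simp: fun_eq_iff)
  have 3: "exec ?W ?s3 n s'" unfolding eq by (rule Node.prems(3))
  have 2: "exec ?W ?s2 (n + 9 * length (bits u2)) s'"
    by (rule Node.IH(2)[of ?s2 r c, OF _ _ 3]) (use assms(1) in auto)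
  have 1: "exec ?W ?s1 (n + 9 * length (bits u2) + 9 * length (bits u1)) s'"
    by (rule Node.IH(1)[of ?s1 "bits u2 @ r" "True # c", OF _ _ 2]) (use assms(1) in auto)
  have 2: "exec (Cond 2 {2} (Pop 2 ;; Push t True ;; Push 5 True) (Pop 2 ;; Push t False ;; Pop 5)) s 7 ?s1"
    apply (rule exec.CondT[of _ _ _ _ 5])
    subgoal using Node by (simp add: top_iff)
    subgoal
      apply (rule exec.Seq[OF exec.Pop[OF order_refl refl] exec.Seq[OF exec.Push[OF order_refl refl] exec.Push[of 2]]])
      using Node assms(1) by (auto simp: fun_eq_iff)
    subgoal by simp
    done
  show ?case
    by (rule exec.WhileT[OF _ 2 1]) (use Node in \<open>auto simp: top_iff\<close>)
qed

lemma exec_WhileF: "top_symbol (s r) \<notin> A \<Longrightarrow> 1 \<le> n \<Longrightarrow> s' = s \<Longrightarrow> exec (While r A P) s n s'"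
  by (simp add: exec.WhileF)

lemma exec_pop_tree:
  assumes "t \<notin> {2, 5}" "s 2 = bits u @ r" "s 5 = []" "s' = s(2 := r, t := rev (bits u) @ s t)"
    "3 + 9 * length (bits u) \<le> n"
  shows "exec (pop_tree t) s n s'"
proof -
  have "exec (pop_tree t) s (3 + 9 * length (bits u)) (s(2 := r, t := rev (bits u) @ s t))"
    unfolding pop_tree_def
    apply (rule exec.Seq[OF exec.Push[OF order_refl refl] pop_tree_loop])
         apply (use assms in auto)[3]
     apply (rule exec_WhileF[OF _ order_refl])
    using assms apply (auto simp: fun_eq_iff top_iff)
    done
  with assms(4,5) show ?thesis using exec_mono by blast
qed

definition move :: "nat \<Rightarrow> nat \<Rightarrow> prog" where
  "move r q = While r {1, 2} (Cond r {2} (Pop r ;; Push q True) (Pop r ;; Push q False))"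

lemma exec_move:
  assumes "r \<noteq> q" "s' = s(r := [], q := rev (s r) @ s q)" "1 + 7 * length (s r) \<le> n"
  shows "exec (move r q) s n s'"
  using assms
proof (induction "s r" arbitrary: s n)
  case Nil
  then have "s' = s" "top_symbol (s r) \<notin> {1, 2}" by (auto simp: fun_eq_iff top_iff)
  with Nil.prems show ?case unfolding move_def by (auto intro!: exec.WhileF)
next
  case (Cons b xs)
  let ?s1 = "s(r := xs, q := b # s q)"
  have 1: "exec (Cond r {2} (Pop r ;; Push q True) (Pop r ;; Push q False)) s 5 ?s1"
  proof (cases b)
    case True
    then show ?thesis
      by (intro exec.CondT[OF _ exec.Seq[OF exec.Pop[OF order_refl refl] exec.Push[of 2]]])
        (use Cons(2)[symmetric] assms(1) in \<open>auto simp: top_iff fun_eq_iff\<close>)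
  next
    case False
    then show ?thesis
      by (intro exec.CondF[OF _ exec.Seq[OF exec.Pop[OF order_refl refl] exec.Push[of 2]]])
        (use Cons(2)[symmetric] assms(1) in \<open>auto simp: top_iff fun_eq_iff\<close>)
  qed
  have 2: "exec (move r q) ?s1 (1 + 7 * length xs) s'"
    by (rule Cons(1)) (use Cons(2)[symmetric] Cons(4) assms(1) in \<open>auto simp: fun_eq_iff\<close>)
  show ?case unfolding move_def
    by (rule exec.WhileT[OF _ 1 2[unfolded move_def]]) (use Cons(2)[symmetric] Cons(5) in \<open>auto simp: top_iff\<close>)
qed

definition clear :: "nat \<Rightarrow> prog" where
  "clear r = While r {1, 2} (Pop r)"

lemma exec_clear:
  assumes "s' = s(r := [])" "1 + 3 * length (s r) \<le> n"
  shows "exec (clear r) s n s'"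
  using assms
proof (induction "s r" arbitrary: s n)
  case Nil
  then have "s' = s" "top_symbol (s r) \<notin> {1, 2}" by (auto simp: fun_eq_iff top_iff)
  with Nil.prems show ?case unfolding clear_def by (auto intro!: exec.WhileF)
next
  case (Cons b xs)
  have "exec (clear r) (s(r := xs)) (1 + 3 * length xs) s'"
    by (rule Cons(1)) (use Cons(2,3) in auto)
  moreover have "exec (Pop r) s 1 (s(r := xs))" using Cons(2)[symmetric] by (auto intro: exec.Pop)
  ultimately show ?case unfolding clear_def
    using exec.WhileT[of s r "{1, 2}" "Pop r" 1 "s(r := xs)" "1 + 3 * length xs" s' n]
      Cons(2)[symmetric] Cons(4) by (auto simp: top_iff)
qed

definition copy_move :: "nat \<Rightarrow> nat \<Rightarrow> nat \<Rightarrow> prog" where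
  "copy_move r q p = While r {1, 2} (Cond r {2}
     (Pop r ;; Push q True ;; Push p True) (Pop r ;; Push q False ;; Push p False))"

lemma exec_copy_move:
  assumes "distinct [r, q, p]" "s' = s(r := [], q := rev (s r) @ s q, p := rev (s r) @ s p)"
    "1 + 9 * length (s r) \<le> n"
  shows "exec (copy_move r q p) s n s'"
  using assms(2,3)
proof (induction "s r" arbitrary: s n)
  case Nil
  then have "s' = s" "top_symbol (s r) \<notin> {1, 2}" using assms(1) by (auto simp: fun_eq_iff top_iff)
  with Nil.prems show ?case unfolding copy_move_def by (auto intro!: exec.WhileF)
next
  case (Cons b xs)
  let ?s1 = "s(r := xs, q := b # s q, p := b # s p)"
  have 1: "exec (Cond r {2} (Pop r ;; Push q True ;; Push p True) (Pop r ;; Push q False ;; Push p False)) s 7 ?s1"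
  proof (cases b)
    case True
    then show ?thesis
      by (intro exec.CondT[OF _ exec.Seq[OF exec.Pop[OF order_refl refl] exec.Seq[OF exec.Push[OF order_refl refl] exec.Push[of 2]]]])
        (use Cons(2)[symmetric] assms(1) in \<open>auto simp: top_iff fun_eq_iff\<close>)
  next
    case False
    then show ?thesis
      by (intro exec.CondF[OF _ exec.Seq[OF exec.Pop[OF order_refl refl] exec.Seq[OF exec.Push[OF order_refl refl] exec.Push[of 2]]]])
        (use Cons(2)[symmetric] assms(1) in \<open>auto simp: top_iff fun_eq_iff\<close>)
  qed
  have 2: "exec (copy_move r q p) ?s1 (1 + 9 * length xs) s'"
    by (rule Cons(1)) (use Cons(2)[symmetric] Cons(3) assms(1) in \<open>auto simp: fun_eq_iff\<close>)
  show ?case unfolding copy_move_def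
    by (rule exec.WhileT[OF _ 1 2[unfolded copy_move_def]]) (use Cons(2)[symmetric] Cons(4) in \<open>auto simp: top_iff\<close>)
qed

definition clean :: "stacks \<Rightarrow> bool" where
  "clean s \<longleftrightarrow> s 3 = [] \<and> s 4 = [] \<and> s 5 = []"

lemma clean_upd [simp]: "clean (s(2 := xs)) = clean s"
  by (simp add: clean_def)

definition drop_tree :: prog where "drop_tree = pop_tree 3 ;; clear 3"
definition dup_tree :: prog where "dup_tree = pop_tree 3 ;; copy_move 3 2 4 ;; move 4 3 ;; move 3 2"
definition swap_tree :: prog where "swap_tree = pop_tree 3 ;; pop_tree 4 ;; move 3 2 ;; move 4 2"

lemma regs_tree_ops [simp]:
  "regs drop_tree = {2, 3, 5}" "regs dup_tree = {2, 3, 4, 5}" "regs swap_tree = {2, 3, 4, 5}"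
  by (auto simp: drop_tree_def dup_tree_def swap_tree_def pop_tree_def clear_def move_def copy_move_def)

lemma exec_drop_tree:
  assumes "clean s" "s 2 = bits u @ r" "s' = s(2 := r)" "12 * length (bits u) + 4 \<le> n"
  shows "exec drop_tree s n s'"
  unfolding drop_tree_def
  by (rule exec.Seq[OF exec_pop_tree[where u = u and r = r, OF _ _ _ refl order_refl]
        exec_clear[OF _ order_refl]])
    (use assms in \<open>auto simp: clean_def fun_eq_iff\<close>)

lemma exec_dup_tree:
  assumes "clean s" "s 2 = bits u @ r" "s' = s(2 := bits u @ bits u @ r)" "32 * length (bits u) + 6 \<le> n"
  shows "exec dup_tree s n s'"
  unfolding dup_tree_def
  by (rule exec.Seq[OF exec_pop_tree[where u = u and r = r, OF _ _ _ refl order_refl]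
        exec.Seq[OF exec_copy_move[OF _ refl order_refl]
          exec.Seq[OF exec_move[OF _ refl order_refl] exec_move[OF _ _ order_refl] order_refl] order_refl]])
    (use assms in \<open>auto simp: clean_def fun_eq_iff\<close>)

lemma exec_swap_tree:
  assumes "clean s" "s 2 = bits u @ bits v @ r" "s' = s(2 := bits v @ bits u @ r)"
    "16 * length (bits u) + 16 * length (bits v) + 8 \<le> n"
  shows "exec swap_tree s n s'"
  unfolding swap_tree_def
  by (rule exec.Seq[OF exec_pop_tree[where u = u and r = "bits v @ r", OF _ _ _ refl order_refl]
        exec.Seq[OF exec_pop_tree[where u = v and r = r, OF _ _ _ refl order_refl]
          exec.Seq[OF exec_move[OF _ refl order_refl] exec_move[OF _ _ order_refl] order_refl] order_refl]])
    (use assms in \<open>auto simp: clean_def fun_eq_iff\<close>)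

fun pushes :: "bool list \<Rightarrow> prog" where
  "pushes [] = Skip"
| "pushes (b # bs) = pushes bs ;; Push 2 b"

lemma regs_pushes: "regs (pushes bs) \<subseteq> {2}"
  by (induction bs) auto

lemma exec_pushes: "exec (pushes bs) s (2 * length bs) (s(2 := bs @ s 2))"
proof (induction bs)
  case Nil
  then show ?case using exec.Skip[of s 0] by simp
next
  case (Cons b bs)
  then show ?case using exec.Seq[OF Cons exec.Push[OF order_refl refl, where r = 2 and b = b] order_refl]
    by (simp add: fun_upd_def cong: if_cong)
qed

section \<open>Functions computable on trees\<close>

text \<open>\<open>cp S f\<close>: computable in time polynomial in the budget \<open>S\<close>, which bounds the size of the argument.\<close>

definition cp :: "('a::codable \<Rightarrow> nat) \<Rightarrow> ('a \<Rightarrow> 'b::codable) \<Rightarrow> bool" where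
  "cp S f \<longleftrightarrow> (\<forall>x. sz x \<le> S x) \<and>
     (\<exists>P c. regs P \<subseteq> {2, 3, 4, 5} \<and>
       (\<forall>x s r. clean s \<longrightarrow> s 2 = bits (tree_of x) @ r \<longrightarrow>
          exec P s ((S x + 2) ^ c) (s(2 := bits (tree_of (f x)) @ r))))"

abbreviation pt :: "('a::codable \<Rightarrow> 'b::codable) \<Rightarrow> bool" where
  "pt \<equiv> cp sz"

lemma cpI:
  assumes "\<And>x. sz x \<le> S x" "regs P \<subseteq> {2, 3, 4, 5}" "pb S T"
    "\<And>x s r. clean s \<Longrightarrow> s 2 = bits (tree_of x) @ r \<Longrightarrow> exec P s (T x) (s(2 := bits (tree_of (f x)) @ r))"
  shows "cp S f"
proof -
  obtain c where "\<And>x. T x \<le> (S x + 2) ^ c" using assms(3) unfolding pb_def by blast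
  with assms show ?thesis unfolding cp_def by (meson exec_mono)
qed

lemma cpE:
  assumes "cp S f"
  obtains P T where "regs P \<subseteq> {2, 3, 4, 5}" "pb S T"
    "\<And>x s r. clean s \<Longrightarrow> s 2 = bits (tree_of x) @ r \<Longrightarrow> exec P s (T x) (s(2 := bits (tree_of (f x)) @ r))"
proof -
  obtain P c where "regs P \<subseteq> {2, 3, 4, 5}"
    "\<And>x s r. clean s \<Longrightarrow> s 2 = bits (tree_of x) @ r \<Longrightarrow>
      exec P s ((S x + 2) ^ c) (s(2 := bits (tree_of (f x)) @ r))"
    using assms unfolding cp_def by blast
  moreover have "pb S (\<lambda>x. (S x + 2) ^ c)" by (intro pb_intros pb_self)
  ultimately show ?thesis using that by blast
qed

lemma cp_base: "cp S f \<Longrightarrow> sz x \<le> S x"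
  by (simp add: cp_def)

lemma cp_pb_sz: "cp S f \<Longrightarrow> pb S sz"
  by (rule pb_mono[OF pb_self]) (rule cp_base)

lemma pb_sz:
  assumes "cp S f"
  shows "pb S (\<lambda>x. sz (f x))"
proof -
  obtain P T where P: "pb S T"
    "\<And>x s r. clean s \<Longrightarrow> s 2 = bits (tree_of x) @ r \<Longrightarrow> exec P s (T x) (s(2 := bits (tree_of (f x)) @ r))"
    using assms by (rule cpE) blast
  have "sz (f x) \<le> sz x + T x" for x
    using exec_length[OF P(2)[of "(\<lambda>_. [])(2 := bits (tree_of x))" x "[]"], of 2]
    by (simp add: sz_def clean_def)
  moreover have "pb S (\<lambda>x. sz x + T x)" by (intro pb_add P cp_pb_sz[OF assms])
  ultimately show ?thesis by (rule pb_mono[rotated])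
qed

text \<open>Programs only see trees, so a change of type that preserves the tree of the result is
  free.\<close>

lemma cp_retype: "cp S g \<Longrightarrow> (\<And>x. tree_of (f x) = tree_of (g x)) \<Longrightarrow> cp S f"
  by (simp add: cp_def)

lemma cp_id: "(\<And>x. sz x \<le> S x) \<Longrightarrow> cp S (\<lambda>x. x)"
  by (rule cpI[of S Skip "\<lambda>_. 0"]) (auto simp: pb_const fun_upd_idem exec.Skip)

lemma cp_const: "(\<And>x. sz x \<le> S x) \<Longrightarrow> cp S (\<lambda>x. k)"
proof (rule cpI[of S "drop_tree ;; pushes (bits (tree_of k))" "\<lambda>x. 12 * S x + 4 + 2 * length (bits (tree_of k))"])
  fix x :: 'a and s r
  assume s: "\<And>x. sz x \<le> S x" "clean s" "s 2 = bits (tree_of x) @ r"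
  have "12 * length (bits (tree_of x)) + 4 \<le> 12 * S x + 4" using s(1)[of x] by (simp add: sz_def)
  then show "exec (drop_tree ;; pushes (bits (tree_of k))) s (12 * S x + 4 + 2 * length (bits (tree_of k)))
      (s(2 := bits (tree_of k) @ r))"
    using exec.Seq[OF exec_drop_tree[OF s(2,3) refl] exec_pushes order_refl, of _ "bits (tree_of k)"] by simp
qed (use regs_pushes in \<open>force intro!: pb_intros pb_self\<close>)+

text \<open>The outer function is timed in the size of its own argument, which is polynomial in the
  budget; hence only the inner function has to carry a budget beyond the size.\<close>

lemma cp_comp:
  fixes g :: "'a::codable \<Rightarrow> 'b::codable" and f :: "'b \<Rightarrow> 'c::codable"
  assumes g: "cp S g" and f: "pt f"
  shows "cp S (\<lambda>x. f (g x))"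
proof -
  obtain P T where P: "regs P \<subseteq> {2, 3, 4, 5}" "pb S T"
    "\<And>x s r. clean s \<Longrightarrow> s 2 = bits (tree_of x) @ r \<Longrightarrow> exec P s (T x) (s(2 := bits (tree_of (g x)) @ r))"
    using g by (rule cpE) blast
  obtain Q c where Q: "regs Q \<subseteq> {2, 3, 4, 5}"
    "\<And>x s r. clean s \<Longrightarrow> s 2 = bits (tree_of x) @ r \<Longrightarrow>
      exec Q s ((sz x + 2) ^ c) (s(2 := bits (tree_of (f x)) @ r))"
    using f unfolding cp_def by blast
  show ?thesis
  proof (rule cpI[of S "P ;; Q" "\<lambda>x. T x + (sz (g x) + 2) ^ c"])
    show "pb S (\<lambda>x. T x + (sz (g x) + 2) ^ c)" by (intro pb_intros P(2) pb_sz[OF g])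
    fix x :: 'a and s r assume s: "clean s" "s 2 = bits (tree_of x) @ r"
    show "exec (P ;; Q) s (T x + (sz (g x) + 2) ^ c) (s(2 := bits (tree_of (f (g x))) @ r))"
      using exec.Seq[OF P(3)[OF s] Q(2)[of _ "g x" r]] s(1) by simp
  qed (use P(1) Q(1) cp_base[OF g] in auto)
qed

lemma cp_pair:
  fixes f :: "'a::codable \<Rightarrow> 'b::codable" and g :: "'a \<Rightarrow> 'c::codable"
  assumes f: "cp S f" and g: "cp S g"
  shows "cp S (\<lambda>x. (f x, g x))"
proof -
  obtain P T where P: "regs P \<subseteq> {2, 3, 4, 5}" "pb S T"
    "\<And>x s r. clean s \<Longrightarrow> s 2 = bits (tree_of x) @ r \<Longrightarrow> exec P s (T x) (s(2 := bits (tree_of (f x)) @ r))"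
    using f by (rule cpE) blast
  obtain Q U where Q: "regs Q \<subseteq> {2, 3, 4, 5}" "pb S U"
    "\<And>x s r. clean s \<Longrightarrow> s 2 = bits (tree_of x) @ r \<Longrightarrow> exec Q s (U x) (s(2 := bits (tree_of (g x)) @ r))"
    using g by (rule cpE) blast
  let ?t = "\<lambda>x. (32 * sz x + 6) + (U x + ((16 * sz (g x) + 16 * sz x + 8) + (T x + 2)))"
  show ?thesis
  proof (rule cpI[of S "dup_tree ;; Q ;; swap_tree ;; P ;; Push 2 True" ?t])
    show "pb S ?t" by (intro pb_intros P(2) Q(2) pb_sz[OF g] cp_pb_sz[OF g])
    fix x :: 'a and s r assume s: "clean s" "s 2 = bits (tree_of x) @ r"
    show "exec (dup_tree ;; Q ;; swap_tree ;; P ;; Push 2 True) s (?t x) (s(2 := bits (tree_of (f x, g x)) @ r))"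
    proof (rule exec.Seq[OF exec_dup_tree[OF s refl order_refl] exec.Seq[OF Q(3)[of _ x "bits (tree_of x) @ r"]
            exec.Seq[OF exec_swap_tree[of _ "tree_of (g x)" "tree_of x" r, OF _ _ refl order_refl]
             exec.Seq[OF P(3)[of _ x "bits (tree_of (g x)) @ r"] exec.Push[of 2] order_refl] order_refl] order_refl]])
    qed (use s in \<open>auto simp: sz_def\<close>)
  qed (use P(1) Q(1) cp_base[OF g] in auto)
qed

lemma cp_if_Leaf:
  fixes b :: "'a::codable \<Rightarrow> tree" and f g :: "'a \<Rightarrow> 'b::codable"
  assumes b: "cp S b" and f: "cp S f" and g: "cp S g"
  shows "cp S (\<lambda>x. if b x \<noteq> Leaf then f x else g x)"
proof -
  obtain P T where P: "regs P \<subseteq> {2, 3, 4, 5}" "pb S T"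
    "\<And>x s r. clean s \<Longrightarrow> s 2 = bits (tree_of x) @ r \<Longrightarrow> exec P s (T x) (s(2 := bits (tree_of (f x)) @ r))"
    using f by (rule cpE) blast
  obtain Q U where Q: "regs Q \<subseteq> {2, 3, 4, 5}" "pb S U"
    "\<And>x s r. clean s \<Longrightarrow> s 2 = bits (tree_of x) @ r \<Longrightarrow> exec Q s (U x) (s(2 := bits (tree_of (g x)) @ r))"
    using g by (rule cpE) blast
  obtain B V where B: "regs B \<subseteq> {2, 3, 4, 5}" "pb S V"
    "\<And>x s r. clean s \<Longrightarrow> s 2 = bits (tree_of x) @ r \<Longrightarrow> exec B s (V x) (s(2 := bits (tree_of (b x)) @ r))"
    using b by (rule cpE) blast
  let ?t = "\<lambda>x. (32 * sz x + 6) + (V x + ((12 * sz (b x) + 4 + (T x + U x)) + 2))"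
  show ?thesis
  proof (rule cpI[of S "dup_tree ;; B ;; Cond 2 {2} (drop_tree ;; P) (drop_tree ;; Q)" ?t])
    show "pb S ?t" by (intro pb_intros P(2) Q(2) B(2) cp_pb_sz[OF g] pb_sz[OF b])
    fix x :: 'a and s r assume s: "clean s" "s 2 = bits (tree_of x) @ r"
    let ?s = "s(2 := bits (tree_of (b x)) @ bits (tree_of x) @ r)"
    have c: "exec (Cond 2 {2} (drop_tree ;; P) (drop_tree ;; Q)) ?s ((12 * sz (b x) + 4 + (T x + U x)) + 2)
        (s(2 := bits (tree_of (if b x \<noteq> Leaf then f x else g x)) @ r))"
    proof (cases "b x \<noteq> Leaf")
      case True
      have "exec drop_tree ?s (12 * sz (b x) + 4) (s(2 := bits (tree_of x) @ r))"
        by (rule exec_drop_tree[of _ "b x"]) (use s in \<open>auto simp: sz_def\<close>)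
      from exec.Seq[OF this P(3)[of _ x r], of "12 * sz (b x) + 4 + (T x + U x)"] s True
      show ?thesis by (intro exec.CondT[where n = "12 * sz (b x) + 4 + (T x + U x)"]) (cases "b x", auto simp: top_iff)+
    next
      case False
      have "exec drop_tree ?s (12 * sz (b x) + 4) (s(2 := bits (tree_of x) @ r))"
        by (rule exec_drop_tree[of _ "b x"]) (use s in \<open>auto simp: sz_def\<close>)
      from exec.Seq[OF this Q(3)[of _ x r], of "12 * sz (b x) + 4 + (T x + U x)"] s False
      show ?thesis by (intro exec.CondF[where n = "12 * sz (b x) + 4 + (T x + U x)"]) (auto simp: top_iff)
    qed
    show "exec (dup_tree ;; B ;; Cond 2 {2} (drop_tree ;; P) (drop_tree ;; Q)) s (?t x)
        (s(2 := bits (tree_of (if b x \<noteq> Leaf then f x else g x)) @ r))"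
      by (rule exec.Seq[OF exec_dup_tree[OF s refl order_refl] exec.Seq[OF B(3)[of _ x "bits (tree_of x) @ r"] _ order_refl]])
        (use s c in \<open>auto simp: sz_def\<close>)
  qed (use P(1) Q(1) B(1) cp_base[OF g] in auto)
qed

lemma cp_tree_of: "cp S f \<Longrightarrow> cp S (\<lambda>x. tree_of (f x))"
  by (erule cp_retype) simp

lemma cp_if:
  assumes "cp S b" "cp S f" "cp S g"
  shows "cp S (\<lambda>x. if b x then f x else g x)"
  by (rule cp_retype[OF cp_if_Leaf[OF cp_tree_of[OF assms(1)] assms(2,3)]]) auto

lemma pt_car: "pt car"
proof (rule cpI[of sz "Cond 2 {2} (Pop 2 ;; swap_tree ;; drop_tree) Skip" "\<lambda>x. 28 * sz x + 15"])
  fix x :: tree and s r assume s: "clean s" "s 2 = bits (tree_of x) @ r"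
  show "exec (Cond 2 {2} (Pop 2 ;; swap_tree ;; drop_tree) Skip) s (28 * sz x + 15) (s(2 := bits (tree_of (car x)) @ r))"
  proof (cases x)
    case Leaf
    then have "s = s(2 := bits (tree_of (car x)) @ r)" using s by auto
    then have "exec Skip s 0 (s(2 := bits (tree_of (car x)) @ r))" using exec.Skip by metis
    then show ?thesis using s Leaf by (intro exec.CondF[where n = 0]) (auto simp: top_iff)
  next
    case (Node a b)
    show ?thesis
      by (rule exec.CondT[where n = "28 * sz x + 13", OF _ exec.Seq[OF exec.Pop[OF order_refl refl]
              exec.Seq[OF exec_swap_tree[of _ a b r, OF _ _ refl order_refl]
                exec_drop_tree[of _ b "bits a @ r", OF _ _ _ order_refl] order_refl]]])
        (use s Node in \<open>auto simp: sz_def top_iff\<close>)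
  qed
qed (auto intro!: pb_intros pb_self)

lemma pt_cdr: "pt cdr"
proof (rule cpI[of sz "Cond 2 {2} (Pop 2 ;; drop_tree) Skip" "\<lambda>x. 12 * sz x + 15"])
  fix x :: tree and s r assume s: "clean s" "s 2 = bits (tree_of x) @ r"
  show "exec (Cond 2 {2} (Pop 2 ;; drop_tree) Skip) s (12 * sz x + 15) (s(2 := bits (tree_of (cdr x)) @ r))"
  proof (cases x)
    case Leaf
    then have "s = s(2 := bits (tree_of (cdr x)) @ r)" using s by auto
    then have "exec Skip s 0 (s(2 := bits (tree_of (cdr x)) @ r))" using exec.Skip by metis
    then show ?thesis using s Leaf by (intro exec.CondF[where n = 0]) (auto simp: top_iff)
  next
    case (Node a b)
    show ?thesis
      by (rule exec.CondT[where n = "12 * sz x + 13", OF _ exec.Seq[OF exec.Pop[OF order_refl refl]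
                exec_drop_tree[of _ a "bits b @ r", OF _ _ _ order_refl]]])
        (use s Node in \<open>auto simp: sz_def top_iff\<close>)
  qed
qed (auto intro!: pb_intros pb_self)

lemma cp_lift: "pt F \<Longrightarrow> cp S f \<Longrightarrow> (\<And>x. tree_of (g x) = F (tree_of (f x))) \<Longrightarrow> cp S g"
  by (rule cp_retype[OF cp_comp[OF cp_tree_of]]) auto

section \<open>Closure properties: pairs, lists and iteration\<close>

named_theorems pt_intros

lemmas [pt_intros] = cp_id[OF order_refl] cp_const[OF order_refl] cp_pair cp_if

lemma cp_fst [pt_intros]: "cp S f \<Longrightarrow> cp S (\<lambda>x. fst (f x))"
  by (erule cp_lift[OF pt_car]) (simp add: tree_of_prod_def)

lemma cp_snd [pt_intros]: "cp S f \<Longrightarrow> cp S (\<lambda>x. snd (f x))"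
  by (erule cp_lift[OF pt_cdr]) (simp add: tree_of_prod_def)

lemma cp_Cons [pt_intros]: "cp S f \<Longrightarrow> cp S g \<Longrightarrow> cp S (\<lambda>x. f x # g x)"
  by (rule cp_retype[OF cp_pair]) auto

lemma cp_Suc [pt_intros]:
  assumes "cp S f"
  shows "cp S (\<lambda>x. Suc (f x))"
  by (rule cp_retype[of S "\<lambda>x. (Leaf, f x)"])
    (auto intro!: cp_pair cp_const assms cp_base[OF assms])

lemma cp_tl [pt_intros]:
  assumes "cp S f"
  shows "cp S (\<lambda>x. tl (f x))"
proof (rule cp_lift[OF pt_cdr assms])
  show "tree_of (tl (f x)) = cdr (tree_of (f x))" for x by (cases "f x") auto
qed

lemma cp_is_Nil [pt_intros]:
  assumes "cp S f"
  shows "cp S (\<lambda>x. f x = [])"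
proof (rule cp_retype[OF cp_if_Leaf[OF cp_tree_of[OF assms]
        cp_const[OF cp_base[OF assms], of False] cp_const[OF cp_base[OF assms], of True]]])
  show "tree_of (f x = []) = tree_of (if tree_of (f x) \<noteq> Leaf then False else True)" for x
    by (cases "f x") auto
qed

lemma cp_hd [pt_intros]:
  fixes f :: "'a::codable \<Rightarrow> 'b::codable list"
  assumes "cp S f"
  shows "cp S (\<lambda>x. hd (f x))"
proof (rule cp_retype[OF cp_if_Leaf[OF cp_tree_of[OF assms] cp_comp[OF cp_tree_of[OF assms] pt_car]
        cp_const[OF cp_base[OF assms], of "tree_of (hd [] :: 'b)"]]])
  show "tree_of (hd (f x)) = tree_of (if tree_of (f x) \<noteq> Leaf then car (tree_of (f x)) else tree_of (hd [] :: 'b))" for x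
    by (cases "f x") auto
qed

text \<open>The loop state is the tree of \<open>(ys, x, a)\<close> without its first bit, so that
  the top symbol is the first bit of \<open>ys\<close> and tells whether elements are left. The
  bound \<open>B\<close> on all intermediate accumulators is what makes iteration safe: repeating a
  step that squares the size would leave polynomial time.\<close>

lemma cp_fold:
  fixes l :: "'a::codable \<Rightarrow> 'b::codable list" and i :: "'a \<Rightarrow> 'c::codable" and h :: "'a \<Rightarrow> 'b \<Rightarrow> 'c \<Rightarrow> 'c"
  assumes h: "pt (\<lambda>z. h (fst z) (fst (snd z)) (snd (snd z)))" and l: "cp S l" and i: "cp S i"
    and B: "pb S B" "\<And>x n. n \<le> length (l x) \<Longrightarrow> sz (fold (h x) (take n (l x)) (i x)) \<le> B x"
  shows "cp S (\<lambda>x. fold (h x) (l x) (i x))"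
proof -
  note base = cp_base[OF l]
  define g where "g = (\<lambda>z :: 'b list \<times> 'a \<times> 'c.
    (tl (fst z), fst (snd z), h (fst (snd z)) (hd (fst z)) (snd (snd z))))"
  have "pt (\<lambda>z :: 'b list \<times> 'a \<times> 'c. h (fst (snd z)) (hd (fst z)) (snd (snd z)))"
    using cp_comp[OF _ h, of sz "\<lambda>z :: 'b list \<times> 'a \<times> 'c. (fst (snd z), hd (fst z), snd (snd z))"]
    by (simp add: pt_intros)
  then have "pt g" unfolding g_def by (intro pt_intros)
  then obtain G c where G: "regs G \<subseteq> {2, 3, 4, 5}"
    "\<And>x s r. clean s \<Longrightarrow> s 2 = bits (tree_of x) @ r \<Longrightarrow>
      exec G s ((sz x + 2) ^ c) (s(2 := bits (tree_of (g x)) @ r))"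
    unfolding cp_def by blast
  have "cp S (\<lambda>x. (l x, x, i x))" by (intro cp_pair l i cp_id base)
  then obtain P T where P: "regs P \<subseteq> {2, 3, 4, 5}" "pb S T"
    "\<And>x s r. clean s \<Longrightarrow> s 2 = bits (tree_of x) @ r \<Longrightarrow> exec P s (T x) (s(2 := bits (tree_of (l x, x, i x)) @ r))"
    by (rule cpE) blast
  let ?W = "While 2 {2} (Push 2 True ;; G ;; Pop 2)"
  have loop: "exec ?W s (length ys * ((L + sz x + b + 4) ^ c + 5) + 1)
      (s(2 := False # bits (tree_of (x, fold (h x) ys a)) @ r))"
    if "clean s" "s 2 = bits (tree_of ys) @ bits (tree_of (x, a)) @ r" "sz ys \<le> L"
      "\<And>n. n \<le> length ys \<Longrightarrow> sz (fold (h x) (take n ys) a) \<le> b"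
    for s ys x a r L b
    using that
  proof (induction ys arbitrary: s a)
    case Nil
    then show ?case by (auto intro!: exec_WhileF simp: top_iff fun_upd_idem)
  next
    case (Cons y ys)
    let ?z = "(y # ys, x, a)"
    let ?s1 = "s(2 := bits (tree_of ys) @ bits (tree_of (x, h x y a)) @ r)"
    have "sz a \<le> b" using Cons.prems(4)[of 0] by simp
    then have "(sz ?z + 2) ^ c \<le> (L + sz x + b + 4) ^ c"
      using Cons.prems(3) by (intro power_mono) auto
    have "exec G (s(2 := bits (tree_of ?z) @ r)) ((L + sz x + b + 4) ^ c) (s(2 := bits (tree_of (g ?z)) @ r))"
      using exec_mono[OF G(2)[of "s(2 := bits (tree_of ?z) @ r)" ?z r] \<open>(sz ?z + 2) ^ c \<le> _\<close>] Cons.prems(1)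
      by simp
    then have 1: "exec (Push 2 True ;; G ;; Pop 2) s ((L + sz x + b + 4) ^ c + 3) ?s1"
      by (intro exec.Seq[OF exec.Push[OF order_refl refl] exec.Seq[OF _ exec.Pop[OF order_refl refl]
              order_refl, of _ _ _ "s(2 := bits (tree_of (g ?z)) @ r)", THEN back_subst[of "\<lambda>t. exec _ _ _ t"]]])
        (use Cons.prems(2) in \<open>auto simp: g_def\<close>)
    have c: "sz (fold (h x) (take n ys) (h x y a)) \<le> b" if "n \<le> length ys" for n
      using Cons.prems(4)[of "Suc n"] that by simp
    have "clean ?s1" "?s1 2 = bits (tree_of ys) @ bits (tree_of (x, h x y a)) @ r" "sz ys \<le> L"
      using Cons.prems(1,3) by (auto simp: clean_def)
    from Cons.IH[OF this c]
    have 2: "exec ?W ?s1 (length ys * ((L + sz x + b + 4) ^ c + 5) + 1)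
      (s(2 := False # bits (tree_of (x, fold (h x) (y # ys) a)) @ r))"
      by (simp only: fun_upd_upd fold_simps)
    show ?case
      by (rule exec.WhileT[OF _ 1 2]) (use Cons.prems(2) in \<open>auto simp: top_iff\<close>)
  qed
  let ?t = "\<lambda>x. T x + (1 + ((length (l x) * ((sz (l x) + sz x + B x + 4) ^ c + 5) + 1) + 1))"
  have "cp S (\<lambda>x. (x, fold (h x) (l x) (i x)))"
  proof (rule cpI[of S "P ;; Pop 2 ;; ?W ;; Pop 2" ?t])
    have "pb S (\<lambda>x. length (l x))" by (rule pb_mono[OF pb_sz[OF l]]) (simp add: length_le_sz less_imp_le)
    then show "pb S ?t" by (intro pb_intros P(2) pb_sz[OF l] cp_pb_sz[OF l] B(1))
    fix x :: 'a and s r assume s: "clean s" "s 2 = bits (tree_of x) @ r"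
    show "exec (P ;; Pop 2 ;; ?W ;; Pop 2) s (?t x) (s(2 := bits (tree_of (x, fold (h x) (l x) (i x))) @ r))"
      by (rule exec.Seq[OF P(3)[OF s] exec.Seq[OF exec.Pop[OF order_refl refl]
              exec.Seq[OF loop[of _ "l x" x "i x" r "sz (l x)" "B x"] exec.Pop[of 1]]]])
        (use s B(2) in auto)
  qed (use P(1) G(1) base in auto)
  from cp_snd[OF this] show ?thesis by simp
qed

lemma pb_Suc: "pb S f \<Longrightarrow> pb S (\<lambda>x. Suc (f x))"
  using pb_add[of S f "\<lambda>_. 1"] by (simp add: pb_const)

lemma pb_length: "cp S l \<Longrightarrow> pb S (\<lambda>x. length (l x))"
  by (rule pb_mono[OF pb_sz]) (auto simp: length_le_sz less_imp_le)

text \<open>If each step adds an amount that depends on \<open>x\<close> and \<open>y\<close> but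
  not on the accumulator, then all accumulators stay below the initial size plus the length of the
  list times the largest such amount.\<close>

lemma cp_fold_linear:
  fixes l :: "'a::codable \<Rightarrow> 'b::codable list" and i :: "'a \<Rightarrow> 'c::codable" and h :: "'a \<Rightarrow> 'b \<Rightarrow> 'c \<Rightarrow> 'c"
  assumes h: "pt (\<lambda>z. h (fst z) (fst (snd z)) (snd (snd z)))" and l: "cp S l" and i: "cp S i"
    and g: "pb sz g" "\<And>x y s. sz (h x y s) \<le> sz s + g (x, y)"
  shows "cp S (\<lambda>x. fold (h x) (l x) (i x))"
proof -
  obtain c where c: "\<And>z. g z \<le> (sz z + 2) ^ c" using g(1) unfolding pb_def by blast
  let ?B = "\<lambda>x. sz (i x) + length (l x) * (sz x + sz (l x) + 3) ^ c"
  have *: "sz (fold (h x) ys a) \<le> sz a + length ys * (sz x + L + 3) ^ c"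
    if "\<And>y. y \<in> set ys \<Longrightarrow> sz y \<le> L" for x a L ys
    using that
  proof (induction ys arbitrary: a)
    case (Cons y ys)
    have "g (x, y) \<le> (sz x + L + 3) ^ c"
      using Cons.prems[of y] by (intro order_trans[OF c] power_mono) auto
    with g(2)[of x y a] Cons.IH[of "h x y a"] Cons.prems show ?case by fastforce
  qed simp
  show ?thesis
  proof (rule cp_fold[OF h l i, of ?B])
    show "pb S ?B" by (intro pb_intros pb_sz[OF l] pb_sz[OF i] cp_pb_sz[OF l] pb_length[OF l])
    fix x n assume n: "n \<le> length (l x)"
    have "sz y \<le> sz (l x)" if "y \<in> set (take n (l x))" for y
      using that by (auto dest: in_set_takeD intro: sz_mem)
    from *[of "take n (l x)" "sz (l x)" x "i x", OF this] n
    have "sz (fold (h x) (take n (l x)) (i x)) \<le> sz (i x) + n * (sz x + sz (l x) + 3) ^ c" by simp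
    also have "\<dots> \<le> ?B x" using n by simp
    finally show "sz (fold (h x) (take n (l x)) (i x)) \<le> ?B x" .
  qed
qed

lemma pb_sz_snd: "pb sz (\<lambda>z. sz (snd z))"
  by (intro pb_sz pt_intros)

lemma cp_rev [pt_intros]:
  assumes "cp S l"
  shows "cp S (\<lambda>x. rev (l x))"
proof -
  have "cp S (\<lambda>x. fold (\<lambda>y s. y # s) (l x) [])"
    by (rule cp_fold_linear[where g = "\<lambda>z. 1 + sz (snd z)"])
      (auto intro!: pt_intros assms cp_const cp_base[OF assms] pb_intros pb_Suc pb_sz_snd)
  then show ?thesis by (simp add: fold_Cons_rev)
qed

lemma fold_Cons_map: "fold (\<lambda>y s. f y # s) xs s = rev (map f xs) @ s"
  by (induction xs arbitrary: s) auto

lemma cp_map [pt_intros]: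
  assumes h: "pt (\<lambda>z. h (fst z) (snd z))" and l: "cp S l"
  shows "cp S (\<lambda>x. map (h x) (l x))"
proof -
  have "pt (\<lambda>z. h (fst z) (fst (snd z)))"
    using cp_comp[OF _ h, of sz "\<lambda>z. (fst z, fst (snd z))"] by (simp add: pt_intros)
  then have "cp S (\<lambda>x. fold (\<lambda>y s. h x y # s) (l x) [])"
    by (intro cp_fold_linear[where g = "\<lambda>z. 1 + sz (h (fst z) (snd z))"])
      (auto intro!: pt_intros l cp_const cp_base[OF l] pb_intros pb_Suc pb_sz[OF h])
  from cp_rev[OF this] show ?thesis by (simp add: fold_Cons_map)
qed

lemma cp_append [pt_intros]:
  assumes "cp S k" "cp S l"
  shows "cp S (\<lambda>x. k x @ l x)"
proof -
  have "cp S (\<lambda>x. fold (\<lambda>y s. y # s) (rev (k x)) (l x))"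
    by (rule cp_fold_linear[where g = "\<lambda>z. 1 + sz (snd z)"])
      (auto intro!: pt_intros assms pb_intros pb_Suc pb_sz_snd)
  then show ?thesis by (simp add: fold_Cons_rev)
qed

lemma fold_append_concat: "fold (\<lambda>y s. s @ y) xs s = s @ concat xs"
  by (induction xs arbitrary: s) auto

lemma cp_concat [pt_intros]:
  assumes "cp S l"
  shows "cp S (\<lambda>x. concat (l x))"
proof -
  have "sz (s @ y) \<le> sz s + sz y" for s y :: "'b list"
    using sz_append[of s y] by simp
  then have "cp S (\<lambda>x. fold (\<lambda>y s. s @ y) (l x) [])"
    by (intro cp_fold_linear[where g = "\<lambda>z. sz (snd z)"])
      (auto intro!: pt_intros assms cp_const cp_base[OF assms] pb_intros pb_Suc pb_sz_snd)
  then show ?thesis by (simp add: fold_append_concat)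
qed

lemma cp_not [pt_intros]: "cp S f \<Longrightarrow> cp S (\<lambda>x. \<not> f x)"
  by (rule cp_retype[OF cp_if[of S f "\<lambda>_. False" "\<lambda>_. True"]]) (auto intro: cp_const dest: cp_base)

lemma cp_conj [pt_intros]: "cp S f \<Longrightarrow> cp S g \<Longrightarrow> cp S (\<lambda>x. f x \<and> g x)"
  by (rule cp_retype[OF cp_if[of S f g "\<lambda>_. False"]]) (auto intro: cp_const dest: cp_base)

lemma cp_disj [pt_intros]: "cp S f \<Longrightarrow> cp S g \<Longrightarrow> cp S (\<lambda>x. f x \<or> g x)"
  by (rule cp_retype[OF cp_if[of S f "\<lambda>_. True" g]]) (auto intro: cp_const dest: cp_base)

lemma cp_imp [pt_intros]: "cp S f \<Longrightarrow> cp S g \<Longrightarrow> cp S (\<lambda>x. f x \<longrightarrow> g x)"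
  by (rule cp_retype[OF cp_if[of S f g "\<lambda>_. True"]]) (auto intro: cp_const dest: cp_base)

lemma cp_filter [pt_intros]:
  assumes p: "pt (\<lambda>z. p (fst z) (snd z))" and l: "cp S l"
  shows "cp S (\<lambda>x. filter (p x) (l x))"
proof -
  have "cp S (\<lambda>x. concat (map (\<lambda>y. if p x y then [y] else []) (l x)))"
    by (intro pt_intros p l)
  moreover have "concat (map (\<lambda>y. if q y then [y] else []) xs) = filter q xs" for q and xs :: "'b list"
    by (induction xs) auto
  ultimately show ?thesis by simp
qed

lemma fold_disj: "fold (\<lambda>y s. s \<or> p y) xs b \<longleftrightarrow> b \<or> (\<exists>y \<in> set xs. p y)"
  by (induction xs arbitrary: b) auto

lemma cp_Bex [pt_intros]:
  assumes p: "pt (\<lambda>z. p (fst z) (snd z))" and l: "cp S l"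
  shows "cp S (\<lambda>x. \<exists>y \<in> set (l x). p x y)"
proof -
  have "pt (\<lambda>z. p (fst z) (fst (snd z)))"
    using cp_comp[OF _ p, of sz "\<lambda>z. (fst z, fst (snd z))"] by (simp add: pt_intros)
  then have "cp S (\<lambda>x. fold (\<lambda>y s. s \<or> p x y) (l x) False)"
    by (intro cp_fold_linear[where g = "\<lambda>z. 3"])
      (auto intro!: pt_intros l cp_const cp_base[OF l] pb_intros)
  then show ?thesis by (simp add: fold_disj)
qed

lemma cp_Ball [pt_intros]:
  assumes p: "pt (\<lambda>z. p (fst z) (snd z))" and l: "cp S l"
  shows "cp S (\<lambda>x. \<forall>y \<in> set (l x). p x y)"
proof -
  have "cp S (\<lambda>x. \<not> (\<exists>y \<in> set (l x). \<not> p x y))" by (intro pt_intros p l)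
  then show ?thesis by simp
qed

section \<open>Unary arithmetic\<close>

lemma fold_Suc_length: "fold (\<lambda>y s. Suc s) xs n = n + length xs"
  by (induction xs arbitrary: n) auto

lemma cp_length [pt_intros]:
  assumes "cp S l"
  shows "cp S (\<lambda>x. length (l x))"
proof -
  have "cp S (\<lambda>x. fold (\<lambda>y s. Suc s) (l x) 0)"
    by (rule cp_fold_linear[where g = "\<lambda>z. 2"])
      (auto intro!: pt_intros assms cp_const cp_base[OF assms] pb_intros)
  then show ?thesis by (simp add: fold_Suc_length)
qed

text \<open>A number is the same tree as a list of that many leaves; thus numbers become lists for
  free and folds serve as bounded loops.\<close>

lemma tree_of_replicate_Leaf: "tree_of (replicate n Leaf) = tree_of n"
  by (induction n) auto

lemma cp_replicate [pt_intros]: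
  assumes "cp S n" "cp S y"
  shows "cp S (\<lambda>x. replicate (n x) (y x))"
proof -
  have "cp S (\<lambda>x. replicate (n x) Leaf)"
    by (rule cp_retype[OF assms(1)]) (simp add: tree_of_replicate_Leaf)
  moreover have "pt (\<lambda>w. map (\<lambda>_ :: tree. snd w) (fst w))" by (intro pt_intros)
  ultimately have "cp S (\<lambda>x. map (\<lambda>_. y x) (replicate (n x) Leaf))"
    using cp_comp[OF cp_pair[OF _ assms(2)]] by fastforce
  then show ?thesis by (simp add: map_replicate_const)
qed

lemma cp_plus [pt_intros]: "cp S m \<Longrightarrow> cp S n \<Longrightarrow> cp S (\<lambda>x. m x + n x :: nat)"
  using cp_length[OF cp_append[OF cp_replicate[of S m "\<lambda>_. Leaf"] cp_replicate[of S n "\<lambda>_. Leaf"]]]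
  by (simp add: cp_const cp_base)

lemma cp_times [pt_intros]: "cp S m \<Longrightarrow> cp S n \<Longrightarrow> cp S (\<lambda>x. m x * n x :: nat)"
  using cp_length[OF cp_concat[OF cp_replicate[of S m, OF _ cp_replicate[of S n "\<lambda>_. Leaf"]]]]
  by (simp add: cp_const cp_base length_concat sum_list_replicate)

lemma cp_poly [pt_intros]:
  assumes "cp S f"
  shows "cp S (\<lambda>x. poly (p :: nat poly) (f x))"
proof (induction p)
  case (pCons a p)
  show ?case by (simp, intro pt_intros cp_const cp_base[OF assms] assms pCons)
qed (simp add: cp_const cp_base[OF assms])

lemma cp_pred [pt_intros]:
  assumes "cp S n"
  shows "cp S (\<lambda>x. n x - Suc 0)"
proof (rule cp_lift[OF pt_cdr assms])
  show "tree_of (n x - Suc 0) = cdr (tree_of (n x))" for x by (cases "n x") auto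
qed

lemma cp_minus [pt_intros]:
  assumes "cp S m" "cp S n"
  shows "cp S (\<lambda>x. m x - n x :: nat)"
proof -
  have "cp S (\<lambda>x. fold (\<lambda>y s. s - Suc 0) (replicate (n x) Leaf) (m x))"
    by (rule cp_fold_linear[where g = "\<lambda>z. 0"])
      (auto intro!: pt_intros assms cp_const cp_base[OF assms(1)] pb_intros simp: sz_nat)
  moreover have "fold (\<lambda>y s. s - Suc 0) (replicate k Leaf) j = j - k" for k j
    by (induction k arbitrary: j) auto
  ultimately show ?thesis by simp
qed

lemma cp_eq_0:
  assumes "cp S n"
  shows "cp S (\<lambda>x. n x = (0::nat))"
proof -
  have "cp S (\<lambda>x. replicate (n x) Leaf = [])"
    by (intro pt_intros assms cp_const cp_base[OF assms])
  then show ?thesis by simp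
qed

lemma cp_le [pt_intros]: "cp S m \<Longrightarrow> cp S n \<Longrightarrow> cp S (\<lambda>x. m x \<le> (n x :: nat))"
  using cp_eq_0[OF cp_minus[of S m n]] by simp

lemma cp_less [pt_intros]: "cp S m \<Longrightarrow> cp S n \<Longrightarrow> cp S (\<lambda>x. m x < (n x :: nat))"
  using cp_not[OF cp_le[of S n m]] by (simp add: not_le)

lemma cp_eq_nat [pt_intros]: "cp S m \<Longrightarrow> cp S n \<Longrightarrow> cp S (\<lambda>x. m x = (n x :: nat))"
  using cp_conj[OF cp_le[of S m n] cp_le[of S n m]] by (simp add: eq_iff)

section \<open>Equality tests\<close>

lemma cp_eq_bool [pt_intros]:
  assumes "cp S f" "cp S g"
  shows "cp S (\<lambda>x. f x = (g x :: bool))"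
proof -
  have "cp S (\<lambda>x. if f x then g x else \<not> g x)" by (intro pt_intros assms)
  then show ?thesis by (rule cp_retype) auto
qed

lemma cp_eq_prod [pt_intros]:
  assumes "pt (\<lambda>z :: 'b \<times> 'b. fst z = snd z)" "pt (\<lambda>z :: 'c \<times> 'c. fst z = snd z)" "cp S f" "cp S g"
  shows "cp S (\<lambda>x. f x = (g x :: 'b::codable \<times> 'c::codable))"
proof -
  have "cp S (\<lambda>x. fst (f x) = fst (g x) \<and> snd (f x) = snd (g x))"
    using cp_comp[OF cp_pair[OF cp_fst cp_fst, of S f g] assms(1)]
      cp_comp[OF cp_pair[OF cp_snd cp_snd, of S f g] assms(2)] assms(3,4)
    by (intro cp_conj) auto
  then show ?thesis by (simp add: prod_eq_iff)
qed

text \<open>Two lists are compared by one fold over the first, with the unread rest of the second in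
  the accumulator.\<close>

lemma fold_list_eq:
  "fold (\<lambda>y s. (fst s \<and> snd s \<noteq> [] \<and> y = hd (snd s), tl (snd s))) xs (b, ys) =
   (b \<and> take (length xs) ys = xs, drop (length xs) ys)"
proof (induction xs arbitrary: b ys)
  case (Cons x xs)
  show ?case by (cases ys) (simp_all add: Cons.IH, blast)
qed simp

lemma sz_tl: "sz (tl xs) \<le> sz xs"
  by (cases xs) auto

lemma cp_eq_list [pt_intros]:
  assumes eq: "pt (\<lambda>z :: 'b \<times> 'b. fst z = snd z)" and "cp S f" "cp S g"
  shows "cp S (\<lambda>x. f x = (g x :: 'b::codable list))"
proof -
  let ?h = "\<lambda>y :: 'b. \<lambda>s :: bool \<times> 'b list. (fst s \<and> snd s \<noteq> [] \<and> y = hd (snd s), tl (snd s))"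
  let ?F = "\<lambda>w :: 'b list \<times> 'b list. fold ?h (fst w) (True, snd w)"
  have "pt (\<lambda>z :: ('b list \<times> 'b list) \<times> 'b \<times> bool \<times> 'b list. fst (snd z) = hd (snd (snd (snd z))))"
    using cp_comp[OF _ eq, of sz "\<lambda>z :: ('b list \<times> 'b list) \<times> 'b \<times> bool \<times> 'b list.
      (fst (snd z), hd (snd (snd (snd z))))"] by (simp add: pt_intros)
  then have "pt (\<lambda>z :: ('b list \<times> 'b list) \<times> 'b \<times> bool \<times> 'b list. ?h (fst (snd z)) (snd (snd z)))"
    by (intro pt_intros)
  moreover have "sz (?h y s) \<le> sz s + 3" for y s
    using sz_tl[of "snd s"] by (cases s) auto
  ultimately have "pt ?F"
    by (intro cp_fold_linear[where g = "\<lambda>z. 3"]) (auto intro!: pt_intros pb_intros simp del: sz_simps)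
  then have "pt (\<lambda>w. fst (?F w) \<and> snd (?F w) = [])" by (intro pt_intros)
  moreover have "take (length xs) ys = xs \<and> drop (length xs) ys = [] \<longleftrightarrow> xs = ys" for xs ys :: "'b list"
    by (metis append_Nil2 append_take_drop_id drop_all order_refl take_all)
  ultimately have "pt (\<lambda>w :: 'b list \<times> 'b list. fst w = snd w)" by (simp add: fold_list_eq)
  from cp_comp[OF cp_pair[OF assms(2,3)] this] show ?thesis by simp
qed

lemma cp_eq_tree:
  assumes "pt (\<lambda>z :: 'b::codable \<times> 'b. fst z = snd z)" "cp S f" "cp S g"
  shows "cp S (\<lambda>x. f x = (g x :: 'b))"
  using cp_comp[OF cp_pair[OF assms(2,3)] assms(1)] by simp

lemma cp_member [pt_intros]:
  assumes eq: "pt (\<lambda>z :: 'b::codable \<times> 'b. fst z = snd z)" and f: "cp S f" and l: "cp S l"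
  shows "cp S (\<lambda>x. (f x :: 'b) \<in> set (l x))"
proof -
  have "pt (\<lambda>w :: 'b \<times> 'b list. \<exists>y \<in> set (snd w). y = fst w)"
    by (intro pt_intros cp_eq_tree[OF eq])
  then have "pt (\<lambda>w :: 'b \<times> 'b list. fst w \<in> set (snd w))" by simp
  from cp_comp[OF cp_pair[OF f l] this] show ?thesis by simp
qed

text \<open>The appended element depends on the accumulator, so that \<open>cp_fold_linear\<close>
  does not apply and the sizes are bounded directly.\<close>

lemma cp_upt [pt_intros]:
  assumes "cp S n"
  shows "cp S (\<lambda>x. [0..<n x])"
proof -
  have u: "fold (\<lambda>_ s. s @ [length s]) (replicate k Leaf) [] = [0..<k]" for k
    by (induction k) (auto simp: replicate_append_same[symmetric])
  have "cp S (\<lambda>x. fold (\<lambda>_ s. s @ [length s]) (replicate (n x) Leaf) [])"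
  proof (rule cp_fold[where B = "\<lambda>x. 1 + n x * (2 * n x + 2)"])
    have "pb S n" by (rule pb_mono[OF pb_sz[OF assms]]) (simp add: sz_nat)
    then show "pb S (\<lambda>x. 1 + n x * (2 * n x + 2))" by (intro pb_intros)
    fix x j assume "j \<le> length (replicate (n x) Leaf)"
    then have j: "j \<le> n x" by simp
    then have "sz [0..<j] \<le> 1 + length [0..<j] * ((2 * n x + 1) + 1)"
      by (intro sz_list_le) (auto simp: sz_nat)
    also have "\<dots> \<le> 1 + n x * (2 * n x + 2)" using mult_le_mono1[OF j, of "2 * n x + 2"] by simp
    finally show "sz (fold (\<lambda>_ s. s @ [length s]) (take j (replicate (n x) Leaf)) []) \<le> 1 + n x * (2 * n x + 2)"
      using j by (simp only: take_replicate min_absorb1 u)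
  qed (intro pt_intros assms cp_const cp_base[OF assms])+
  then show ?thesis by (simp only: u)
qed

section \<open>Decoding and parsing of trees\<close>

lemma cp_of_tree_tree [pt_intros]: "cp S f \<Longrightarrow> cp S (\<lambda>x. of_tree (f x) :: tree)"
  by simp

lemma cp_of_tree_bool [pt_intros]:
  assumes "cp S f"
  shows "cp S (\<lambda>x. of_tree (f x) :: bool)"
proof -
  have "cp S (\<lambda>x. if f x \<noteq> Leaf then True else False)"
    by (intro cp_if_Leaf assms cp_const cp_base[OF assms])
  then show ?thesis by (rule cp_retype) (simp add: of_tree_bool_def)
qed

lemma tree_of_tree_list: "tree_of (tree_list t) = t"
  by (induction t) auto

lemma cp_tree_list [pt_intros]: "cp S f \<Longrightarrow> cp S (\<lambda>x. tree_list (f x))"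
  by (erule cp_retype) (simp add: tree_of_tree_list)

lemma cp_of_tree_list [pt_intros]:
  assumes "pt (of_tree :: tree \<Rightarrow> 'b::codable)" "cp S f"
  shows "cp S (\<lambda>x. of_tree (f x) :: 'b list)"
  unfolding of_tree_list_def using cp_comp[OF cp_snd[OF cp_id[OF order_refl]] assms(1)]
  by (intro pt_intros assms(2))

lemma cp_of_tree_nat [pt_intros]: "cp S f \<Longrightarrow> cp S (\<lambda>x. of_tree (f x) :: nat)"
  unfolding of_tree_nat_def by (intro pt_intros)

lemma cp_of_tree_prod [pt_intros]:
  assumes "pt (of_tree :: tree \<Rightarrow> 'b::codable)" "pt (of_tree :: tree \<Rightarrow> 'c::codable)" "cp S f"
  shows "cp S (\<lambda>x. of_tree (f x) :: 'b \<times> 'c)"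
  unfolding of_tree_prod_def
  using cp_comp[OF cp_comp[OF assms(3) pt_car] assms(1)] cp_comp[OF cp_comp[OF assms(3) pt_cdr] assms(2)]
  by (intro cp_pair) auto

text \<open>A shift-reduce parser for the prefix code \<open>bits\<close>, run from right to left; the stack of
  subtrees is itself a tree.\<close>

definition shift_reduce :: "bool \<Rightarrow> tree \<Rightarrow> tree" where
  "shift_reduce b t = (if b then Node (Node (car t) (car (cdr t))) (cdr (cdr t)) else Node Leaf t)"

definition parse_tree :: "bool list \<Rightarrow> tree" where
  "parse_tree bs = car (fold shift_reduce (rev bs) Leaf)"

lemma parse_tree_bits: "parse_tree (bits t) = t"
proof -
  have "fold shift_reduce (rev (bits t)) u = Node t u" for u
    by (induction t arbitrary: u) (auto simp: shift_reduce_def)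
  then show ?thesis by (simp add: parse_tree_def)
qed

lemma cp_Node: "cp S f \<Longrightarrow> cp S g \<Longrightarrow> cp S (\<lambda>x. Node (f x) (g x))"
  by (rule cp_retype[OF cp_pair[of S f g]]) auto

lemma cp_parse_tree [pt_intros]:
  assumes "cp S f"
  shows "cp S (\<lambda>x. parse_tree (f x))"
proof -
  have cdr: "sz (car t) + sz (cdr t) \<le> sz t + 1" for t
    by (cases t) auto
  note c = cp_comp[OF _ pt_car] cp_comp[OF _ pt_cdr]
  have "pt (\<lambda>z :: 'a \<times> bool \<times> tree. shift_reduce (fst (snd z)) (snd (snd z)))"
    unfolding shift_reduce_def by (intro cp_Node pt_intros c)
  then have "cp S (\<lambda>x. fold shift_reduce (rev (f x)) Leaf)"
  proof (rule cp_fold_linear[where g = "\<lambda>_. 4"])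
    show "sz (shift_reduce y s) \<le> sz s + 4" for y s
      using cdr[of s] cdr[of "cdr s"] by (auto simp: shift_reduce_def)
  qed (intro pt_intros assms pb_intros cp_const cp_base[OF assms])+
  then show ?thesis unfolding parse_tree_def by (rule c)
qed

section \<open>From computable functions to Turing machines\<close>

text \<open>Turns a raw bit string into the tree of a list. The pushed words are the bit of a list
  cell followed by the code of its head, which is \<open>Node Leaf Leaf\<close> or
  \<open>Leaf\<close>. The input is reversed first because the list grows from its last
  element.\<close>

definition load :: "nat \<Rightarrow> prog" where
  "load r = move r 3 ;; Push 2 False ;; While 3 {1, 2} (Cond 3 {2}
     (Pop 3 ;; pushes [True, True, False, False]) (Pop 3 ;; pushes [True, False]))"

lemma exec_load_loop:
  assumes "s' = s(3 := [], 2 := bits (tree_of (rev (s 3) @ ys)) @ r)" "s 2 = bits (tree_of ys) @ r"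
    "13 * length (s 3) + 1 \<le> n"
  shows "exec (While 3 {1, 2} (Cond 3 {2}
     (Pop 3 ;; pushes [True, True, False, False]) (Pop 3 ;; pushes [True, False]))) s n s'"
  using assms
proof (induction "s 3" arbitrary: s n ys)
  case Nil
  then have "s' = s" "top_symbol (s 3) \<notin> {1, 2}" by (auto simp: fun_eq_iff top_iff)
  with Nil.prems show ?case by (auto intro!: exec.WhileF)
next
  case (Cons b xs)
  let ?s1 = "s(3 := xs, 2 := bits (tree_of (b # ys)) @ r)"
  have 1: "exec (Cond 3 {2} (Pop 3 ;; pushes [True, True, False, False]) (Pop 3 ;; pushes [True, False])) s 11 ?s1"
  proof (cases b)
    case True
    have "exec (Pop 3 ;; pushes [True, True, False, False]) s 9 ?s1"
      using exec.Seq[OF exec.Pop[OF order_refl refl, where s = s and r = 3] exec_pushes[of "[True, True, False, False]"], of 9]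
        Cons(2)[symmetric] Cons(4) True by (simp add: fun_upd_twist)
    then show ?thesis using Cons(2)[symmetric] True by (intro exec.CondT[where n = 9]) (auto simp: top_iff)
  next
    case False
    have "exec (Pop 3 ;; pushes [True, False]) s 9 ?s1"
      using exec.Seq[OF exec.Pop[OF order_refl refl, where s = s and r = 3] exec_pushes[of "[True, False]"], of 9]
        Cons(2)[symmetric] Cons(4) False by (simp add: fun_upd_twist)
    then show ?thesis using Cons(2)[symmetric] False by (intro exec.CondF[where n = 9]) (auto simp: top_iff)
  qed
  have 2: "exec (While 3 {1, 2} (Cond 3 {2}
     (Pop 3 ;; pushes [True, True, False, False]) (Pop 3 ;; pushes [True, False]))) ?s1 (13 * length xs + 1) s'"
    by (rule Cons(1)[of ?s1 "b # ys"]) (use Cons(2)[symmetric] Cons(3) in \<open>auto simp: fun_eq_iff\<close>)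
  show ?case
    by (rule exec.WhileT[OF _ 1 2]) (use Cons(2)[symmetric] Cons(5) in \<open>auto simp: top_iff\<close>)
qed

lemma exec_load:
  assumes "r \<notin> {2, 3}" "clean s" "s' = s(r := [], 2 := bits (tree_of (s r)) @ s 2)"
    "20 * length (s r) + 4 \<le> n"
  shows "exec (load r) s n s'"
  unfolding load_def
  by (rule exec.Seq[OF exec_move[OF _ refl order_refl] exec.Seq[OF exec.Push[OF order_refl refl]
          exec_load_loop[where ys = "[]" and r = "s 2", OF _ _ order_refl] order_refl]])
    (use assms in \<open>auto simp: fun_eq_iff clean_def\<close>)

text \<open>Register 6 is the last tape of a machine with 7 tapes, where an output is read, and also
  the first tape of the second machine in \<open>then_machine 6\<close>, where an input is
  expected.\<close>

definition unload :: prog where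
  "unload = While 2 {2} (Pop 2 ;; Cond 2 {2} (Pop 2 ;; Pop 2 ;; Pop 2 ;; Push 3 True) (Pop 2 ;; Push 3 False)) ;;
     Pop 2 ;; move 3 6"

lemma exec_unload_loop:
  assumes "s' = s(2 := False # r, 3 := rev ys @ s 3)" "s 2 = bits (tree_of ys) @ r" "10 * length ys + 1 \<le> n"
  shows "exec (While 2 {2} (Pop 2 ;; Cond 2 {2} (Pop 2 ;; Pop 2 ;; Pop 2 ;; Push 3 True) (Pop 2 ;; Push 3 False))) s n s'"
  using assms
proof (induction ys arbitrary: s n)
  case Nil
  then have "s' = s" "top_symbol (s 2) \<notin> {2}" by (auto simp: fun_eq_iff top_iff)
  with Nil.prems show ?case by (auto intro!: exec.WhileF)
next
  case (Cons b ys)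
  let ?s1 = "s(2 := bits (tree_of ys) @ r, 3 := b # s 3)"
  let ?s0 = "s(2 := bits (tree_of b) @ bits (tree_of ys) @ r)"
  have "exec (Cond 2 {2} (Pop 2 ;; Pop 2 ;; Pop 2 ;; Push 3 True) (Pop 2 ;; Push 3 False)) ?s0 7 ?s1"
  proof (cases b)
    case True
    show ?thesis
      by (rule exec.CondT[where n = 5, OF _ exec.Seq[OF exec.Pop[OF order_refl refl] exec.Seq[OF exec.Pop[OF order_refl refl]
             exec.Seq[OF exec.Pop[OF order_refl refl] exec.Push[of 2] order_refl] order_refl]]])
        (use True in \<open>auto simp: top_iff fun_eq_iff\<close>)
  next
    case False
    show ?thesis
      by (rule exec.CondF[where n = 5, OF _ exec.Seq[OF exec.Pop[OF order_refl refl] exec.Push[of 2]]])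
        (use False in \<open>auto simp: top_iff fun_eq_iff\<close>)
  qed
  then have 1: "exec (Pop 2 ;; Cond 2 {2} (Pop 2 ;; Pop 2 ;; Pop 2 ;; Push 3 True) (Pop 2 ;; Push 3 False)) s 8 ?s1"
    by (rule exec.Seq[OF exec.Pop[of 1], rotated 2]) (use Cons(3) in auto)
  have 2: "exec (While 2 {2} (Pop 2 ;; Cond 2 {2} (Pop 2 ;; Pop 2 ;; Pop 2 ;; Push 3 True) (Pop 2 ;; Push 3 False)))
      ?s1 (10 * length ys + 1) s'"
    by (rule Cons(1)) (use Cons(2) in \<open>auto simp: fun_eq_iff\<close>)
  show ?case
    by (rule exec.WhileT[OF _ 1 2]) (use Cons(3,4) in \<open>auto simp: top_iff\<close>)
qed

lemma exec_unload:
  assumes "clean s" "s 2 = bits (tree_of ys) @ r" "s' = s(2 := r, 6 := ys @ s 6)" "17 * length ys + 3 \<le> n"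
  shows "exec unload s n s'"
  unfolding unload_def
  by (rule exec.Seq[OF exec_unload_loop[where s = s and ys = ys and r = r, OF refl assms(2) order_refl] exec.Seq[OF exec.Pop[OF order_refl refl]
          exec_move[OF _ _ order_refl] order_refl]])
    (use assms in \<open>auto simp: fun_eq_iff clean_def\<close>)

definition inputs :: "bool list list \<Rightarrow> stacks" where
  "inputs xs = (\<lambda>i. if i < length xs then xs ! i else [])"

lemma sz_bool_list: "sz (xs :: bool list) \<le> 4 * length xs + 1"
  by (induction xs) auto

lemma cp_function_prog:
  fixes f :: "bool list \<Rightarrow> bool list"
  assumes "cp S f"
  obtains P T where "regs P \<subseteq> {..<7}" "pb S T"
    "\<And>x. exec P (inputs [x]) (T x) ((\<lambda>_. [])(6 := f x))"
proof -
  obtain P T where P: "regs P \<subseteq> {2, 3, 4, 5}" "pb S T"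
    "\<And>x s r. clean s \<Longrightarrow> s 2 = bits (tree_of x) @ r \<Longrightarrow> exec P s (T x) (s(2 := bits (tree_of (f x)) @ r))"
    using assms by (rule cpE) blast
  let ?T = "\<lambda>x. (20 * length x + 4) + (T x + (17 * length (f x) + 3))"
  show ?thesis
  proof (rule that[of "load 0 ;; P ;; unload" ?T])
    show "regs (load 0 ;; P ;; unload) \<subseteq> {..<7}"
      using P(1) by (auto simp: load_def unload_def move_def)
    show "pb S ?T"
      using pb_length[OF cp_id[OF cp_base[OF assms]]] by (intro pb_intros P(2) pb_length[OF assms])
    show "exec (load 0 ;; P ;; unload) (inputs [x]) (?T x) ((\<lambda>_. [])(6 := f x))" for x
      by (rule exec.Seq[OF exec_load[OF _ _ refl order_refl] exec.Seq[OF P(3)[of _ x "[]"]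
              exec_unload[where r = "[]" and ys = "f x"] order_refl]])
        (auto simp: inputs_def clean_def fun_eq_iff)
  qed
qed

lemma polytime_computable_pt:
  assumes "pt f"
  shows "polytime_computable f"
proof -
  obtain P T where P: "regs P \<subseteq> {..<7}" "pb sz T"
    "\<And>x. exec P (inputs [x]) (T x) ((\<lambda>_. [])(6 := f x))"
    using assms by (rule cp_function_prog) blast
  obtain c where c: "\<And>x. T x \<le> (sz x + 2) ^ c" using P(2) unfolding pb_def by blast
  let ?M = "machine 7 P 6" and ?p = "[:3, 4:] ^ c + [:2:] :: nat poly"
  have "halted (run ?M [x] (poly ?p (length x))) \<and>
      shows_output (last (snd (run ?M [x] (poly ?p (length x))))) (f x)" for x
  proof -
    let ?c = "run ?M [x] (poly ?p (length x))"
    have "T x \<le> (length x * 4 + 3) ^ c"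
      by (rule order_trans[OF c power_mono]) (use sz_bool_list[of x] in auto)
    then have t: "T x + 2 \<le> poly ?p (length x)" by (simp add: poly_power algebra_simps)
    have "fst ?c \<in> {1, 2} \<and> represents ?M ((\<lambda>_. [])(6 := f x)) (snd ?c)"
      using run_machine[OF P(3) P(1) _ _ t, of 6] by (auto simp: inputs_def)
    then have *: "halted ?c" "length (snd ?c) = 7" "view (snd ?c ! 6) = stack_view (f x)"
      by (auto simp: halted_def represents_def machine_def)
    then have "last (snd ?c) = snd ?c ! 6" by (subst last_conv_nth) auto
    moreover have "shows_output (snd ?c ! 6) (f x)"
      using fun_cong[OF *(3)] by (auto simp: shows_output_def view_def stack_view_def)
    ultimately show ?thesis using * by simp
  qed
  moreover have "wf_tm ?M" using P(1) by (intro wf_machine) auto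
  ultimately show ?thesis unfolding polytime_computable_def Let_def by blast
qed

lemma NP_I:
  fixes V :: "bool list \<times> bool list \<Rightarrow> bool"
  assumes V: "pt V" and L: "\<And>x. x \<in> L \<longleftrightarrow> (\<exists>u. length u \<le> poly (p :: nat poly) (length x) \<and> V (x, u))"
  shows "L \<in> NP"
proof -
  obtain P T where P: "regs P \<subseteq> {2, 3, 4, 5}" "pb sz T"
    "\<And>x s r. clean s \<Longrightarrow> s 2 = bits (tree_of x) @ r \<Longrightarrow> exec P s (T x) (s(2 := bits (tree_of (V x)) @ r))"
    using V by (rule cpE) blast
  obtain c where c: "\<And>x. T x \<le> (sz x + 2) ^ c" using P(2) unfolding pb_def by blast
  let ?P = "load 1 ;; load 0 ;; Push 2 True ;; P"
  \<comment> \<open>The verdict is the first bit of the resulting tree, since True is a node and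
    False a leaf. In the time bound, 12 consists of 4 for each load, 2 for the push that forms the
    pair, and 2 for entering and leaving the program.\<close>
  let ?M = "machine 7 ?P 2"
  let ?q = "[:12:] + 20 * [:0, 1:] + 20 * p + (4 * [:0, 1:] + 4 * p + [:5:]) ^ c :: nat poly"
  have regs: "regs ?P \<subseteq> {..<7}" using P(1) by (auto simp: load_def move_def)
  have ans: "answers ?M [x, u] (poly ?q (length x)) (V (x, u))" if "length u \<le> poly p (length x)" for x u
  proof -
    let ?n = "(20 * length u + 4) + ((20 * length x + 4) + (2 + T (x, u)))"
    have "sz (x, u) + 2 \<le> 4 * length x + 4 * poly p (length x) + 5"
      using sz_bool_list[of x] sz_bool_list[of u] that by simp
    then have "T (x, u) \<le> (4 * length x + 4 * poly p (length x) + 5) ^ c"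
      by (intro order_trans[OF c power_mono]) auto
    then have n: "?n + 2 \<le> poly ?q (length x)" using that by (simp add: poly_power algebra_simps)
    have "exec ?P (inputs [x, u]) ?n ((\<lambda>_. [])(2 := bits (tree_of (V (x, u)))))"
      by (rule exec.Seq[OF exec_load[OF _ _ refl order_refl] exec.Seq[OF exec_load[OF _ _ refl order_refl]
              exec.Seq[OF exec.Push[OF order_refl refl] P(3)[of _ "(x, u)" "[]", THEN back_subst[of "exec _ _ _"]]
               order_refl] order_refl]])
        (auto simp: inputs_def clean_def fun_eq_iff)
    from run_machine[OF this regs _ inputs_def n, of 2] show ?thesis
      by (auto simp: answers_def top_iff)
  qed
  have "wf_tm ?M" "2 \<le> tapes ?M"
    using regs by (auto intro!: wf_machine) (simp add: machine_def)
  moreover have "answers ?M [x, u] (poly ?q (length x)) True \<longleftrightarrow> V (x, u)"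
    if "length u \<le> poly p (length x)" for x u
    using ans[OF that] by (cases "V (x, u)") (auto simp: answers_def)
  ultimately show ?thesis unfolding NP_def using ans L
    by (intro CollectI exI[of _ ?M] exI[of _ p] exI[of _ ?q]) blast
qed

section \<open>Encodings\<close>

text \<open>The arbitrary tails make the property pass through concatenations, and with it
  injectivity of the composite encodings.\<close>

definition prefix_free :: "('a \<Rightarrow> bool list) \<Rightarrow> bool" where
  "prefix_free e \<longleftrightarrow> (\<forall>x y a b. e x @ a = e y @ b \<longrightarrow> x = y \<and> a = b)"

lemma prefix_freeD: "prefix_free e \<Longrightarrow> e x @ a = e y @ b \<Longrightarrow> x = y \<and> a = b"
  by (auto simp: prefix_free_def)

lemma prefix_free_inj: "prefix_free e \<Longrightarrow> inj e"
  by (rule injI) (metis append_Nil2 prefix_freeD)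

lemma prefix_free_enc_bit: "prefix_free enc_bit"
  by (auto simp: prefix_free_def enc_bit_def)

lemma enc_list_simps: "enc_list e [] = [False]" "enc_list e (x # xs) = True # e x @ enc_list e xs"
  by (auto simp: enc_list_def)

lemma prefix_free_enc_list:
  assumes "prefix_free e"
  shows "prefix_free (enc_list e)"
proof -
  have "xs = ys \<and> a = b" if "enc_list e xs @ a = enc_list e ys @ b" for xs ys a b
    using that
  proof (induction xs arbitrary: ys)
    case Nil
    then show ?case by (cases ys) (auto simp: enc_list_simps)
  next
    case (Cons x xs)
    then obtain y zs where ys: "ys = y # zs" by (cases ys) (auto simp: enc_list_simps)
    with Cons.prems have "e x @ enc_list e xs @ a = e y @ enc_list e zs @ b"
      by (simp add: enc_list_simps)
    from prefix_freeD[OF assms this] Cons.IH[of zs] ys show ?case by simp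
  qed
  then show ?thesis by (simp add: prefix_free_def)
qed

lemma prefix_free_enc_pair:
  assumes "prefix_free e" "prefix_free e'"
  shows "prefix_free (enc_pair e e')"
proof -
  have "x = y \<and> a = b" if "enc_pair e e' x @ a = enc_pair e e' y @ b" for x y a b
  proof -
    have "e (fst x) @ e' (snd x) @ a = e (fst y) @ e' (snd y) @ b"
      using that by (simp add: enc_pair_def)
    from prefix_freeD[OF assms(1) this] prefix_freeD[OF assms(2)] show ?thesis
      by (auto simp: prod_eq_iff)
  qed
  then show ?thesis by (simp add: prefix_free_def)
qed

section \<open>Binary numerals and instances over arbitrary names\<close>

primrec bits_value :: "bool list \<Rightarrow> nat" where
  "bits_value [] = 0"
| "bits_value (b # bs) = of_bool b + 2 * bits_value bs"

definition canonical :: "bool list \<Rightarrow> bool" where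
  "canonical bs \<longleftrightarrow> bs = [] \<or> last bs"

lemma nat_bits_0 [simp]: "nat_bits 0 = []"
  by (subst nat_bits.simps) simp

lemma nat_bits_pos: "0 < n \<Longrightarrow> nat_bits n = odd n # nat_bits (n div 2)"
  by (subst nat_bits.simps) simp

lemma bits_value_nat_bits [simp]: "bits_value (nat_bits n) = n"
proof (induction n rule: less_induct)
  case (less n)
  then show ?case by (cases "n = 0") (auto simp: nat_bits_pos)
qed

lemma canonical_nat_bits [simp]: "canonical (nat_bits n)"
proof (induction n rule: less_induct)
  case (less n)
  show ?case
  proof (cases "n = 0")
    case False
    moreover have "nat_bits (n div 2) = [] \<Longrightarrow> n div 2 = 0"
      using bits_value_nat_bits[of "n div 2"] by simp
    ultimately show ?thesis using less[of "n div 2"]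
      by (auto simp: nat_bits_pos canonical_def)
  qed (simp add: canonical_def)
qed

lemma bits_value_pos: "canonical bs \<Longrightarrow> bs \<noteq> [] \<Longrightarrow> 0 < bits_value bs"
  by (induction bs) (auto simp: canonical_def split: if_splits)

lemma nat_bits_value: "canonical bs \<Longrightarrow> nat_bits (bits_value bs) = bs"
proof (induction bs)
  case (Cons b bs)
  have c: "canonical bs" using Cons.prems by (auto simp: canonical_def split: if_splits)
  have "0 < bits_value (b # bs)" using bits_value_pos[OF Cons.prems] by simp
  then show ?case using Cons.IH[OF c] by (subst nat_bits_pos) auto
qed simp

lemma bits_value_inj: "canonical xs \<Longrightarrow> canonical ys \<Longrightarrow> bits_value xs = bits_value ys \<longleftrightarrow> xs = ys"
  by (metis nat_bits_value)

lemma nat_bits_inj: "inj nat_bits"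
  by (metis bits_value_nat_bits injI)

abbreviation enc_bits :: "bool list \<Rightarrow> bool list" where
  "enc_bits \<equiv> enc_list enc_bit"

lemma prefix_free_enc_bits: "prefix_free enc_bits"
  by (intro prefix_free_enc_list prefix_free_enc_bit)

lemma prefix_free_enc_nat: "prefix_free enc_nat"
  unfolding prefix_free_def enc_nat_def
  by (metis prefix_freeD[OF prefix_free_enc_bits] bits_value_nat_bits)

text \<open>Instances with an arbitrary type of names, used for vertices and times alike: numbers in
  the problem, bit strings in everything that a machine computes. By \<open>enc_instance_map\<close>
  the encoding is the same for both.\<close>

type_synonym 'a instance_of =
  "'a list \<times> ('a \<times> 'a) list \<times> ('a \<times> 'a) list \<times> (('a \<times> 'a) \<times> ('a \<times> 'a)) list \<times> ('a \<times> 'a) list list"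

definition map_instance :: "('a \<Rightarrow> 'b) \<Rightarrow> 'a instance_of \<Rightarrow> 'b instance_of" where
  "map_instance f = (let f2 = map_prod f f in
     map_prod (map f) (map_prod (map f2) (map_prod (map f2) (map_prod (map (map_prod f2 f2)) (map (map f2))))))"

definition enc_instance_of :: "('a \<Rightarrow> bool list) \<Rightarrow> 'a instance_of \<Rightarrow> bool list" where
  "enc_instance_of e = (let enc2 = enc_pair e e in
      enc_pair (enc_list e) (enc_pair (enc_list enc2) (enc_pair (enc_list enc2)
        (enc_pair (enc_list (enc_pair enc2 enc2)) (enc_list (enc_list enc2))))))"

lemma enc_instance_eq: "enc_instance = enc_instance_of enc_nat"
  by (simp add: enc_instance_def enc_instance_of_def)

lemma enc_list_map: "enc_list e (map f xs) = enc_list (\<lambda>x. e (f x)) xs"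
  by (simp add: enc_list_def comp_def)

lemma enc_pair_map: "enc_pair e e' (map_prod f g z) = enc_pair (\<lambda>x. e (f x)) (\<lambda>y. e' (g y)) z"
  by (simp add: enc_pair_def)

lemma enc_instance_of_map: "enc_instance_of e (map_instance f I) = enc_instance_of (\<lambda>x. e (f x)) I"
  by (simp add: enc_instance_of_def map_instance_def Let_def enc_pair_map enc_list_map)

lemma enc_instance_map: "enc_instance I = enc_instance_of enc_bits (map_instance nat_bits I)"
  unfolding enc_instance_of_map enc_instance_eq by (simp add: enc_nat_def[abs_def])

lemma inj_enc_instance: "inj enc_instance"
  unfolding enc_instance_eq enc_instance_of_def Let_def
  by (intro prefix_free_inj prefix_free_enc_pair prefix_free_enc_list prefix_free_enc_nat)

lemma map_instance_comp: "map_instance f (map_instance g I) = map_instance (\<lambda>x. f (g x)) I"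
  by (simp add: map_instance_def Let_def prod.map_comp comp_def map_prod_def split_def)

lemma cp_enc_bit [pt_intros]: "cp S f \<Longrightarrow> cp S (\<lambda>x. enc_bit (f x))"
  unfolding enc_bit_def by (intro pt_intros cp_const) (auto dest: cp_base)

lemma cp_enc_list [pt_intros]:
  assumes e: "pt e" and l: "cp S l"
  shows "cp S (\<lambda>x. enc_list e (l x))"
  unfolding enc_list_def
  by (intro pt_intros cp_comp[OF _ e] l cp_const cp_base[OF l])

lemma cp_enc_pair [pt_intros]:
  assumes e: "pt e" "pt e'" and l: "cp S l"
  shows "cp S (\<lambda>x. enc_pair e e' (l x))"
  unfolding enc_pair_def
  by (intro pt_intros cp_comp[OF _ e(1)] cp_comp[OF _ e(2)] l)

lemmas pt_enc_list = cp_enc_list[OF _ cp_id[OF order_refl]]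
lemmas pt_enc_pair = cp_enc_pair[OF _ _ cp_id[OF order_refl]]

lemma pt_enc_bits: "pt enc_bits"
  by (intro pt_enc_list cp_enc_bit cp_id order_refl)

lemma pt_enc_instance_of: "pt e \<Longrightarrow> pt (enc_instance_of e)"
  unfolding enc_instance_of_def Let_def by (intro pt_enc_pair pt_enc_list)

section \<open>Branchings as forests\<close>

text \<open>A branching assigns to each vertex \<open>v\<close> a time \<open>\<tau> v\<close>, and a parent unless \<open>(v, \<tau> v)\<close> is a root;
  the rank \<open>rk\<close> excludes cycles.\<close>

definition forest ::
    "'v temporal_digraph \<Rightarrow> ('v \<times> nat) set \<Rightarrow> ('v \<Rightarrow> nat) \<Rightarrow> ('v \<Rightarrow> 'v) \<Rightarrow> ('v \<Rightarrow> nat) \<Rightarrow> bool" where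
  "forest \<G> R \<tau> p rk \<longleftrightarrow> (\<forall>v \<in> pverts (dg \<G>). (v, \<tau> v) \<in> temporal_verts \<G> \<and>
     ((v, \<tau> v) \<in> R \<or> p v \<in> pverts (dg \<G>) \<and> rk (p v) < rk v \<and>
        ((p v, \<tau> (p v)), (v, \<tau> v)) \<in> temporal_edges \<G>))"

definition forest_edges ::
    "'v temporal_digraph \<Rightarrow> ('v \<times> nat) set \<Rightarrow> ('v \<Rightarrow> nat) \<Rightarrow> ('v \<Rightarrow> 'v) \<Rightarrow> (('v \<times> nat) \<times> ('v \<times> nat)) set" where
  "forest_edges \<G> R \<tau> p =
     {((p v, \<tau> (p v)), (v, \<tau> v)) | v. v \<in> pverts (dg \<G>) \<and> (v, \<tau> v) \<notin> R}"

definition arc_of :: "('v \<times> nat) \<times> ('v \<times> nat) \<Rightarrow> 'v \<times> 'v" where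
  "arc_of e = (fst (fst e), fst (snd e))"

lemma temporal_walk_last: "temporal_walk \<B> x w z \<Longrightarrow> w \<noteq> [] \<and> last w = TVert z"
  by (induction rule: temporal_walk.induct) auto

lemma temporal_walk_end: "temporal_walk \<B> x w z \<Longrightarrow> z \<in> temporal_verts \<B>"
  by (induction rule: temporal_walk.induct) auto

lemma temporal_walk_hd: "temporal_walk \<B> x w z \<Longrightarrow> w \<noteq> [] \<and> hd w = TVert x"
  by (induction rule: temporal_walk.induct) auto

text \<open>Walks are built at their start, but parents are found at their end. The strict decrease
  of the length provides the ranks of a forest and rules out waiting.\<close>

lemma temporal_walk_unsnoc:
  assumes "temporal_walk \<B> x w z"
  shows "x = z \<or> (\<exists>v t w'. z = (v, t + 1) \<and> temporal_walk \<B> x w' (v, t) \<and> length w' < length w) \<or>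
    (\<exists>y w'. (y, z) \<in> temporal_edges \<B> \<and> temporal_walk \<B> x w' y \<and> length w' < length w)"
  using assms
proof (induction rule: temporal_walk.induct)
  case (single x)
  then show ?case by simp
next
  case (wait v t w z)
  from wait.IH show ?case
  proof (elim disjE exE conjE)
    assume "(v, t + 1) = z"
    moreover have "temporal_walk \<B> (v, t) [TVert (v, t)] (v, t)" using wait by (auto intro: temporal_walk.single)
    moreover have "0 < length w" using temporal_walk_last[OF wait.hyps(2)] by simp
    ultimately show ?thesis by force
  next
    fix v' t' w' assume "z = (v', t' + 1)" "temporal_walk \<B> (v, t + 1) w' (v', t')" "length w' < length w"
    then show ?thesis using temporal_walk.wait[OF wait.hyps(1), of w' "(v', t')"] by fastforce
  next
    fix y w' assume "(y, z) \<in> temporal_edges \<B>" "temporal_walk \<B> (v, t + 1) w' y" "length w' < length w"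
    then show ?thesis using temporal_walk.wait[OF wait.hyps(1), of w' y]
      by (metis length_Cons not_less_eq)
  qed
next
  case (traverse x y w z)
  from traverse.IH show ?case
  proof (elim disjE exE conjE)
    assume "y = z"
    moreover have "temporal_walk \<B> x [TVert x] x" using traverse by (auto intro: temporal_walk.single)
    ultimately show ?thesis using traverse.hyps(1)
      by (intro disjI2 exI[of _ x] exI[of _ "[TVert x]"]) auto
  next
    fix v' t' w' assume "z = (v', t' + 1)" "temporal_walk \<B> y w' (v', t')" "length w' < length w"
    then show ?thesis using temporal_walk.traverse[OF traverse.hyps(1,2), of w' "(v', t')"] by fastforce
  next
    fix y' w' assume "(y', z) \<in> temporal_edges \<B>" "temporal_walk \<B> y w' y'" "length w' < length w"
    then show ?thesis using temporal_walk.traverse[OF traverse.hyps(1,2), of w' y']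
      by (metis length_Cons less_SucI not_less_eq)
  qed
qed

lemma temporal_walk_snoc:
  assumes "temporal_walk \<B> x w y" "(y, z) \<in> temporal_edges \<B>" "z \<in> temporal_verts \<B>"
  shows "temporal_walk \<B> x (w @ [TEdge (y, z), TVert z]) z"
  using assms
proof (induction rule: temporal_walk.induct)
  case (single x)
  then show ?case
    using temporal_walk.traverse[of x z \<B> "[TVert z]" z] by (auto intro: temporal_walk.single)
next
  case (wait v t w y)
  then show ?case using temporal_walk.wait[of v t] by simp
next
  case (traverse x y' w y)
  then show ?case using temporal_walk.traverse[of x y'] by simp
qed

lemma temporal_edges_verts:
  assumes "temporal_digraph \<B>" "(y, z) \<in> temporal_edges \<B>"
  shows "y \<in> temporal_verts \<B>" "z \<in> temporal_verts \<B>" "snd y \<le> snd z"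
proof -
  obtain u t v t' where e: "y = (u, t)" "z = (v, t')" "(u, v) \<in> parcs (dg \<B>)" "(t, t') \<in> lam \<B> (u, v)"
    using assms(2) by (auto simp: temporal_edges_def)
  have "pair_digraph (dg \<B>)" using assms(1) by (simp add: temporal_digraph_def)
  then interpret pair_digraph "dg \<B>" .
  have "u \<in> pverts (dg \<B>)" "v \<in> pverts (dg \<B>)"
    using e(3) arc_fst_in_verts[of "(u, v)"] arc_snd_in_verts[of "(u, v)"] by auto
  then show "y \<in> temporal_verts \<B>" "z \<in> temporal_verts \<B>" "snd y \<le> snd z"
    using e assms(1) unfolding temporal_digraph_def temporal_verts_def by auto
qed

lemma subdigraph_temporal:
  assumes "temporal_subdigraph \<B> \<G>"
  shows "temporal_verts \<B> \<subseteq> temporal_verts \<G>" "temporal_edges \<B> \<subseteq> temporal_edges \<G>"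
    "pverts (dg \<B>) \<subseteq> pverts (dg \<G>)"
  using assms
  by (fastforce simp: temporal_subdigraph_def subgraph_def temporal_verts_def temporal_edges_def with_proj_def)+

text \<open>Let \<open>\<tau> u\<close> be the end time of the unique walk \<open>W u\<close>, and
  let its length be the rank. A shorter part of \<open>W u\<close> from the same root is the unique
  walk of the vertex where it ends; hence the last step cannot be a wait, which would leave a
  shorter walk to \<open>u\<close>, and if it is an edge, then the edge comes from a vertex at its
  own chosen time. Only an inclusion is claimed because the branching may contain temporal edges
  that no walk from \<open>R\<close> uses.\<close>

lemma branching_forest:
  assumes "vertex_spanning_branching \<G> R \<B>"
  shows "\<exists>\<tau> p rk. forest \<G> R \<tau> p rk \<and> forest_edges \<G> R \<tau> p \<subseteq> temporal_edges \<B>"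
proof -
  have sub: "temporal_subdigraph \<B> \<G>" and td: "temporal_digraph \<B>"
    using assms by (auto simp: vertex_spanning_branching_def temporal_subdigraph_def)
  let ?Q = "\<lambda>u w i. (u, i) \<in> temporal_verts \<G> \<and> (\<exists>r \<in> R. temporal_walk \<B> r w (u, i))"
  have ex1: "\<exists>!w. \<exists>i. ?Q u w i" if "u \<in> pverts (dg \<G>)" for u
  proof -
    have eq: "(\<exists>i. ?Q u w i) \<longleftrightarrow> (\<exists>r \<in> R. \<exists>i. (u, i) \<in> temporal_verts \<G> \<and> temporal_walk \<B> r w (u, i))" for w
      by blast
    show ?thesis unfolding eq using assms that by (simp add: vertex_spanning_branching_def)
  qed
  have "\<exists>w i. ?Q u w i" if "u \<in> pverts (dg \<G>)" for u
    using ex1[OF that] by blast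
  then obtain W \<tau> where W: "\<And>u. u \<in> pverts (dg \<G>) \<Longrightarrow> ?Q u (W u) (\<tau> u)" by metis
  have uniq: "w = W u \<and> i = \<tau> u" if "r \<in> R" "temporal_walk \<B> r w (u, i)" for r w u i
  proof -
    have v: "(u, i) \<in> temporal_verts \<G>" using temporal_walk_end[OF that(2)] subdigraph_temporal[OF sub] by blast
    then have u: "u \<in> pverts (dg \<G>)" by (simp add: temporal_verts_def)
    then have "w = W u" using ex1[OF u] W[OF u] that v by blast
    moreover from this have "i = \<tau> u"
      using W[OF u] temporal_walk_last[OF that(2)] temporal_walk_last[of \<B> _ "W u"] by auto
    ultimately show ?thesis by blast
  qed
  define rk where "rk u = length (W u)" for u
  have "\<exists>q. (u, \<tau> u) \<in> R \<or> q \<in> pverts (dg \<G>) \<and> rk q < rk u \<and> ((q, \<tau> q), (u, \<tau> u)) \<in> temporal_edges \<B>"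
    if u: "u \<in> pverts (dg \<G>)" for u
  proof -
    obtain r where r: "r \<in> R" "temporal_walk \<B> r (W u) (u, \<tau> u)" using W[OF u] by blast
    from temporal_walk_unsnoc[OF r(2)] show ?thesis
    proof (elim disjE exE conjE)
      assume "r = (u, \<tau> u)" then show ?thesis using r by blast
    next
      fix v t w' assume h: "(u, \<tau> u) = (v, t + 1)" "temporal_walk \<B> r w' (v, t)" "length w' < length (W u)"
      then have "w' = W u" using uniq[OF r(1) h(2)] by simp
      then show ?thesis using h by simp
    next
      fix y w' assume h: "(y, (u, \<tau> u)) \<in> temporal_edges \<B>" "temporal_walk \<B> r w' y" "length w' < length (W u)"
      obtain q i where y: "y = (q, i)" by (cases y)
      have "w' = W q" "i = \<tau> q" using uniq[OF r(1), of w' q i] h(2) y by auto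
      moreover have "q \<in> pverts (dg \<G>)"
        using temporal_walk_end[OF h(2)] subdigraph_temporal[OF sub] y by (auto simp: temporal_verts_def)
      ultimately show ?thesis using h y by (auto simp: rk_def)
    qed
  qed
  then obtain p where p: "\<And>u. u \<in> pverts (dg \<G>) \<Longrightarrow> (u, \<tau> u) \<in> R \<or>
      p u \<in> pverts (dg \<G>) \<and> rk (p u) < rk u \<and> ((p u, \<tau> (p u)), (u, \<tau> u)) \<in> temporal_edges \<B>"
    by metis
  have "forest \<G> R \<tau> p rk"
    using W p subdigraph_temporal(2)[OF sub] unfolding forest_def by blast
  moreover have "forest_edges \<G> R \<tau> p \<subseteq> temporal_edges \<B>"
    using p unfolding forest_edges_def by blast
  ultimately show ?thesis by blast
qed

text \<open>The number is fuel for following parents back to a root; any amount not below the rank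
  of \<open>v\<close> gives the same walk.\<close>

fun forest_walk :: "('v \<times> nat) set \<Rightarrow> ('v \<Rightarrow> nat) \<Rightarrow> ('v \<Rightarrow> 'v) \<Rightarrow> nat \<Rightarrow> 'v \<Rightarrow> 'v walk_item list" where
  "forest_walk R \<tau> p 0 v = [TVert (v, \<tau> v)]"
| "forest_walk R \<tau> p (Suc n) v = (if (v, \<tau> v) \<in> R then [TVert (v, \<tau> v)]
     else forest_walk R \<tau> p n (p v) @ [TEdge ((p v, \<tau> (p v)), (v, \<tau> v)), TVert (v, \<tau> v)])"

text \<open>The subdigraph keeps one time for each vertex and only the forest edges. Its arcs are
  thus precisely those of its temporal edges, as edge-disjointness requires.\<close>

lemma forest_branching:
  assumes td: "temporal_digraph \<G>" and f: "forest \<G> R \<tau> p rk"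
  shows "\<exists>\<B>. vertex_spanning_branching \<G> R \<B> \<and> temporal_edges \<B> = forest_edges \<G> R \<tau> p \<and>
    parcs (dg \<B>) = arc_of ` forest_edges \<G> R \<tau> p"
proof -
  let ?V = "pverts (dg \<G>)"
  define \<B> where "\<B> = \<lparr>dg = \<lparr>pverts = ?V, parcs = {(p v, v) | v. v \<in> ?V \<and> (v, \<tau> v) \<notin> R}\<rparr>,
    gam = (\<lambda>v. if v \<in> ?V then {\<tau> v} else {}),
    lam = (\<lambda>(u, v). if v \<in> ?V \<and> (v, \<tau> v) \<notin> R \<and> u = p v then {(\<tau> u, \<tau> v)} else {})\<rparr>"
  have tv: "temporal_verts \<B> = {(v, \<tau> v) | v. v \<in> ?V}"
    by (auto simp: temporal_verts_def \<B>_def split: if_splits)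
  have te: "temporal_edges \<B> = forest_edges \<G> R \<tau> p"
    by (auto simp: temporal_edges_def forest_edges_def \<B>_def split: if_splits)
  have pd: "pair_digraph (dg \<G>)" using td by (simp add: temporal_digraph_def)
  then interpret G: pair_digraph "dg \<G>" .
  have fv: "(v, \<tau> v) \<in> temporal_verts \<G>" if "v \<in> ?V" for v using f that by (auto simp: forest_def)
  have fp: "p v \<in> ?V \<and> rk (p v) < rk v \<and> ((p v, \<tau> (p v)), (v, \<tau> v)) \<in> temporal_edges \<G>"
    if "v \<in> ?V" "(v, \<tau> v) \<notin> R" for v using f that by (auto simp: forest_def)
  have arcs: "parcs (dg \<B>) \<subseteq> parcs (dg \<G>)"
    using fp by (auto simp: \<B>_def temporal_edges_def)
  have "pair_digraph (dg \<B>)"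
  proof
    show "fst e \<in> pverts (dg \<B>)" "snd e \<in> pverts (dg \<B>)" if "e \<in> parcs (dg \<B>)" for e
      using fp that by (auto simp: \<B>_def)
    show "finite (pverts (dg \<B>))" using G.pair_finite_verts by (simp add: \<B>_def)
    show "finite (parcs (dg \<B>))" using arcs G.pair_finite_arcs finite_subset by blast
    show "fst e \<noteq> snd e" if "e \<in> parcs (dg \<B>)" for e using arcs that G.no_loops by blast
  qed
  then interpret B: pair_digraph "dg \<B>" .
  have tdB: "temporal_digraph \<B>"
    unfolding temporal_digraph_def
  proof (intro conjI allI impI)
    show "pair_digraph (dg \<B>)" ..
    show "finite (gam \<B> v)" for v by (simp add: \<B>_def)
    show "0 \<notin> gam \<B> v" for v
      using fv[of v] td by (auto simp: \<B>_def temporal_digraph_def temporal_verts_def split: if_splits) (metis gr0I)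
    show "gam \<B> v = {}" if "v \<notin> pverts (dg \<B>)" for v using that by (simp add: \<B>_def)
    show "lam \<B> e = {}" if "e \<notin> parcs (dg \<B>)" for e using that by (cases e) (auto simp: \<B>_def)
    fix u v t t' assume "(t, t') \<in> lam \<B> (u, v)"
    then have h: "v \<in> ?V" "(v, \<tau> v) \<notin> R" "u = p v" "t = \<tau> u" "t' = \<tau> v"
      by (auto simp: \<B>_def split: if_splits)
    with fp[OF h(1,2)] temporal_edges_verts[OF td, of "(u, t)" "(v, t')"]
    show "t \<le> t'" "t \<in> gam \<B> u" "t' \<in> gam \<B> v" by (auto simp: \<B>_def)
  qed
  have sub: "temporal_subdigraph \<B> \<G>"
    unfolding temporal_subdigraph_def subgraph_def
  proof (intro conjI allI)
    show "gam \<B> v \<subseteq> gam \<G> v" for v using fv[of v] by (auto simp: \<B>_def temporal_verts_def)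
    show "lam \<B> e \<subseteq> lam \<G> e" for e
      using fp by (cases e) (auto simp: \<B>_def temporal_edges_def)
  qed (use td tdB arcs G.wf_digraph B.wf_digraph in \<open>auto simp: with_proj_def compatible_def \<B>_def\<close>)
  have indep: "forest_walk R \<tau> p n v = forest_walk R \<tau> p m v" if "v \<in> ?V" "rk v \<le> n" "rk v \<le> m" for n m v
    using that
  proof (induction n arbitrary: m v)
    case 0
    then have "(v, \<tau> v) \<in> R" using fp[of v] by (cases "(v, \<tau> v) \<in> R") auto
    then show ?case by (cases m) auto
  next
    case (Suc n)
    show ?case
    proof (cases m)
      case 0
      then have "(v, \<tau> v) \<in> R" using fp[of v] Suc.prems by (cases "(v, \<tau> v) \<in> R") auto
      then show ?thesis using 0 by simp
    next
      case (Suc m')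
      then show ?thesis using fp[of v] Suc.prems Suc.IH[of "p v" m'] by auto
    qed
  qed
  define W where "W v = forest_walk R \<tau> p (rk v) v" for v
  have W_root: "W v = [TVert (v, \<tau> v)]" if "(v, \<tau> v) \<in> R" for v
    using that by (cases "rk v") (auto simp: W_def)
  have W_edge: "W v = W (p v) @ [TEdge ((p v, \<tau> (p v)), (v, \<tau> v)), TVert (v, \<tau> v)]"
    if "v \<in> ?V" "(v, \<tau> v) \<notin> R" for v
  proof -
    note fpv = fp[OF that]
    then obtain n where n: "rk v = Suc n" by (cases "rk v") auto
    then have "forest_walk R \<tau> p n (p v) = W (p v)"
      unfolding W_def using fpv by (intro indep) auto
    then show ?thesis using that n by (simp add: W_def)
  qed
  have exists: "\<exists>r \<in> R. temporal_walk \<B> r (W v) (v, \<tau> v)" if "v \<in> ?V" for v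
    using that
  proof (induction "rk v" arbitrary: v rule: less_induct)
    case less
    show ?case
    proof (cases "(v, \<tau> v) \<in> R")
      case True
      then show ?thesis using less.prems W_root tv by (auto intro!: bexI[of _ "(v, \<tau> v)"] temporal_walk.single)
    next
      case False
      then obtain r where r: "r \<in> R" "temporal_walk \<B> r (W (p v)) (p v, \<tau> (p v))"
        using less fp by blast
      have "((p v, \<tau> (p v)), (v, \<tau> v)) \<in> temporal_edges \<B>"
        using False less.prems te by (auto simp: forest_edges_def)
      then show ?thesis using temporal_walk_snoc[OF r(2)] r(1) W_edge[OF less.prems False] tv less.prems by auto
    qed
  qed
  \<comment> \<open>Every walk prolongs the forest walk of its start to the forest walk of its end.
    If the start is a root, its forest walk is a single temporal vertex, so that the walk is
    determined by its end. A wait would need two times at one vertex.\<close>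
  have unique: "W (fst x) @ tl w = W (fst z)" if "temporal_walk \<B> x w z" for x w z
    using that
  proof (induction rule: temporal_walk.induct)
    case (wait v t w z)
    have "(v, t + 1) \<in> temporal_verts \<B>"
      using wait.hyps(2) by (cases rule: temporal_walk.cases) auto
    then show ?case using wait.hyps(1) tv by auto
  next
    case (traverse x y w z)
    obtain v where v: "x = (p v, \<tau> (p v))" "y = (v, \<tau> v)" "v \<in> ?V" "(v, \<tau> v) \<notin> R"
      using traverse.hyps(1) te by (auto simp: forest_edges_def)
    have "w = TVert y # tl w" using temporal_walk_hd[OF traverse.hyps(3)] by (metis list.collapse)
    then show ?case using traverse.IH v W_edge[OF v(3,4)]
      by (metis append.assoc append_Cons append_Nil fst_conv list.sel(3))
  qed simp
  have "\<exists>!w. \<exists>r \<in> R. \<exists>i. (u, i) \<in> temporal_verts \<G> \<and> temporal_walk \<B> r w (u, i)" if u: "u \<in> ?V" for u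
  proof (rule ex1I[of _ "W u"])
    show "\<exists>r \<in> R. \<exists>i. (u, i) \<in> temporal_verts \<G> \<and> temporal_walk \<B> r (W u) (u, i)"
      using exists[OF u] fv[OF u] by blast
    fix w assume "\<exists>r \<in> R. \<exists>i. (u, i) \<in> temporal_verts \<G> \<and> temporal_walk \<B> r w (u, i)"
    then obtain r i where r: "r \<in> R" "temporal_walk \<B> r w (u, i)" by blast
    have "r \<in> temporal_verts \<B>" using r(2) by (cases rule: temporal_walk.cases) auto
    then have "W (fst r) = [TVert r]" using tv r(1) W_root by auto
    with unique[OF r(2)] temporal_walk_hd[OF r(2)] show "w = W u" by (metis append_Cons append_Nil fst_conv list.collapse)
  qed
  then have "vertex_spanning_branching \<G> R \<B>"
    unfolding vertex_spanning_branching_def using sub by blast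
  moreover have "parcs (dg \<B>) = arc_of ` forest_edges \<G> R \<tau> p"
    by (auto simp: \<B>_def forest_edges_def arc_of_def image_def)
  ultimately show ?thesis using te by blast
qed

text \<open>The function \<open>\<pi>\<close> selects what two branchings must not share: the
  identity for temporal edges, \<open>arc_of\<close> for arcs.\<close>

definition forests ::
    "((('v \<times> nat) \<times> ('v \<times> nat)) \<Rightarrow> 'b) \<Rightarrow> 'v temporal_digraph \<Rightarrow> ('v \<times> nat) set list \<Rightarrow> bool" where
  "forests \<pi> \<G> Rs \<longleftrightarrow> (\<exists>\<tau> p rk. (\<forall>i < length Rs. forest \<G> (Rs ! i) (\<tau> i) (p i) (rk i)) \<and>
     (\<forall>i < length Rs. \<forall>j < length Rs. i \<noteq> j \<longrightarrow>
        \<pi> ` forest_edges \<G> (Rs ! i) (\<tau> i) (p i) \<inter> \<pi> ` forest_edges \<G> (Rs ! j) (\<tau> j) (p j) = {}))"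

text \<open>\<open>D1\<close> is applied to arbitrary branchings, \<open>D2\<close> only to those
  built from forests. The latter may assume that every arc carries a temporal edge; otherwise bare
  arcs could violate edge-disjointness.\<close>

lemma has_disjoint_branchings_forests:
  assumes td: "temporal_digraph \<G>"
    and D1: "\<And>\<B>1 \<B>2. temporal_subdigraph \<B>1 \<G> \<Longrightarrow> temporal_subdigraph \<B>2 \<G> \<Longrightarrow> D \<G> \<B>1 \<B>2 \<Longrightarrow>
      \<pi> ` temporal_edges \<B>1 \<inter> \<pi> ` temporal_edges \<B>2 = {}"
    and D2: "\<And>\<B>1 \<B>2. temporal_subdigraph \<B>1 \<G> \<Longrightarrow> temporal_subdigraph \<B>2 \<G> \<Longrightarrow>
      parcs (dg \<B>1) = arc_of ` temporal_edges \<B>1 \<Longrightarrow> parcs (dg \<B>2) = arc_of ` temporal_edges \<B>2 \<Longrightarrow>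
      \<pi> ` temporal_edges \<B>1 \<inter> \<pi> ` temporal_edges \<B>2 = {} \<Longrightarrow> D \<G> \<B>1 \<B>2"
  shows "has_disjoint_branchings D \<G> Rs \<longleftrightarrow> forests \<pi> \<G> Rs"
proof
  assume "has_disjoint_branchings D \<G> Rs"
  then obtain \<B> where B: "\<And>i. i < length Rs \<Longrightarrow> vertex_spanning_branching \<G> (Rs ! i) (\<B> i)"
    and d: "\<And>i j. i < length Rs \<Longrightarrow> j < length Rs \<Longrightarrow> i \<noteq> j \<Longrightarrow> D \<G> (\<B> i) (\<B> j)"
    unfolding has_disjoint_branchings_def by blast
  have sub: "temporal_subdigraph (\<B> i) \<G>" if "i < length Rs" for i
    using B[OF that] by (simp add: vertex_spanning_branching_def)
  have "\<exists>\<tau> p rk. i < length Rs \<longrightarrow> forest \<G> (Rs ! i) \<tau> p rk \<and> forest_edges \<G> (Rs ! i) \<tau> p \<subseteq> temporal_edges (\<B> i)" for i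
    using branching_forest[OF B[of i]] by blast
  then obtain \<tau> p rk where f: "\<And>i. i < length Rs \<Longrightarrow> forest \<G> (Rs ! i) (\<tau> i) (p i) (rk i) \<and>
      forest_edges \<G> (Rs ! i) (\<tau> i) (p i) \<subseteq> temporal_edges (\<B> i)" by metis
  have "\<pi> ` forest_edges \<G> (Rs ! i) (\<tau> i) (p i) \<inter> \<pi> ` forest_edges \<G> (Rs ! j) (\<tau> j) (p j) = {}"
    if "i < length Rs" "j < length Rs" "i \<noteq> j" for i j
    using D1[OF sub[OF that(1)] sub[OF that(2)] d[OF that]] f[OF that(1)] f[OF that(2)] by blast
  with f show "forests \<pi> \<G> Rs" unfolding forests_def by blast
next
  assume "forests \<pi> \<G> Rs"
  then obtain \<tau> p rk where fd: "(\<forall>i < length Rs. forest \<G> (Rs ! i) (\<tau> i) (p i) (rk i)) \<and>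
     (\<forall>i < length Rs. \<forall>j < length Rs. i \<noteq> j \<longrightarrow>
        \<pi> ` forest_edges \<G> (Rs ! i) (\<tau> i) (p i) \<inter> \<pi> ` forest_edges \<G> (Rs ! j) (\<tau> j) (p j) = {})"
    unfolding forests_def by (elim exE)
  note f = conjunct1[OF fd, rule_format] and d = conjunct2[OF fd, rule_format]
  have "\<exists>\<B>. i < length Rs \<longrightarrow> vertex_spanning_branching \<G> (Rs ! i) \<B> \<and>
      temporal_edges \<B> = forest_edges \<G> (Rs ! i) (\<tau> i) (p i) \<and>
      parcs (dg \<B>) = arc_of ` forest_edges \<G> (Rs ! i) (\<tau> i) (p i)" for i
    using forest_branching[OF td f[of i]] by blast
  then obtain \<B> where B: "\<And>i. i < length Rs \<Longrightarrow> vertex_spanning_branching \<G> (Rs ! i) (\<B> i) \<and>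
      temporal_edges (\<B> i) = forest_edges \<G> (Rs ! i) (\<tau> i) (p i) \<and>
      parcs (dg (\<B> i)) = arc_of ` forest_edges \<G> (Rs ! i) (\<tau> i) (p i)" by metis
  have "D \<G> (\<B> i) (\<B> j)" if "i < length Rs" "j < length Rs" "i \<noteq> j" for i j
    by (rule D2) (use B[OF that(1)] B[OF that(2)] d[OF that] in \<open>simp_all add: vertex_spanning_branching_def\<close>)
  then show "has_disjoint_branchings D \<G> Rs"
    unfolding has_disjoint_branchings_def by (intro exI[of _ \<B>]) (simp add: B)
qed

lemma t_edge_disjoint_forests:
  assumes "temporal_digraph \<G>"
  shows "has_disjoint_branchings t_edge_disjoint \<G> Rs \<longleftrightarrow> forests (\<lambda>e. e) \<G> Rs"
proof (rule has_disjoint_branchings_forests[OF assms])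
  fix \<B>1 \<B>2 assume s: "temporal_subdigraph \<B>1 \<G>" "temporal_subdigraph \<B>2 \<G>"
  have arcs: "parcs (dg \<B>1) \<subseteq> parcs (dg \<G>)"
    using s by (auto simp: temporal_subdigraph_def subgraph_def with_proj_def)
  show "(\<lambda>e. e) ` temporal_edges \<B>1 \<inter> (\<lambda>e. e) ` temporal_edges \<B>2 = {}" if "t_edge_disjoint \<G> \<B>1 \<B>2"
    using that arcs by (fastforce simp: t_edge_disjoint_def temporal_edges_def)
  assume d: "(\<lambda>e. e) ` temporal_edges \<B>1 \<inter> (\<lambda>e. e) ` temporal_edges \<B>2 = {}"
  have l: "(t, t') \<in> lam \<B> (u, v) \<Longrightarrow> ((u, t), (v, t')) \<in> temporal_edges \<B>"
    if "temporal_subdigraph \<B> \<G>" for \<B> u v t t'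
    using that by (cases "(u, v) \<in> parcs (dg \<B>)")
      (auto simp: temporal_subdigraph_def temporal_digraph_def temporal_edges_def)
  show "t_edge_disjoint \<G> \<B>1 \<B>2"
    using d l[OF s(1)] l[OF s(2)] by (fastforce simp: t_edge_disjoint_def)
qed

lemma edge_disjoint_forests:
  assumes "temporal_digraph \<G>"
  shows "has_disjoint_branchings edge_disjoint \<G> Rs \<longleftrightarrow> forests arc_of \<G> Rs"
proof (rule has_disjoint_branchings_forests[OF assms])
  fix \<B>1 \<B>2 :: "'a temporal_digraph"
  have "arc_of ` temporal_edges \<B> \<subseteq> parcs (dg \<B>)" for \<B> :: "'a temporal_digraph"
    by (auto simp: arc_of_def temporal_edges_def)
  then show "arc_of ` temporal_edges \<B>1 \<inter> arc_of ` temporal_edges \<B>2 = {}" if "edge_disjoint \<G> \<B>1 \<B>2"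
    using that unfolding edge_disjoint_def by (meson disjoint_iff subsetD)
qed (simp add: edge_disjoint_def)

section \<open>From multivalued satisfiability to branchings\<close>

text \<open>Variables take values that are bit strings; \<open>(i, a)\<close> is the literal \<open>i = a\<close>. A formula lists its
  variables, the admissible pairs of a variable and a value, and its clauses.\<close>

type_synonym literal = "bool list \<times> bool list"
type_synonym mv_formula = "bool list list \<times> literal list \<times> literal list list"

definition mv_wf :: "mv_formula \<Rightarrow> bool" where
  "mv_wf \<phi> \<longleftrightarrow> fst ` set (fst (snd \<phi>)) \<subseteq> set (fst \<phi>) \<and> (\<forall>C \<in> set (snd (snd \<phi>)). set C \<subseteq> set (fst (snd \<phi>)))"

definition mv_sat :: "mv_formula \<Rightarrow> bool" where
  "mv_sat \<phi> \<longleftrightarrow> (\<exists>\<tau>. (\<forall>i \<in> set (fst \<phi>). (i, \<tau> i) \<in> set (fst (snd \<phi>))) \<and>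
     (\<forall>C \<in> set (snd (snd \<phi>)). \<exists>l \<in> set C. \<tau> (fst l) = snd l))"

text \<open>The first bit separates variables from clauses. The final True makes names canonical, so
  that different names are different numbers, and makes times positive; in particular the values
  \<open>[]\<close> and \<open>[False]\<close> become the times 1 and 2.\<close>

definition source_name :: "bool list \<Rightarrow> bool list" where
  "source_name i = False # i @ [True]"

definition clause_name :: "literal list \<Rightarrow> bool list" where
  "clause_name C = True # enc_list (enc_pair enc_bits enc_bits) C @ [True]"

definition time_name :: "bool list \<Rightarrow> bool list" where
  "time_name a = a @ [True]"

text \<open>The first branching chooses a value \<open>a\<close> for each variable \<open>i\<close>, as the root \<open>(i, a)\<close>; a clause can
  only be reached from a literal that is satisfied. The other branchings are trivial.\<close>

definition reduce :: "nat \<Rightarrow> mv_formula \<Rightarrow> bool list instance_of" where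
  "reduce k \<phi> =
    (let roots = map (\<lambda>l. (source_name (fst l), time_name (snd l))) (fst (snd \<phi>));
         tvs = roots @ concat (map (\<lambda>C. map (\<lambda>l. (clause_name C, time_name (snd l))) C) (snd (snd \<phi>)))
     in (map source_name (fst \<phi>) @ map clause_name (snd (snd \<phi>)),
         concat (map (\<lambda>C. map (\<lambda>l. (source_name (fst l), clause_name C)) C) (snd (snd \<phi>))),
         tvs,
         concat (map (\<lambda>C. map (\<lambda>l. ((source_name (fst l), time_name (snd l)), (clause_name C, time_name (snd l)))) C)
           (snd (snd \<phi>))),
         roots # replicate (k - 1) tvs))"

definition reduced :: "nat \<Rightarrow> mv_formula \<Rightarrow> branching_instance" where
  "reduced k \<phi> = map_instance bits_value (reduce k \<phi>)"

abbreviation "source_vertex i \<equiv> bits_value (source_name i)"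
abbreviation "clause_vertex C \<equiv> bits_value (clause_name C)"
abbreviation "time_value a \<equiv> bits_value (time_name a)"

lemma canonical_names: "canonical (source_name i)" "canonical (clause_name C)" "canonical (time_name a)"
  by (auto simp: canonical_def source_name_def clause_name_def time_name_def)

lemma inj_enc_clause: "enc_list (enc_pair enc_bits enc_bits) C = enc_list (enc_pair enc_bits enc_bits) C' \<longleftrightarrow> C = C'"
  using prefix_free_inj[OF prefix_free_enc_list[OF prefix_free_enc_pair[OF prefix_free_enc_bits prefix_free_enc_bits]]]
  by (simp add: inj_eq)

lemma vertex_inj [simp]:
  "source_vertex i = source_vertex j \<longleftrightarrow> i = j" "clause_vertex C = clause_vertex C' \<longleftrightarrow> C = C'"
  "time_value a = time_value b \<longleftrightarrow> a = b" "source_vertex i \<noteq> clause_vertex C" "clause_vertex C \<noteq> source_vertex i"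
  by (simp_all add: bits_value_inj canonical_names) 
     (auto simp: source_name_def clause_name_def time_name_def inj_enc_clause)

lemma time_value_pos [simp]: "0 < time_value a"
  using bits_value_pos[OF canonical_names(3)[of a]] by (simp add: time_name_def)

lemma time_value_neq [simp]: "time_value a \<noteq> 0"
  using time_value_pos[of a] by linarith

definition clause_literals :: "mv_formula \<Rightarrow> (literal list \<times> literal) set" where
  "clause_literals \<phi> = {(C, l). C \<in> set (snd (snd \<phi>)) \<and> l \<in> set C}"

definition reduced_roots :: "mv_formula \<Rightarrow> (nat \<times> nat) set" where
  "reduced_roots \<phi> = (\<lambda>l. (source_vertex (fst l), time_value (snd l))) ` set (fst (snd \<phi>))"

definition reduced_verts :: "mv_formula \<Rightarrow> (nat \<times> nat) set" where
  "reduced_verts \<phi> = reduced_roots \<phi> \<union> (\<lambda>(C, l). (clause_vertex C, time_value (snd l))) ` clause_literals \<phi>"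

lemma reduced_graph:
  "pverts (dg (tdigraph_of (reduced k \<phi>))) = source_vertex ` set (fst \<phi>) \<union> clause_vertex ` set (snd (snd \<phi>))"
  "parcs (dg (tdigraph_of (reduced k \<phi>))) =
     (\<lambda>(C, l). (source_vertex (fst l), clause_vertex C)) ` clause_literals \<phi>"
  "gam (tdigraph_of (reduced k \<phi>)) v = {t. (v, t) \<in> reduced_verts \<phi>}"
  "lam (tdigraph_of (reduced k \<phi>)) (u, v) = {(t, t'). ((u, t), (v, t')) \<in>
     (\<lambda>(C, l). ((source_vertex (fst l), time_value (snd l)), (clause_vertex C, time_value (snd l)))) ` clause_literals \<phi>}"
  "roots_of (reduced k \<phi>) = reduced_roots \<phi> # replicate (k - 1) (reduced_verts \<phi>)"
  by (auto simp: reduced_def reduce_def map_instance_def Let_def reduced_roots_def reduced_verts_def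
      clause_literals_def image_iff split_def) force+

lemma temporal_digraph_reduced:
  assumes wf: "mv_wf \<phi>"
  shows "temporal_digraph (tdigraph_of (reduced k \<phi>))"
proof -
  let ?G = "tdigraph_of (reduced k \<phi>)"
  have fin: "finite (clause_literals \<phi>)"
    by (rule finite_subset[of _ "Sigma (set (snd (snd \<phi>))) set"]) (auto simp: clause_literals_def)
  have lit: "l \<in> set (fst (snd \<phi>)) \<and> fst l \<in> set (fst \<phi>) \<and> C \<in> set (snd (snd \<phi>))" if "(C, l) \<in> clause_literals \<phi>" for C l
    using wf that by (force simp: mv_wf_def clause_literals_def)
  have src: "fst l \<in> set (fst \<phi>)" if "l \<in> set (fst (snd \<phi>))" for l
    using wf that by (force simp: mv_wf_def)
  have fv: "finite (reduced_verts \<phi>)" using fin by (simp add: reduced_verts_def reduced_roots_def)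
  have "pair_digraph (dg ?G)"
  proof
    show "fst e \<in> pverts (dg ?G)" "snd e \<in> pverts (dg ?G)" "fst e \<noteq> snd e" if "e \<in> parcs (dg ?G)" for e
      using that lit unfolding reduced_graph by auto
    show "finite (pverts (dg ?G))" "finite (parcs (dg ?G))" using fin unfolding reduced_graph by auto
  qed
  moreover have "finite (gam ?G v)" for v
    unfolding reduced_graph by (rule finite_subset[of _ "snd ` reduced_verts \<phi>"]) (force intro: fv)+
  ultimately show ?thesis
    unfolding temporal_digraph_def
  proof (intro conjI allI impI)
    show "0 \<notin> gam ?G v" for v
      unfolding reduced_graph by (auto simp: reduced_verts_def reduced_roots_def)
    show "gam ?G v = {}" if "v \<notin> pverts (dg ?G)" for v
      using that lit src unfolding reduced_graph by (force simp: reduced_verts_def reduced_roots_def)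
    show "lam ?G e = {}" if "e \<notin> parcs (dg ?G)" for e
      using that by (cases e) (force simp: reduced_graph)
    fix u v t t' assume "(t, t') \<in> lam ?G (u, v)"
    then obtain C l where "(C, l) \<in> clause_literals \<phi>" "u = source_vertex (fst l)" "v = clause_vertex C"
      "t = time_value (snd l)" "t' = t" unfolding reduced_graph by auto
    with lit[of C l] show "t \<le> t'" "t \<in> gam ?G u" "t' \<in> gam ?G v"
      unfolding reduced_graph reduced_verts_def reduced_roots_def by force+
  qed auto
qed

lemma temporal_verts_reduced:
  assumes "mv_wf \<phi>"
  shows "temporal_verts (tdigraph_of (reduced k \<phi>)) = reduced_verts \<phi>"
proof -
  have "v \<in> pverts (dg (tdigraph_of (reduced k \<phi>)))" if "(v, t) \<in> reduced_verts \<phi>" for v t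
    using temporal_digraph_reduced[OF assms, of k] that
    by (auto simp: temporal_digraph_def reduced_graph(3))
  then show ?thesis by (auto simp: temporal_verts_def reduced_graph(3))
qed

lemma temporal_edges_reduced:
  "temporal_edges (tdigraph_of (reduced k \<phi>)) =
    (\<lambda>(C, l). ((source_vertex (fst l), time_value (snd l)), (clause_vertex C, time_value (snd l)))) ` clause_literals \<phi>"
  unfolding temporal_edges_def reduced_graph by (force simp: image_iff)

lemma reduced_instance:
  assumes "mv_wf \<phi>" "1 \<le> k"
  shows "reduced k \<phi> \<in> branching_instances k"
  using assms temporal_digraph_reduced[OF assms(1), of k] temporal_verts_reduced[OF assms(1), of k]
  by (auto simp: branching_instances_def reduced_graph(5) reduced_verts_def)

text \<open>A source has no incoming temporal edge, so that its time in the first forest must be a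
  root and is the value of the variable. A clause has no root, and edges into it preserve time, so
  that its parent is a source standing at the value of a literal. Conversely, the other forests can
  consist of roots only; having no edges, they satisfy disjointness for every \<open>\<pi>\<close>,
  which settles both problems at once.\<close>

lemma forests_reduced:
  assumes wf: "mv_wf \<phi>" and k: "1 \<le> k"
  shows "forests \<pi> (tdigraph_of (reduced k \<phi>)) (roots_of (reduced k \<phi>)) \<longleftrightarrow> mv_sat \<phi>"
proof
  let ?G = "tdigraph_of (reduced k \<phi>)"
  assume "forests \<pi> ?G (roots_of (reduced k \<phi>))"
  then obtain \<tau> p rk where "\<forall>i < length (roots_of (reduced k \<phi>)). forest ?G (roots_of (reduced k \<phi>) ! i) (\<tau> i) (p i) (rk i)"
    unfolding forests_def by (elim exE conjE)
  then have f: "forest ?G (reduced_roots \<phi>) (\<tau> 0) (p 0) (rk 0)"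
    by (auto simp: reduced_graph(5))
  have src: "\<exists>a. (i, a) \<in> set (fst (snd \<phi>)) \<and> \<tau> 0 (source_vertex i) = time_value a" if "i \<in> set (fst \<phi>)" for i
  proof -
    have "source_vertex i \<in> pverts (dg ?G)" using that by (simp add: reduced_graph)
    with f have "(source_vertex i, \<tau> 0 (source_vertex i)) \<in> reduced_roots \<phi> \<or>
        (\<exists>y. (y, (source_vertex i, \<tau> 0 (source_vertex i))) \<in> temporal_edges ?G)"
      unfolding forest_def by blast
    then show ?thesis by (auto simp: temporal_edges_reduced reduced_roots_def)
  qed
  then obtain \<sigma> where \<sigma>: "\<And>i. i \<in> set (fst \<phi>) \<Longrightarrow> (i, \<sigma> i) \<in> set (fst (snd \<phi>)) \<and> \<tau> 0 (source_vertex i) = time_value (\<sigma> i)"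
    by metis
  have "\<exists>l \<in> set C. \<sigma> (fst l) = snd l" if C: "C \<in> set (snd (snd \<phi>))" for C
  proof -
    have "clause_vertex C \<in> pverts (dg ?G)" using that by (simp add: reduced_graph)
    with f have "(clause_vertex C, \<tau> 0 (clause_vertex C)) \<in> reduced_roots \<phi> \<or>
        ((p 0 (clause_vertex C), \<tau> 0 (p 0 (clause_vertex C))), (clause_vertex C, \<tau> 0 (clause_vertex C))) \<in> temporal_edges ?G"
      unfolding forest_def by blast
    then obtain l where l: "(C, l) \<in> clause_literals \<phi>" "\<tau> 0 (source_vertex (fst l)) = time_value (snd l)"
      by (auto simp: temporal_edges_reduced reduced_roots_def)
    then have "fst l \<in> set (fst \<phi>)" "l \<in> set C" using wf by (force simp: mv_wf_def clause_literals_def)+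
    then show ?thesis using \<sigma>[of "fst l"] l(2) by (metis vertex_inj(3))
  qed
  with \<sigma> show "mv_sat \<phi>" unfolding mv_sat_def by blast
next
  let ?G = "tdigraph_of (reduced k \<phi>)"
  assume "mv_sat \<phi>"
  then obtain \<sigma> where s1: "\<And>i. i \<in> set (fst \<phi>) \<Longrightarrow> (i, \<sigma> i) \<in> set (fst (snd \<phi>))"
    and s2: "\<And>C. C \<in> set (snd (snd \<phi>)) \<Longrightarrow> \<exists>l \<in> set C. \<sigma> (fst l) = snd l" unfolding mv_sat_def by blast
  from s2 obtain L where L: "\<And>C. C \<in> set (snd (snd \<phi>)) \<Longrightarrow> L C \<in> set C \<and> \<sigma> (fst (L C)) = snd (L C)" by metis
  define \<tau> where "\<tau> v = (if v \<in> range source_vertex then time_value (\<sigma> (inv source_vertex v))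
    else time_value (snd (L (inv clause_vertex v))))" for v
  define p where "p v = source_vertex (fst (L (inv clause_vertex v)))" for v
  define rk where "rk v = (if v \<in> range source_vertex then 0 else 1 :: nat)" for v
  have inv: "inv source_vertex (source_vertex i) = i" "inv clause_vertex (clause_vertex C) = C" for i C
    by (intro inv_f_f injI, simp)+
  have ts: "\<tau> (source_vertex i) = time_value (\<sigma> i)" for i by (simp add: \<tau>_def inv)
  have tc: "\<tau> (clause_vertex C) = time_value (snd (L C))" "p (clause_vertex C) = source_vertex (fst (L C))" for C
    by (auto simp: \<tau>_def p_def inv)
  have vs: "(v, \<tau> v) \<in> reduced_verts \<phi>" if "v \<in> pverts (dg ?G)" for v
    using that unfolding reduced_graph
  proof
    assume "v \<in> source_vertex ` set (fst \<phi>)"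
    then show ?thesis using s1 by (force simp: reduced_verts_def reduced_roots_def ts)
  next
    assume "v \<in> clause_vertex ` set (snd (snd \<phi>))"
    then show ?thesis using L by (force simp: reduced_verts_def tc clause_literals_def)
  qed
  have f1: "forest ?G (reduced_roots \<phi>) \<tau> p rk"
    unfolding forest_def
  proof (intro ballI conjI)
    fix v assume v: "v \<in> pverts (dg ?G)"
    show "(v, \<tau> v) \<in> temporal_verts ?G" using vs[OF v] by (simp add: temporal_verts_reduced[OF wf])
    from v consider i where "v = source_vertex i" "i \<in> set (fst \<phi>)" | C where "v = clause_vertex C" "C \<in> set (snd (snd \<phi>))"
      unfolding reduced_graph by blast
    then show "(v, \<tau> v) \<in> reduced_roots \<phi> \<or> p v \<in> pverts (dg ?G) \<and> rk (p v) < rk v \<and>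
        ((p v, \<tau> (p v)), (v, \<tau> v)) \<in> temporal_edges ?G"
    proof cases
      case 1
      then show ?thesis using s1 by (force simp: reduced_roots_def ts)
    next
      case 2
      have l: "L C \<in> set C" "\<sigma> (fst (L C)) = snd (L C)" using L 2 by auto
      then have "L C \<in> set (fst (snd \<phi>))" using wf 2 by (auto simp: mv_wf_def)
      then have "fst (L C) \<in> set (fst \<phi>)" using wf by (auto simp: mv_wf_def)
      moreover have "rk (p v) < rk v" using 2 by (auto simp: rk_def tc)
      moreover have "((p v, \<tau> (p v)), (v, \<tau> v)) \<in> temporal_edges ?G"
        using 2 l by (auto simp: temporal_edges_reduced tc ts clause_literals_def intro!: image_eqI[of _ _ "(C, L C)"])
      ultimately show ?thesis using 2 by (auto simp: reduced_graph tc)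
    qed
  qed
  have f2: "forest ?G (reduced_verts \<phi>) \<tau> p rk" "forest_edges ?G (reduced_verts \<phi>) \<tau> p = {}"
    using vs by (auto simp: forest_def forest_edges_def temporal_verts_reduced[OF wf])
  let ?Rs = "reduced_roots \<phi> # replicate (k - 1) (reduced_verts \<phi>)"
  have r: "?Rs ! i = (if i = 0 then reduced_roots \<phi> else reduced_verts \<phi>)" if "i < length ?Rs" for i
    using that by (cases i) auto
  show "forests \<pi> ?G (roots_of (reduced k \<phi>))"
    unfolding forests_def reduced_graph(5)
    apply (rule exI[of _ "\<lambda>_. \<tau>"], rule exI[of _ "\<lambda>_. p"], rule exI[of _ "\<lambda>_. rk"])
    using r f1 f2 by (auto simp del: nth_Cons_0 simp: nth_Cons')
qed

lemma has_disjoint_branchings_reduced: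
  assumes "mv_wf \<phi>" "1 \<le> k" "D = t_edge_disjoint \<or> D = edge_disjoint"
  shows "has_disjoint_branchings D (tdigraph_of (reduced k \<phi>)) (roots_of (reduced k \<phi>)) \<longleftrightarrow> mv_sat \<phi>"
  using assms(3) t_edge_disjoint_forests[OF temporal_digraph_reduced[OF assms(1), of k]]
    edge_disjoint_forests[OF temporal_digraph_reduced[OF assms(1), of k]] forests_reduced[OF assms(1,2)]
  by metis

lemma acyclic_reduced: "acyclic (parcs (dg (tdigraph_of (reduced k \<phi>))))"
  by (rule acyclicI_order[of _ "\<lambda>v. if v \<in> range clause_vertex then 0 else 1 :: nat"])
    (auto simp: reduced_graph)

lemma has_lifetime_reduced:
  assumes wf: "mv_wf \<phi>" and v: "snd ` set (fst (snd \<phi>)) \<subseteq> {[], [False]}" "[False] \<in> snd ` set (fst (snd \<phi>))"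
  shows "has_lifetime (tdigraph_of (reduced k \<phi>)) 2"
proof -
  let ?G = "tdigraph_of (reduced k \<phi>)"
  have t: "time_value [] = 1" "time_value [False] = 2" by (auto simp: time_name_def)
  have lits: "snd l \<in> {[], [False]}" if "(C, l) \<in> clause_literals \<phi>" for C l
  proof -
    have "l \<in> set (fst (snd \<phi>))" using wf that by (auto simp: mv_wf_def clause_literals_def)
    then show ?thesis using v(1) by blast
  qed
  have le: "snd ` reduced_verts \<phi> \<subseteq> {1, 2}"
  proof
    fix x assume "x \<in> snd ` reduced_verts \<phi>"
    then consider l where "l \<in> set (fst (snd \<phi>))" "x = time_value (snd l)"
      | C l where "(C, l) \<in> clause_literals \<phi>" "x = time_value (snd l)"
      by (auto simp: reduced_verts_def reduced_roots_def)
    then show "x \<in> {1, 2}"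
    proof cases
      case 1
      then have "snd l \<in> {[], [False]}" using v(1) by blast
      then show ?thesis using t 1 by auto
    next
      case 2
      then show ?thesis using lits[of C l] t by auto
    qed
  qed
  have eq: "(\<Union>v \<in> pverts (dg ?G). gam ?G v) = snd ` reduced_verts \<phi>"
    unfolding temporal_verts_reduced[OF wf, symmetric, of k] by (force simp: temporal_verts_def)
  have "2 \<in> snd ` reduced_verts \<phi>"
    using v(2) t by (force simp: reduced_verts_def reduced_roots_def)
  moreover from this le have "Max (snd ` reduced_verts \<phi>) = 2"
    by (intro Max_eqI) (auto intro: finite_subset[OF le])
  ultimately show ?thesis unfolding has_lifetime_def eq by auto
qed

lemma enc_reduced: "enc_instance (reduced k \<phi>) = enc_instance_of enc_bits (reduce k \<phi>)"
proof -
  have "map_instance (\<lambda>x. nat_bits (bits_value x)) (reduce k \<phi>) = reduce k \<phi>"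
    by (auto simp: reduce_def map_instance_def Let_def nat_bits_value canonical_names split_def map_concat comp_def)
  then show ?thesis
    by (simp add: reduced_def enc_instance_map map_instance_comp)
qed

lemma cp_enc_clause: "pt (enc_list (enc_pair enc_bits enc_bits))"
  by (intro pt_enc_list pt_enc_pair pt_enc_bits)

lemma pt_enc_reduced: "pt (\<lambda>\<phi>. enc_instance (reduced k \<phi>))"
proof -
  have "pt (reduce k)"
    unfolding reduce_def Let_def source_name_def clause_name_def time_name_def
    by (intro pt_intros cp_comp[OF _ cp_enc_clause])
  from cp_comp[OF this pt_enc_instance_of[OF pt_enc_bits]] show ?thesis by (simp add: enc_reduced)
qed

section \<open>Propositional formulas\<close>

type_synonym nat_cnf = "(bool \<times> nat list) list list"

definition cnf_true :: "(nat list \<Rightarrow> bool) \<Rightarrow> nat_cnf \<Rightarrow> bool" where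
  "cnf_true \<alpha> F \<longleftrightarrow> (\<forall>C \<in> set F. \<exists>l \<in> set C. \<alpha> (snd l) = fst l)"

definition var_name :: "nat list \<Rightarrow> bool list" where
  "var_name v = enc_list enc_bits (map (\<lambda>n. replicate n True) v)"

lemma var_name_inj [simp]: "var_name v = var_name w \<longleftrightarrow> v = w"
proof -
  have "inj (\<lambda>n. replicate n True)" by (rule injI) (metis length_replicate)
  then show ?thesis
    using prefix_free_inj[OF prefix_free_enc_list[OF prefix_free_enc_bits]]
    by (simp add: var_name_def inj_eq inj_mapI)
qed

text \<open>Chosen so that the two truth values become the times 1 and 2.\<close>

definition truth_value :: "bool \<Rightarrow> bool list" where
  "truth_value b = (if b then [False] else [])"

lemma truth_value_inj [simp]: "truth_value b = truth_value c \<longleftrightarrow> b = c"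
  by (auto simp: truth_value_def)

definition mv_of_cnf :: "nat_cnf \<Rightarrow> mv_formula" where
  "mv_of_cnf F = (map (\<lambda>l. var_name (snd l)) (concat F),
     concat (map (\<lambda>l. [(var_name (snd l), truth_value False), (var_name (snd l), truth_value True)]) (concat F)),
     map (\<lambda>C. map (\<lambda>l. (var_name (snd l), truth_value (fst l))) C) F)"

lemma mv_wf_of_cnf: "mv_wf (mv_of_cnf F)"
proof -
  have "(var_name v, truth_value b) \<in> set (fst (snd (mv_of_cnf F)))" if "C \<in> set F" "(b, v) \<in> set C" for C b v
    using that by (cases b) (force simp: mv_of_cnf_def)+
  then have "\<forall>C \<in> set (snd (snd (mv_of_cnf F))). set C \<subseteq> set (fst (snd (mv_of_cnf F)))"
    by (auto simp: mv_of_cnf_def)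
  moreover have "fst ` set (fst (snd (mv_of_cnf F))) \<subseteq> set (fst (mv_of_cnf F))"
    by (force simp: mv_of_cnf_def image_iff)
  ultimately show ?thesis by (simp add: mv_wf_def)
qed

lemma mv_sat_of_cnf: "mv_sat (mv_of_cnf F) \<longleftrightarrow> (\<exists>\<alpha>. cnf_true \<alpha> F)"
proof
  assume "mv_sat (mv_of_cnf F)"
  then obtain \<tau> where "\<forall>C \<in> set F. \<exists>l \<in> set C. \<tau> (var_name (snd l)) = truth_value (fst l)"
    by (auto simp: mv_sat_def mv_of_cnf_def)
  then have "cnf_true (\<lambda>v. \<tau> (var_name v) = truth_value True) F"
    unfolding cnf_true_def by (metis (full_types) truth_value_inj)
  then show "\<exists>\<alpha>. cnf_true \<alpha> F" by blast
next
  assume "\<exists>\<alpha>. cnf_true \<alpha> F"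
  then obtain \<alpha> where a: "cnf_true \<alpha> F" by blast
  have inv: "inv var_name (var_name v) = v" for v by (intro inv_f_f injI) simp
  have "truth_value b = truth_value False \<or> truth_value b = truth_value True" for b by (cases b) auto
  with a show "mv_sat (mv_of_cnf F)"
    unfolding mv_sat_def mv_of_cnf_def cnf_true_def
    by (intro exI[of _ "\<lambda>x. truth_value (\<alpha> (inv var_name x))"]) (fastforce simp: inv)
qed

lemma pt_mv_of_cnf: "pt mv_of_cnf"
  unfolding mv_of_cnf_def var_name_def truth_value_def
  by (intro pt_intros cp_comp[OF _ pt_enc_list[OF pt_enc_bits]])

lemma mv_of_cnf_lifetime:
  assumes "concat F \<noteq> []"
  shows "snd ` set (fst (snd (mv_of_cnf F))) \<subseteq> {[], [False]}" "[False] \<in> snd ` set (fst (snd (mv_of_cnf F)))"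
proof -
  show "snd ` set (fst (snd (mv_of_cnf F))) \<subseteq> {[], [False]}"
    by (auto simp: mv_of_cnf_def truth_value_def)
  obtain l where "l \<in> set (concat F)" using assms by (cases "concat F") auto
  then have "(var_name (snd l), truth_value True) \<in> set (fst (snd (mv_of_cnf F)))"
    by (fastforce simp: mv_of_cnf_def)
  then show "[False] \<in> snd ` set (fst (snd (mv_of_cnf F)))"
    by (metis image_eqI snd_conv truth_value_def)
qed

section \<open>Computation tableaux\<close>

text \<open>Lets halting states idle by ordinary transitions, so that the tableau needs no separate
  case for them.\<close>

definition full_trans :: "tm \<Rightarrow> nat \<Rightarrow> nat list \<Rightarrow> nat \<times> (nat \<times> int) list" where
  "full_trans M q as = (if q = 1 \<or> q = 2 then (q, map (\<lambda>a. (a, 0)) as) else trans M q as)"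

definition acts :: "tm \<Rightarrow> config \<Rightarrow> (nat \<times> int) list" where
  "acts M c = snd (full_trans M (fst c) (map scan (snd c)))"

lemma step_full_trans:
  "step M c = (fst (full_trans M (fst c) (map scan (snd c))), map2 act (acts M c) (snd c))"
proof -
  have "map2 act (map (\<lambda>a. (a, 0)) (map scan tps)) tps = tps" for tps
    by (induction tps) (auto simp: act_idle)
  then show ?thesis
    by (cases c) (auto simp: step_def acts_def full_trans_def halted_def Let_def)
qed

definition config_ok :: "tm \<Rightarrow> config \<Rightarrow> bool" where
  "config_ok M c \<longleftrightarrow> fst c < states M \<and> length (snd c) = tapes M \<and>
     (\<forall>tp \<in> set (snd c). \<forall>p. fst tp p < symbols M)"

lemma full_trans_ok:
  assumes "wf_tm M" "q < states M" "length as = tapes M" "set as \<subseteq> {..<symbols M}"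
  shows "fst (full_trans M q as) < states M" "length (snd (full_trans M q as)) = tapes M"
    "set (snd (full_trans M q as)) \<subseteq> {..<symbols M} \<times> {-1, 0, 1}"
  using assms by (auto simp: full_trans_def wf_tm_def)

lemma scan_ok: "config_ok M c \<Longrightarrow> length (map scan (snd c)) = tapes M \<and> set (map scan (snd c)) \<subseteq> {..<symbols M}"
  by (auto simp: config_ok_def scan_def)

lemma acts_ok:
  assumes "wf_tm M" "config_ok M c"
  shows "length (acts M c) = tapes M"
    "j < tapes M \<Longrightarrow> fst (acts M c ! j) < symbols M \<and> snd (acts M c ! j) \<in> {-1, 0, 1}"
proof -
  note s = scan_ok[OF assms(2)]
  have q: "fst c < states M" using assms(2) by (simp add: config_ok_def)
  note f = full_trans_ok[OF assms(1) q conjunct1[OF s] conjunct2[OF s], folded acts_def]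
  show "length (acts M c) = tapes M" by (rule f)
  assume "j < tapes M"
  then have "acts M c ! j \<in> {..<symbols M} \<times> {-1, 0, 1}" using f(2,3) nth_mem by fastforce
  then show "fst (acts M c ! j) < symbols M \<and> snd (acts M c ! j) \<in> {-1, 0, 1}" by auto
qed

lemma config_ok_step:
  assumes "wf_tm M" "config_ok M c"
  shows "config_ok M (step M c)"
proof -
  note s = scan_ok[OF assms(2)] and a = acts_ok[OF assms]
  have q: "fst c < states M" and l: "length (snd c) = tapes M"
    and c: "\<And>tp p. tp \<in> set (snd c) \<Longrightarrow> fst tp p < symbols M"
    using assms(2) by (auto simp: config_ok_def)
  have "fst tp p < symbols M" if "tp \<in> set (map2 act (acts M c) (snd c))" for tp p
  proof -
    obtain j where j: "j < tapes M" "tp = act (acts M c ! j) (snd c ! j)"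
      using \<open>tp \<in> _\<close> a(1) l by (auto simp: set_zip)
    then show ?thesis using a(2)[OF j(1)] c[of "snd c ! j"] l by (auto simp: act_def)
  qed
  then show ?thesis
    using full_trans_ok(1)[OF assms(1) q] s a(1) l by (simp add: config_ok_def step_full_trans)
qed

lemma config_ok_run:
  assumes "wf_tm M"
  shows "config_ok M (run M xs t)"
proof (induction t)
  case 0
  have "3 \<le> symbols M" "3 \<le> states M" using assms by (auto simp: wf_tm_def)
  then show ?case
    by (auto simp: run_def init_def config_ok_def input_tape_def bit_symbol_def)
qed (simp add: run_def config_ok_step[OF assms])

lemma run_Suc_tape:
  assumes "wf_tm M" "j < tapes M"
  shows "snd (run M xs (Suc t)) ! j = act (acts M (run M xs t) ! j) (snd (run M xs t) ! j)"
  using acts_ok(1)[OF assms(1) config_ok_run[OF assms(1), of xs t]] config_ok_run[OF assms(1), of xs t] assms(2)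
  by (simp add: run_def step_full_trans config_ok_def)

text \<open>Within \<open>T\<close> steps only the positions from \<open>-T\<close> to
  \<open>T\<close> matter; shifted by \<open>T\<close>, they become the naturals up to
  \<open>2 * T\<close>.\<close>

lemma head_bound:
  assumes "wf_tm M" "j < tapes M"
  shows "\<bar>snd (snd (run M xs t) ! j)\<bar> \<le> int t"
proof (induction t)
  case 0
  then show ?case using assms by (simp add: run_def init_def input_tape_def)
next
  case (Suc t)
  have "snd (acts M (run M xs t) ! j) \<in> {-1, 0, 1}"
    using acts_ok(2)[OF assms(1) config_ok_run[OF assms(1)] assms(2)] by blast
  then show ?case using Suc by (auto simp: run_Suc_tape[OF assms] act_def)
qed

text \<open>The variables of the tableau:
  \<open>[0, t, q]\<close>: the state at time \<open>t\<close> is \<open>q\<close>;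
  \<open>[1, t, j, p, a]\<close>: at time \<open>t\<close>, cell \<open>p - T\<close> of tape \<open>j\<close> contains \<open>a\<close>;
  \<open>[2, t, j, p]\<close>: the head of tape \<open>j\<close> is at \<open>p - T\<close>;
  \<open>[3, t, j, a]\<close>, \<open>[4, t, j, b]\<close>, \<open>[5, t, j, d]\<close>: on tape \<open>j\<close>, the machine scans \<open>a\<close>, writes \<open>b\<close>
  and moves by \<open>d - 1\<close>;
  \<open>[6, i]\<close>: the certificate is longer than \<open>i\<close>; \<open>[7, i]\<close>: its \<open>i\<close>-th bit.
  All clauses but those on the certificate are Horn implications, so that a satisfying assignment
  makes true whatever holds in the run on the certificate that it describes; no clause has to
  state that a configuration is unique.\<close>

definition imp :: "nat list list \<Rightarrow> nat list \<Rightarrow> (bool \<times> nat list) list" where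
  "imp ps q = map (\<lambda>p. (False, p)) ps @ [(True, q)]"

text \<open>The last clause for a cell of the certificate makes the variables \<open>[6, i]\<close>
  downward closed, so that they describe a length; the other three force the cell to be the bit or
  the blank that \<open>[6, i]\<close> and \<open>[7, i]\<close> prescribe.\<close>

definition init_cell :: "bool list \<Rightarrow> nat \<Rightarrow> nat \<Rightarrow> nat \<Rightarrow> nat \<Rightarrow> nat_cnf" where
  "init_cell x T P j p =
    (if j = 1 \<and> T \<le> p \<and> p - T < P then
       [imp [[6, p - T], [7, p - T]] [1, 0, j, p, 2],
        [(False, [6, p - T]), (True, [7, p - T]), (True, [1, 0, j, p, 1])],
        [(True, [6, p - T]), (True, [1, 0, j, p, 0])],
        imp [[6, Suc (p - T)]] [6, p - T]]
     else [imp [] [1, 0, j, p,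
       if j = 0 \<and> T \<le> p \<and> p - T < length x then (if hd (drop (p - T) x) then 2 else 1) else 0]])"

definition stamp :: "nat \<Rightarrow> nat list \<Rightarrow> nat list" where
  "stamp t v = hd v # t # tl v"

type_synonym template = "nat list list \<times> nat list \<times> nat list list"

text \<open>The transition function is an arbitrary function; only its finite table enters the
  reduction, as a constant list. A template carries no time, which \<open>stamp\<close> inserts
  later.\<close>

definition templates :: "tm \<Rightarrow> template list" where
  "templates M = map (\<lambda>(q, as). let r = full_trans M q as in
      ([0, q] # map (\<lambda>j. [3, j, as ! j]) [0..<tapes M], [0, fst r],
       map (\<lambda>j. [4, j, fst (snd r ! j)]) [0..<tapes M] @
       map (\<lambda>j. [5, j, nat (snd (snd r ! j) + 1)]) [0..<tapes M]))
    (List.product [0..<states M] (List.n_lists (tapes M) [0..<symbols M]))"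

text \<open>That a cell away from the head keeps its content is said with the actual cell
  \<open>p'\<close> of the head, which avoids the non-Horn hypothesis that the head is not at
  \<open>p\<close>. In \<open>p + d - 1\<close> the subtraction is truncated only for
  \<open>p = 0\<close> and \<open>d = 0\<close>, which is harmless: the head cannot be at position
  \<open>-T\<close> before time \<open>T\<close>.\<close>

definition cell_clauses :: "nat \<Rightarrow> nat \<Rightarrow> nat \<Rightarrow> nat \<Rightarrow> nat \<Rightarrow> nat_cnf" where
  "cell_clauses S T t j p =
     map (\<lambda>a. imp [[2, t, j, p], [1, t, j, p, a]] [3, t, j, a]) [0..<S] @
     map (\<lambda>b. imp [[2, t, j, p], [4, t, j, b]] [1, Suc t, j, p, b]) [0..<S] @
     map (\<lambda>d. imp [[2, t, j, p], [5, t, j, d]] [2, Suc t, j, p + d - 1]) [0..<3] @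
     concat (map (\<lambda>p'. map (\<lambda>a. imp [[2, t, j, p'], [1, t, j, p, a]] [1, Suc t, j, p, a]) [0..<S])
       (filter (\<lambda>p'. p' \<noteq> p) [0..<2 * T + 1]))"

definition template_clauses :: "nat \<Rightarrow> template \<Rightarrow> nat_cnf" where
  "template_clauses t r = imp (map (stamp t) (fst r)) (stamp (Suc t) (fst (snd r))) #
     map (\<lambda>q. imp (map (stamp t) (fst r)) (stamp t q)) (snd (snd r))"

definition tableau :: "nat \<Rightarrow> nat \<Rightarrow> template list \<Rightarrow> nat poly \<Rightarrow> nat poly \<Rightarrow> bool list \<Rightarrow> nat_cnf" where
  "tableau K S ts p q x =
    (let T = poly q (length x); P = poly p (length x) in
     [imp [] [0, 0, 0]] @ map (\<lambda>j. imp [] [2, 0, j, T]) [0..<K] @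
     concat (map (\<lambda>j. concat (map (\<lambda>i. init_cell x T P j i) [0..<2 * T + 1])) [0..<K]) @
     concat (map (\<lambda>t. concat (map (\<lambda>j. concat (map (\<lambda>i. cell_clauses S T t j i) [0..<2 * T + 1])) [0..<K]) @
       concat (map (\<lambda>r. template_clauses t r) ts)) [0..<T]) @
     [[(False, [0, T, 2])]])"

lemma cp_drop [pt_intros]:
  assumes "cp S n" "cp S l"
  shows "cp S (\<lambda>x. drop (n x) (l x))"
proof -
  have "sz (tl s) \<le> sz s" for s :: "'b list" by (rule sz_tl)
  then have "cp S (\<lambda>x. fold (\<lambda>_ s. tl s) (replicate (n x) Leaf) (l x))"
    by (intro cp_fold_linear[where g = "\<lambda>_. 0"])
      (auto intro!: pt_intros pb_intros assms cp_const cp_base[OF assms(1)])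
  moreover have "fold (\<lambda>_ s. tl s) (replicate k Leaf) ys = drop k ys" for k and ys :: "'b list"
    by (induction k arbitrary: ys) (auto simp: drop_Suc)
  ultimately show ?thesis by (simp only:)
qed

lemma pt_tableau: "pt (tableau K S ts p q)"
  unfolding tableau_def Let_def imp_def init_cell_def cell_clauses_def template_clauses_def stamp_def
  by (intro pt_intros)

lemma cnf_true_simps:
  "cnf_true \<alpha> []"
  "cnf_true \<alpha> (C # F) \<longleftrightarrow> (\<exists>l \<in> set C. \<alpha> (snd l) = fst l) \<and> cnf_true \<alpha> F"
  "cnf_true \<alpha> (F @ G) \<longleftrightarrow> cnf_true \<alpha> F \<and> cnf_true \<alpha> G"
  "cnf_true \<alpha> (concat Fs) \<longleftrightarrow> (\<forall>F \<in> set Fs. cnf_true \<alpha> F)"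
  "cnf_true \<alpha> (if b then F else G) \<longleftrightarrow> (if b then cnf_true \<alpha> F else cnf_true \<alpha> G)"
  by (auto simp: cnf_true_def)

lemma cnf_true_map: "cnf_true \<alpha> (map f xs) \<longleftrightarrow> (\<forall>x \<in> set xs. \<exists>l \<in> set (f x). \<alpha> (snd l) = fst l)"
  by (auto simp: cnf_true_def)

lemma imp_true: "(\<exists>l \<in> set (imp ps q). \<alpha> (snd l) = fst l) \<longleftrightarrow> ((\<forall>p \<in> set ps. \<alpha> p) \<longrightarrow> \<alpha> q)"
  by (auto simp: imp_def)

lemmas cell_clauses_true = cell_clauses_def cnf_true_simps cnf_true_map imp_true

lemma in_templates:
  assumes "q < states M" "length as = tapes M" "set as \<subseteq> {..<symbols M}" "r = full_trans M q as"
  shows "([0, q] # map (\<lambda>j. [3, j, as ! j]) [0..<tapes M], [0, fst r],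
       map (\<lambda>j. [4, j, fst (snd r ! j)]) [0..<tapes M] @
       map (\<lambda>j. [5, j, nat (snd (snd r ! j) + 1)]) [0..<tapes M]) \<in> set (templates M)"
proof -
  have "(q, as) \<in> set (List.product [0..<states M] (List.n_lists (tapes M) [0..<symbols M]))"
    using assms by (auto simp: set_n_lists)
  then show ?thesis unfolding templates_def assms(4) by (force simp: Let_def)
qed

definition certificate_at :: "(nat list \<Rightarrow> bool) \<Rightarrow> nat \<Rightarrow> bool list" where
  "certificate_at \<alpha> n = map (\<lambda>i. \<alpha> [7, i]) [0..<n]"

lemma downward_closed_prefix:
  fixes Q :: "nat \<Rightarrow> bool"
  assumes "\<And>i. i < N \<Longrightarrow> Q (Suc i) \<Longrightarrow> Q i"
  shows "\<exists>n \<le> N. \<forall>i < N. Q i \<longleftrightarrow> i < n"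
  using assms
proof (induction N)
  case (Suc N)
  then obtain n where n: "n \<le> N" "\<forall>i < N. Q i \<longleftrightarrow> i < n" by force
  show ?case
  proof (cases "Q N")
    case True
    have "Q i" if "i \<le> N" for i
      using that True Suc.prems by (induction rule: inc_induct) (auto simp: less_Suc_eq)
    then show ?thesis by (intro exI[of _ "Suc N"]) auto
  next
    case False
    then show ?thesis using n by (intro exI[of _ n]) (auto simp: less_Suc_eq)
  qed
qed simp

text \<open>The certificate is read off from the variables with tags 6 and 7. By induction on the
  time, every fact of the run on it is made true, so that a rejecting run would contradict the final
  clause.\<close>

lemma tableau_sound:
  assumes wf: "wf_tm M" and true: "cnf_true \<alpha> (tableau (tapes M) (symbols M) (templates M) p q x)"
  shows "\<exists>u. length u \<le> poly p (length x) \<and> fst (run M [x, u] (poly q (length x))) \<noteq> 2"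
proof -
  let ?T = "poly q (length x)" and ?P = "poly p (length x)" and ?K = "tapes M" and ?S = "symbols M"
  from true have i1: "\<alpha> [0, 0, 0]" and i2: "\<And>j. j < ?K \<Longrightarrow> \<alpha> [2, 0, j, ?T]"
    and i3: "\<And>j i. j < ?K \<Longrightarrow> i \<le> 2 * ?T \<Longrightarrow> cnf_true \<alpha> (init_cell x ?T ?P j i)"
    and s1: "\<And>t j i. t < ?T \<Longrightarrow> j < ?K \<Longrightarrow> i \<le> 2 * ?T \<Longrightarrow> cnf_true \<alpha> (cell_clauses ?S ?T t j i)"
    and s2: "\<And>t r. t < ?T \<Longrightarrow> r \<in> set (templates M) \<Longrightarrow> cnf_true \<alpha> (template_clauses t r)"
    and f: "\<not> \<alpha> [0, ?T, 2]"
    by (auto simp: tableau_def Let_def cnf_true_simps cnf_true_map imp_true less_Suc_eq_le simp del: upt_Suc)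
  \<comment> \<open>The tableau describes the cells 0 to \<open>T\<close> of the certificate, hence
    at most \<open>T + 1\<close> of them, and none if there is no second tape.\<close>
  define N where "N = (if 1 < ?K then min ?P (Suc ?T) else 0)"
  have i4: "cnf_true \<alpha> (init_cell x ?T ?P 1 (?T + i))" if "i < N" for i
    using that i3[of 1 "?T + i"] by (auto simp: N_def split: if_splits)
  have "\<exists>n \<le> N. \<forall>i < N. \<alpha> [6, i] \<longleftrightarrow> i < n"
  proof (rule downward_closed_prefix)
    fix i assume "i < N" "\<alpha> [6, Suc i]"
    then show "\<alpha> [6, i]"
      using i4[of i] by (auto simp: init_cell_def cnf_true_simps imp_true N_def split: if_splits)
  qed
  then obtain n where n: "n \<le> N" "\<And>i. i < N \<Longrightarrow> \<alpha> [6, i] \<longleftrightarrow> i < n" by blast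
  define u where "u = certificate_at \<alpha> n"
  have u: "length u = n" "\<And>i. i < n \<Longrightarrow> u ! i = \<alpha> [7, i]" by (auto simp: u_def certificate_at_def)
  let ?c = "run M [x, u]" and ?pos = "\<lambda>t j. nat (snd (snd (run M [x, u] t) ! j) + int ?T)"
  have pos: "int (?pos t j) = snd (snd (?c t) ! j) + int ?T" "?pos t j \<le> 2 * ?T" if "t \<le> ?T" "j < ?K" for t j
    using head_bound[OF wf that(2), of "[x, u]" t] that(1) by auto
  have inv: "\<alpha> [0, t, fst (?c t)] \<and> (\<forall>j < ?K. \<alpha> [2, t, j, ?pos t j]) \<and>
      (\<forall>j < ?K. \<forall>i \<le> 2 * ?T. \<alpha> [1, t, j, i, fst (snd (?c t) ! j) (int i - int ?T)])" if "t \<le> ?T" for t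
    using that
  proof (induction t)
    case 0
    have "\<alpha> [1, 0, j, i, fst (snd (?c 0) ! j) (int i - int ?T)]" if j: "j < ?K" "i \<le> 2 * ?T" for j i
    proof -
      have c: "fst (snd (?c 0) ! j) (int i - int ?T) =
          fst (input_tape (if j < 2 then [x, u] ! j else [])) (int i - int ?T)"
        using j by (simp add: run_def init_def numeral_2_eq_2)
      show ?thesis
      proof (cases "j = 1 \<and> ?T \<le> i \<and> i - ?T < ?P")
        case True
        then have N: "i - ?T < N" using j by (auto simp: N_def)
        have int: "nat (int i - int ?T) = i - ?T" "int i - int ?T < int n \<longleftrightarrow> i - ?T < n" using True by auto
        show ?thesis using i3[OF j] True n(2)[OF N] u(2)[of "i - ?T"] unfolding c
          by (auto simp: init_cell_def cnf_true_simps imp_true input_tape_def u(1) int bit_symbol_def split: if_splits)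
      next
        case False
        show ?thesis
        proof (cases "j = 1")
          case True
          then have "fst (input_tape u) (int i - int ?T) = 0"
            using False n(1) j by (auto simp: input_tape_def u(1) N_def split: if_splits)
          then show ?thesis using i3[OF j] True False unfolding c
            by (auto simp: init_cell_def cnf_true_simps imp_true split: if_splits)
        next
          case False
          have int: "nat (int i - int ?T) = i - ?T" "int i - int ?T < int (length x) \<longleftrightarrow> i - ?T < length x" if "?T \<le> i"
            using that by auto
          show ?thesis using i3[OF j] False unfolding c
            by (auto simp: init_cell_def cnf_true_simps imp_true input_tape_def bit_symbol_def hd_drop_conv_nth int
                less_2_cases_iff split: if_splits)
        qed
      qed
    qed
    moreover have "?pos 0 j = ?T" if "j < ?K" for j using that by (simp add: run_def init_def input_tape_def)
    moreover have "fst (?c 0) = 0" by (simp add: run_def init_def)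
    ultimately show ?case using i1 i2 by simp
  next
    case (Suc t)
    then have t: "t < ?T" by simp
    from Suc have h1: "\<alpha> [0, t, fst (?c t)]" and h2: "\<And>j. j < ?K \<Longrightarrow> \<alpha> [2, t, j, ?pos t j]"
      and h3: "\<And>j i. j < ?K \<Longrightarrow> i \<le> 2 * ?T \<Longrightarrow> \<alpha> [1, t, j, i, fst (snd (?c t) ! j) (int i - int ?T)]" by auto
    have ok: "config_ok M (?c t)" by (rule config_ok_run[OF wf])
    note sc = scan_ok[OF ok] and ao = acts_ok[OF wf ok]
    have q: "fst (?c t) < states M" and l: "length (snd (?c t)) = ?K" using ok by (auto simp: config_ok_def)
    have h4: "\<alpha> [3, t, j, scan (snd (?c t) ! j)]" if j: "j < ?K" for j
    proof -
      have "scan (snd (?c t) ! j) < ?S" using ok l j by (simp add: config_ok_def scan_def)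
      moreover have "\<alpha> [1, t, j, ?pos t j, scan (snd (?c t) ! j)]"
        using h3[OF j pos(2)[OF _ j, of t]] pos(1)[OF _ j, of t] t by (simp add: scan_def)
      ultimately show ?thesis using s1[OF t j pos(2)[OF _ j, of t]] h2[OF j] t
        by (auto simp: cell_clauses_true)
    qed
    have "cnf_true \<alpha> (template_clauses t ([0, fst (?c t)] # map (\<lambda>j. [3, j, map scan (snd (?c t)) ! j]) [0..<?K],
        [0, fst (?c (Suc t))], map (\<lambda>j. [4, j, fst (acts M (?c t) ! j)]) [0..<?K] @
        map (\<lambda>j. [5, j, nat (snd (acts M (?c t) ! j) + 1)]) [0..<?K]))"
      using s2[OF t in_templates[OF q conjunct1[OF sc] conjunct2[OF sc] refl]]
      by (simp add: acts_def run_def step_full_trans)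
    then have h5: "\<alpha> [0, Suc t, fst (?c (Suc t))]" "\<And>j. j < ?K \<Longrightarrow> \<alpha> [4, t, j, fst (acts M (?c t) ! j)]"
      "\<And>j. j < ?K \<Longrightarrow> \<alpha> [5, t, j, nat (snd (acts M (?c t) ! j) + 1)]"
      using h1 h4 l by (auto simp: template_clauses_def cnf_true_simps cnf_true_map imp_true stamp_def)
    have "\<alpha> [2, Suc t, j, ?pos (Suc t) j]" if j: "j < ?K" for j
    proof -
      have d: "snd (acts M (?c t) ! j) \<in> {-1, 0, 1}" using ao(2)[OF j] by blast
      then have "\<alpha> [2, Suc t, j, ?pos t j + nat (snd (acts M (?c t) ! j) + 1) - 1]"
        using s1[OF t j pos(2)[OF _ j, of t]] h2[OF j] h5(3)[OF j] t
        by (auto simp: cell_clauses_true)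
      moreover have "?pos t j + nat (snd (acts M (?c t) ! j) + 1) - 1 = ?pos (Suc t) j"
        using d pos(1)[OF _ j, of t] pos(1)[OF Suc.prems j] t head_bound[OF wf j, of "[x, u]" t]
        by (auto simp: run_Suc_tape[OF wf j] act_def)
      ultimately show ?thesis by simp
    qed
    moreover have "\<alpha> [1, Suc t, j, i, fst (snd (?c (Suc t)) ! j) (int i - int ?T)]" if j: "j < ?K" and i: "i \<le> 2 * ?T" for j i
    proof (cases "i = ?pos t j")
      case True
      then have "fst (snd (?c (Suc t)) ! j) (int i - int ?T) = fst (acts M (?c t) ! j)"
        using pos(1)[OF _ j, of t] t by (simp add: run_Suc_tape[OF wf j] act_def)
      moreover have "fst (acts M (?c t) ! j) < ?S" using ao(2)[OF j] by blast
      ultimately show ?thesis using s1[OF t j i] True h2[OF j] h5(2)[OF j]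
        by (auto simp: cell_clauses_true)
    next
      case False
      then have eq: "fst (snd (?c (Suc t)) ! j) (int i - int ?T) = fst (snd (?c t) ! j) (int i - int ?T)"
        using pos(1)[OF _ j, of t] t by (auto simp: run_Suc_tape[OF wf j] act_def)
      have "fst (snd (?c t) ! j) (int i - int ?T) < ?S" using ok j l by (simp add: config_ok_def)
      then show ?thesis using s1[OF t j i] False h2[OF j] h3[OF j i] pos(2)[OF _ j, of t] t unfolding eq
        by (auto simp: cell_clauses_true less_Suc_eq_le simp del: upt_Suc)
    qed
    ultimately show ?case using h5(1) by blast
  qed
  have "fst (?c ?T) \<noteq> 2" using inv[of ?T] f by auto
  moreover have "length u \<le> ?P" using u(1) n(1) by (auto simp: N_def split: if_splits)
  ultimately show ?thesis by blast
qed

definition run_assignment :: "tm \<Rightarrow> bool list \<Rightarrow> bool list \<Rightarrow> nat \<Rightarrow> nat list \<Rightarrow> bool" where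
  "run_assignment M x u T v =
    (let c = run M [x, u] (v ! 1); tp = snd c ! (v ! 2) in
     if v ! 0 = 0 then fst c = v ! 2
     else if v ! 0 = 1 then fst tp (int (v ! 3) - int T) = v ! 4
     else if v ! 0 = 2 then snd tp = int (v ! 3) - int T
     else if v ! 0 = 3 then scan tp = v ! 3
     else if v ! 0 = 4 then fst (acts M c ! (v ! 2)) = v ! 3
     else if v ! 0 = 5 then nat (snd (acts M c ! (v ! 2)) + 1) = v ! 3
     else if v ! 0 = 6 then v ! 1 < length u
     else u ! (v ! 1))"

lemma run_assignment_simps [simp]:
  "run_assignment M x u T [0, t, q] \<longleftrightarrow> fst (run M [x, u] t) = q"
  "run_assignment M x u T [Suc 0, t, j, i, a] \<longleftrightarrow> fst (snd (run M [x, u] t) ! j) (int i - int T) = a"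
  "run_assignment M x u T [2, t, j, i] \<longleftrightarrow> snd (snd (run M [x, u] t) ! j) = int i - int T"
  "run_assignment M x u T [3, t, j, a] \<longleftrightarrow> scan (snd (run M [x, u] t) ! j) = a"
  "run_assignment M x u T [4, t, j, b] \<longleftrightarrow> fst (acts M (run M [x, u] t) ! j) = b"
  "run_assignment M x u T [5, t, j, d] \<longleftrightarrow> nat (snd (acts M (run M [x, u] t) ! j) + 1) = d"
  "run_assignment M x u T [6, i] \<longleftrightarrow> i < length u"
  "run_assignment M x u T [7, i] \<longleftrightarrow> u ! i"
  by (simp_all add: run_assignment_def Let_def)

lemma tableau_complete:
  assumes wf: "wf_tm M" and u: "length u \<le> poly p (length x)"
    and acc: "fst (run M [x, u] (poly q (length x))) \<noteq> 2"
  shows "cnf_true (run_assignment M x u (poly q (length x)))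
    (tableau (tapes M) (symbols M) (templates M) p q x)"
proof -
  let ?T = "poly q (length x)" and ?P = "poly p (length x)" and ?K = "tapes M" and ?S = "symbols M"
  let ?a = "run_assignment M x u ?T" and ?c = "run M [x, u]"
  have c0: "snd (?c 0) ! j = input_tape (if j = 0 then x else if j = 1 then u else [])" if "j < ?K" for j
    using that by (auto simp: run_def init_def less_Suc_eq nth_Cons')
  have "cnf_true ?a (init_cell x ?T ?P j i)" if j: "j < ?K" for j i
  proof -
    define w where "w = (if j = 0 then x else if j = 1 then u else [])"
    have "fst (snd (?c 0) ! j) (int i - int ?T) =
        (if ?T \<le> i \<and> i - ?T < length w then bit_symbol (w ! (i - ?T)) else 0)"
      using c0[OF j] by (auto simp: w_def[symmetric] input_tape_def nat_diff_distrib')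
    then show ?thesis
      using u by (auto simp: init_cell_def cnf_true_simps imp_true bit_symbol_def
          hd_drop_conv_nth w_def split: if_splits)
  qed
  moreover have "cnf_true ?a (cell_clauses ?S ?T t j i)" if j: "j < ?K" and t: "t < ?T" for t j i
  proof -
    have d: "snd (acts M (?c t) ! j) \<in> {-1, 0, 1}"
      using acts_ok(2)[OF wf config_ok_run[OF wf] j] by blast
    show ?thesis
      using d head_bound[OF wf j, of "[x, u]" t] t
      by (auto simp: cell_clauses_true run_Suc_tape[OF wf j] act_def scan_def simp del: upt_Suc)
  qed
  moreover have "cnf_true ?a (template_clauses t r)" if r: "r \<in> set (templates M)" for t r
  proof -
    obtain s as where s: "length as = ?K" "s < states M" "r = (let r = full_trans M s as in
      ([0, s] # map (\<lambda>j. [3, j, as ! j]) [0..<?K], [0, fst r],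
       map (\<lambda>j. [4, j, fst (snd r ! j)]) [0..<?K] @
       map (\<lambda>j. [5, j, nat (snd (snd r ! j) + 1)]) [0..<?K]))"
      using r by (auto simp: templates_def set_n_lists)
    show ?thesis
    proof (cases "fst (?c t) = s \<and> (\<forall>j < ?K. scan (snd (?c t) ! j) = as ! j)")
      case True
      have "length (snd (?c t)) = ?K" using config_ok_run[OF wf] by (simp add: config_ok_def)
      then have "as = map scan (snd (?c t))" using True s(1) by (auto intro: nth_equalityI)
      then show ?thesis using True
        by (auto simp: template_clauses_def s(3) Let_def cnf_true_simps cnf_true_map imp_true stamp_def acts_def
            run_def step_full_trans)
    next
      case False
      then show ?thesis
        by (auto simp: template_clauses_def s(3) Let_def cnf_true_simps cnf_true_map imp_true stamp_def)
    qed
  qed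
  moreover have "fst (?c 0) = 0" by (simp add: run_def init_def)
  ultimately show ?thesis using acc
    by (auto simp: tableau_def Let_def cnf_true_simps cnf_true_map imp_true c0 input_tape_def)
qed

text \<open>Only the membership of reduced instances of lifetime 2 matters, so that the same
  reduction serves with and without the restriction to DAGs of lifetime 2, and for both kinds of
  disjointness.\<close>

lemma NP_hardI:
  assumes k: "1 \<le> k"
    and X: "\<And>\<phi>. mv_wf \<phi> \<Longrightarrow> has_lifetime (tdigraph_of (reduced k \<phi>)) 2 \<Longrightarrow> reduced k \<phi> \<in> X \<longleftrightarrow> mv_sat \<phi>"
  shows "NP_hard (enc_instance ` X)"
  unfolding NP_hard_def
proof
  fix L assume "L \<in> NP"
  then obtain M and p q :: "nat poly" where wf: "wf_tm M"
    and tot: "\<And>x u. length u \<le> poly p (length x) \<Longrightarrow> \<exists>b. answers M [x, u] (poly q (length x)) b"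
    and L: "\<And>x. x \<in> L \<longleftrightarrow> (\<exists>u. length u \<le> poly p (length x) \<and> answers M [x, u] (poly q (length x)) True)"
    unfolding NP_def by blast
  define F where "F = tableau (tapes M) (symbols M) (templates M) p q"
  have ans: "answers M [x, u] (poly q (length x)) True \<longleftrightarrow> fst (run M [x, u] (poly q (length x))) \<noteq> 2"
    if "length u \<le> poly p (length x)" for x u
    using tot[OF that] by (auto simp: answers_def split: if_splits)
  have sat: "(\<exists>\<alpha>. cnf_true \<alpha> (F x)) \<longleftrightarrow> x \<in> L" for x
    using tableau_sound[OF wf] tableau_complete[OF wf] ans L unfolding F_def by metis
  have "enc_instance (reduced k (mv_of_cnf (F x))) \<in> enc_instance ` X \<longleftrightarrow> x \<in> L" for x
  proof -
    have "concat (F x) \<noteq> []" by (simp add: F_def tableau_def Let_def imp_def)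
    from has_lifetime_reduced[OF mv_wf_of_cnf mv_of_cnf_lifetime[OF this]]
    have "reduced k (mv_of_cnf (F x)) \<in> X \<longleftrightarrow> x \<in> L"
      using X[OF mv_wf_of_cnf] mv_sat_of_cnf sat by metis
    then show ?thesis using inj_enc_instance by (simp add: inj_image_mem_iff)
  qed
  moreover have "pt (\<lambda>x. enc_instance (reduced k (mv_of_cnf (F x))))"
    unfolding F_def by (intro cp_comp[OF _ pt_enc_reduced] cp_comp[OF _ pt_mv_of_cnf] pt_tableau)
  ultimately show "polytime_reducible L (enc_instance ` X)"
    unfolding polytime_reducible_def using polytime_computable_pt by blast
qed

section \<open>Certificates\<close>

type_synonym 'a temporal_edge = "('a \<times> 'a) \<times> ('a \<times> 'a)"

text \<open>A certificate consists of the instance, for each branching its roots and for each vertex its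
  incoming temporal edge and a rank, and for each vertex a rank that witnesses acyclicity of the
  digraph. For a root, only the head of the edge matters.\<close>

type_synonym 'a forest_list = "('a temporal_edge \<times> nat) list"
type_synonym 'a certificate =
  "'a instance_of \<times> (('a \<times> 'a) list \<times> 'a forest_list) list \<times> ('a \<times> nat) list"

definition map_certificate :: "('a \<Rightarrow> 'b) \<Rightarrow> 'a certificate \<Rightarrow> 'b certificate" where
  "map_certificate f = (let f2 = map_prod f f in
     map_prod (map_instance f) (map_prod
       (map (map_prod (map f2) (map (map_prod (map_prod f2 f2) (\<lambda>n. n)))))
       (map (map_prod f (\<lambda>n. n)))))"

definition check_instance :: "('a \<Rightarrow> 'a \<Rightarrow> bool) \<Rightarrow> 'a \<Rightarrow> nat \<Rightarrow> 'a instance_of \<Rightarrow> bool" where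
  "check_instance le z k I =
    (let vs = fst I; es = fst (snd I); tvs = fst (snd (snd I)); tes = fst (snd (snd (snd I))); rs = snd (snd (snd (snd I))) in
     (\<forall>a \<in> set es. fst a \<in> set vs \<and> snd a \<in> set vs \<and> fst a \<noteq> snd a) \<and>
     (\<forall>x \<in> set tvs. fst x \<in> set vs \<and> snd x \<noteq> z) \<and>
     (\<forall>e \<in> set tes. (fst (fst e), fst (snd e)) \<in> set es \<and> fst e \<in> set tvs \<and> snd e \<in> set tvs \<and>
        le (snd (fst e)) (snd (snd e))) \<and>
     length rs = k \<and> (\<forall>R \<in> set rs. \<forall>x \<in> set R. x \<in> set tvs))"

definition check_forest :: "'a instance_of \<Rightarrow> ('a \<times> 'a) list \<Rightarrow> 'a forest_list \<Rightarrow> bool" where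
  "check_forest I R E =
    (let vs = fst I; tvs = fst (snd (snd I)); tes = fst (snd (snd (snd I))) in
     (\<forall>v \<in> set vs. \<exists>e \<in> set E. fst (snd (fst e)) = v) \<and>
     (\<forall>e \<in> set E. \<forall>e' \<in> set E. fst (snd (fst e)) = fst (snd (fst e')) \<longrightarrow> e = e') \<and>
     (\<forall>e \<in> set E. snd (fst e) \<in> set tvs \<and> (snd (fst e) \<in> set R \<or> fst e \<in> set tes \<and>
        (\<exists>e' \<in> set E. snd (fst e') = fst (fst e) \<and> snd e' < snd e))))"

text \<open>The flag \<open>b\<close> selects edge-disjointness rather than t-edge-disjointness.\<close>

definition disjoint_forests :: "bool \<Rightarrow> ('a \<times> 'a) list \<times> 'a forest_list \<Rightarrow> ('a \<times> 'a) list \<times> 'a forest_list \<Rightarrow> bool" where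
  "disjoint_forests b f f' = (\<forall>e \<in> set (snd f). \<forall>e' \<in> set (snd f').
     snd (fst e) \<in> set (fst f) \<or> snd (fst e') \<in> set (fst f') \<or>
     (if b then \<not> (fst (fst (fst e)) = fst (fst (fst e')) \<and> fst (snd (fst e)) = fst (snd (fst e')))
      else \<not> fst e = fst e'))"

definition check_restricted :: "'a \<Rightarrow> 'a \<Rightarrow> 'a certificate \<Rightarrow> bool" where
  "check_restricted one two c =
    (let vs = fst (fst c); es = fst (snd (fst c)); tvs = fst (snd (snd (fst c))); ranks = snd (snd c) in
     (\<exists>x \<in> set tvs. snd x = two) \<and> (\<forall>x \<in> set tvs. snd x = one \<or> snd x = two) \<and>
     (\<forall>v \<in> set vs. \<exists>r \<in> set ranks. fst r = v) \<and>
     (\<forall>a \<in> set es. \<forall>r \<in> set ranks. \<forall>r' \<in> set ranks. fst r = fst a \<and> fst r' = snd a \<longrightarrow> snd r < snd r'))"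

definition check ::
    "('a \<Rightarrow> 'a \<Rightarrow> bool) \<Rightarrow> 'a \<Rightarrow> 'a \<Rightarrow> 'a \<Rightarrow> nat \<Rightarrow> bool \<Rightarrow> bool \<Rightarrow> 'a certificate \<Rightarrow> bool" where
  "check le z one two k b d c =
    (check_instance le z k (fst c) \<and> map (\<lambda>f. fst f) (fst (snd c)) = snd (snd (snd (snd (fst c)))) \<and>
     (\<forall>f \<in> set (fst (snd c)). check_forest (fst c) (fst f) (snd f)) \<and>
     (\<forall>i \<in> set [0..<length (fst (snd c))]. \<forall>j \<in> set [0..<length (fst (snd c))]. i = j \<or>
        disjoint_forests b (hd (drop i (fst (snd c)))) (hd (drop j (fst (snd c))))) \<and>
     (if d then check_restricted one two c else True))"

lemma inj_pair_image: "inj f \<Longrightarrow> (f a, f b) \<in> map_prod f f ` S \<longleftrightarrow> (a, b) \<in> S"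
  by (auto simp: inj_eq)

text \<open>The machine checks certificates over bit strings, while correctness is proved over
  numbers. The check depends on names only through equality and its parameters, so that the
  injection \<open>nat_bits\<close> translates between the two.\<close>

lemma check_map:
  assumes "inj f"
  shows "check le (f z) (f one) (f two) k b d (map_certificate f c) =
    check (\<lambda>x y. le (f x) (f y)) z one two k b d c"
proof -
  obtain vs es tvs tes rs fs ranks where c: "c = ((vs, es, tvs, tes, rs), fs, ranks)" by (metis prod_cases5 prod_cases3)
  let ?f2 = "map_prod f f" and ?I = "(vs, es, tvs, tes, rs)"
  have f2: "inj ?f2" by (rule prod.inj_map[OF assms assms])
  have f4: "inj (map_prod ?f2 ?f2)" by (rule prod.inj_map[OF f2 f2])
  have fe: "inj (map_prod (map_prod ?f2 ?f2) (\<lambda>n :: nat. n))" by (rule prod.inj_map[OF f4]) (rule injI)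
  note inj = inj_eq[OF assms] inj_eq[OF f2] inj_eq[OF f4] inj_eq[OF fe] inj_image_mem_iff[OF assms]
    inj_image_mem_iff[OF f2] inj_image_mem_iff[OF f4] inj_pair_image[OF assms]
  have 1: "check_instance le (f z) k (map_instance f ?I) = check_instance (\<lambda>x y. le (f x) (f y)) z k ?I"
    by (simp add: check_instance_def Let_def map_instance_def inj)
  have 2: "check_forest (map_instance f ?I) (map ?f2 R) (map (map_prod (map_prod ?f2 ?f2) (\<lambda>n. n)) E) = check_forest ?I R E" for R E
    by (simp add: check_forest_def Let_def map_instance_def inj)
  have 3: "disjoint_forests b (map_prod (map ?f2) (map (map_prod (map_prod ?f2 ?f2) (\<lambda>n. n))) g)
      (map_prod (map ?f2) (map (map_prod (map_prod ?f2 ?f2) (\<lambda>n. n))) g') = disjoint_forests b g g'" for g g'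
    by (simp add: disjoint_forests_def inj)
  have 4: "check_restricted (f one) (f two) (map_certificate f c) = check_restricted one two c"
    by (simp add: check_restricted_def Let_def map_certificate_def map_instance_def inj c)
  let ?g = "map_prod (map ?f2) (map (map_prod (map_prod ?f2 ?f2) (\<lambda>n :: nat. n)))"
  have 5: "map (\<lambda>f. fst f) (map ?g fs) = map (map ?f2) rs \<longleftrightarrow> map (\<lambda>f. fst f) fs = rs"
  proof -
    have "map (\<lambda>f. fst f) (map ?g fs) = map (map ?f2) (map (\<lambda>f. fst f) fs)" by simp
    then show ?thesis using inj_eq[OF inj_mapI[OF inj_mapI[OF f2]]] by metis
  qed
  have 6: "(\<forall>h \<in> set (map ?g fs). check_forest (map_instance f ?I) (fst h) (snd h)) \<longleftrightarrow>
      (\<forall>h \<in> set fs. check_forest ?I (fst h) (snd h))"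
    by (simp add: 2)
  have 7: "(\<forall>i \<in> set [0..<length (map ?g fs)]. \<forall>j \<in> set [0..<length (map ?g fs)]. i = j \<or>
        disjoint_forests b (hd (drop i (map ?g fs))) (hd (drop j (map ?g fs)))) \<longleftrightarrow>
      (\<forall>i \<in> set [0..<length fs]. \<forall>j \<in> set [0..<length fs]. i = j \<or>
        disjoint_forests b (hd (drop i fs)) (hd (drop j fs)))"
    by (simp add: hd_drop_conv_nth 3 del: drop_map)
  have m: "map_certificate f c = (map_instance f ?I, map ?g fs, map (map_prod f (\<lambda>n. n)) ranks)"
    by (simp add: c map_certificate_def Let_def)
  have rs: "snd (snd (snd (snd (map_instance f ?I)))) = map (map ?f2) rs" by (simp add: map_instance_def Let_def)
  show ?thesis
    unfolding check_def m fst_conv snd_conv rs 1 4[unfolded m] 5 6 7 by (simp only: c fst_conv snd_conv)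
qed

text \<open>A guessed certificate may contain names with zeros at the significant end; stripping
  them makes every guess a certificate over numbers.\<close>

definition strip :: "bool list \<Rightarrow> bool list" where
  "strip bs = fold (\<lambda>b s. if \<not> b \<and> s = [] then [] else b # s) (rev bs) []"

lemma nat_bits_bits_value: "nat_bits (bits_value bs) = strip bs"
proof -
  let ?h = "\<lambda>b s. if \<not> b \<and> s = [] then [] else b # s"
  have "strip bs = foldr ?h bs []" for bs by (simp add: strip_def foldr_conv_fold)
  moreover have "nat_bits (bits_value bs) = foldr ?h bs []"
  proof (induction bs)
    case (Cons b bs)
    show ?case
    proof (cases "bits_value (b # bs) = 0")
      case True
      then have "\<not> b" "bits_value bs = 0" by (auto split: if_splits)
      then show ?thesis using Cons.IH by simp
    next
      case False
      then have "nat_bits (bits_value (b # bs)) = b # nat_bits (bits_value bs)"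
        by (subst nat_bits_pos) auto
      moreover have "\<not> (\<not> b \<and> foldr ?h bs [] = [])"
      proof
        assume h: "\<not> b \<and> foldr ?h bs [] = []"
        then have "bits_value (nat_bits (bits_value bs)) = 0" unfolding Cons.IH by simp
        then show False using h False by simp
      qed
      ultimately show ?thesis using Cons.IH by simp
    qed
  qed simp
  ultimately show ?thesis by simp
qed

lemma pt_strip: "cp S f \<Longrightarrow> cp S (\<lambda>x. strip (f x))"
proof -
  assume f: "cp S f"
  show ?thesis unfolding strip_def
    by (rule cp_fold_linear[where g = "\<lambda>z. 4"])
      (auto intro!: pt_intros pb_intros f cp_const cp_base[OF f])
qed

text \<open>Of two canonical numerals the longer is larger. At equal length the bits are read from
  the least significant one, and the last difference seen, which is the most significant,
  decides.\<close>

definition le_bits :: "bool list \<Rightarrow> bool list \<Rightarrow> bool" where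
  "le_bits xs ys = (length xs < length ys \<or> length xs = length ys \<and>
     fst (fold (\<lambda>x s. (if x = hd (snd s) then fst s else hd (snd s), tl (snd s))) xs (True, ys)))"

lemma bits_value_less: "bits_value bs < 2 ^ length bs"
  by (induction bs) auto

lemma bits_value_ge: "canonical bs \<Longrightarrow> bs \<noteq> [] \<Longrightarrow> 2 ^ (length bs - 1) \<le> bits_value bs"
proof (induction bs)
  case (Cons b bs)
  show ?case
  proof (cases bs)
    case Nil
    then show ?thesis using Cons.prems by (simp add: canonical_def)
  next
    case (Cons c cs)
    then have "2 ^ (length bs - 1) \<le> bits_value bs" using Cons.IH Cons.prems by (simp add: canonical_def)
    then show ?thesis using Cons by simp
  qed
qed simp

lemma fold_compare:
  "length xs = length ys \<Longrightarrow>
   fst (fold (\<lambda>x s. (if x = hd (snd s) then fst s else hd (snd s), tl (snd s))) xs (c, ys)) \<longleftrightarrow>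
   (if c then bits_value xs \<le> bits_value ys else bits_value xs < bits_value ys)"
proof (induction xs arbitrary: c ys)
  case (Cons x xs)
  then obtain y zs where ys: "ys = y # zs" "length xs = length zs" by (cases ys) auto
  show ?case using Cons.IH[OF ys(2)] by (auto simp: ys(1))
qed simp

lemma le_bits_nat_bits: "le_bits (nat_bits m) (nat_bits n) \<longleftrightarrow> m \<le> n"
proof -
  have *: "m < n" if "length (nat_bits m) < length (nat_bits n)" for m n
  proof -
    have "m < 2 ^ length (nat_bits m)" using bits_value_less[of "nat_bits m"] by simp
    also have "\<dots> \<le> 2 ^ (length (nat_bits n) - 1)" using that by (intro power_increasing) auto
    also have "\<dots> \<le> n" using bits_value_ge[OF canonical_nat_bits, of n] that by (cases "nat_bits n = []") auto
    finally show ?thesis .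
  qed
  consider "length (nat_bits m) < length (nat_bits n)" | "length (nat_bits n) < length (nat_bits m)"
    | "length (nat_bits m) = length (nat_bits n)" by linarith
  then show ?thesis
    using *[of m n] *[of n m] fold_compare[of "nat_bits m" "nat_bits n" True] by cases (auto simp: le_bits_def)
qed

lemma pt_le_bits: "cp S f \<Longrightarrow> cp S g \<Longrightarrow> cp S (\<lambda>x. le_bits (f x) (g x))"
proof -
  assume fg: "cp S f" "cp S g"
  let ?h = "\<lambda>x :: bool. \<lambda>s :: bool \<times> bool list. (if x = hd (snd s) then fst s else hd (snd s), tl (snd s))"
  let ?F = "\<lambda>w :: bool list \<times> bool list. fold ?h (fst w) (True, snd w)"
  have "pt (\<lambda>z :: (bool list \<times> bool list) \<times> bool \<times> bool \<times> bool list. ?h (fst (snd z)) (snd (snd z)))"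
    by (intro pt_intros)
  moreover have "sz (?h y s) \<le> sz s + 3" for y s
    using sz_tl[of "snd s"] by (cases s) auto
  ultimately have "pt ?F"
    by (intro cp_fold_linear[where g = "\<lambda>z. 3"]) (auto intro!: pt_intros pb_intros simp del: sz_simps)
  then have "pt (\<lambda>w. le_bits (fst w) (snd w))" unfolding le_bits_def by (intro pt_intros)
  from cp_comp[OF cp_pair[OF fg] this] show ?thesis by simp
qed

definition binary_check :: "nat \<Rightarrow> bool \<Rightarrow> bool \<Rightarrow> bool list certificate \<Rightarrow> bool" where
  "binary_check = check le_bits [] [True] [False, True]"

lemma binary_check_map: "binary_check k b d (map_certificate nat_bits c) = check (\<le>) 0 1 2 k b d c"
proof -
  have "nat_bits 1 = [True]" "nat_bits 2 = [False, True]"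
    by (auto simp: nat_bits_pos)
  then show ?thesis
    using check_map[OF nat_bits_inj, of le_bits 0 1 2 k b d c] by (simp add: binary_check_def le_bits_nat_bits)
qed

lemma pt_binary_check: "pt (binary_check k b d)"
  unfolding binary_check_def check_def[abs_def] check_instance_def check_forest_def disjoint_forests_def
    check_restricted_def Let_def
  by (intro pt_intros pt_le_bits)

lemma pt_map_certificate_strip: "pt (map_certificate strip)"
  unfolding map_certificate_def map_instance_def Let_def map_prod_def case_prod_unfold
  by (intro pt_intros pt_strip)

section \<open>Correctness of the check over numbers\<close>

lemma pair_digraph_iff:
  "pair_digraph G \<longleftrightarrow> finite (pverts G) \<and> finite (parcs G) \<and>
     (\<forall>e \<in> parcs G. fst e \<in> pverts G \<and> snd e \<in> pverts G \<and> fst e \<noteq> snd e)"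
  unfolding pair_digraph_def pair_fin_digraph_def pair_wf_digraph_def pair_fin_digraph_axioms_def
    pair_loopfree_digraph_def pair_loopfree_digraph_axioms_def by auto

lemma check_instance_iff: "check_instance (\<le>) 0 k J \<longleftrightarrow> J \<in> branching_instances k"
proof -
  obtain vs es tvs tes rs where J: "J = (vs, es, tvs, tes, rs)" by (metis prod_cases5)
  have fin: "finite {t. (v, t) \<in> set tvs}" for v
    by (rule finite_subset[of _ "snd ` set tvs"]) force+
  have 1: "temporal_digraph (tdigraph_of J) \<longleftrightarrow>
      (\<forall>a \<in> set es. fst a \<in> set vs \<and> snd a \<in> set vs \<and> fst a \<noteq> snd a) \<and>
      (\<forall>x \<in> set tvs. fst x \<in> set vs \<and> snd x \<noteq> 0) \<and>
      (\<forall>e \<in> set tes. (fst (fst e), fst (snd e)) \<in> set es \<and> fst e \<in> set tvs \<and> snd e \<in> set tvs \<and>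
        snd (fst e) \<le> snd (snd e))" (is "?l \<longleftrightarrow> ?r")
  proof
    assume ?l then show ?r
      unfolding temporal_digraph_def pair_digraph_iff J by (auto split: prod.splits) blast
  next
    assume ?r then show ?l
      unfolding temporal_digraph_def pair_digraph_iff J using fin by (auto split: prod.splits)
  qed
  have 2: "temporal_verts (tdigraph_of J) = {x \<in> set tvs. fst x \<in> set vs}"
    by (auto simp: temporal_verts_def J)
  show ?thesis
    unfolding branching_instances_def mem_Collect_eq 1 2 by (auto simp: check_instance_def J Let_def subset_iff) fastforce
qed

context
  fixes k :: nat and J :: branching_instance
  assumes J: "J \<in> branching_instances k"
begin

lemma temporal_digraph_instance: "temporal_digraph (tdigraph_of J)"
  using J by (simp add: branching_instances_def)

lemma pverts_instance: "pverts (dg (tdigraph_of J)) = set (fst J)"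
  by (cases J) auto

lemma temporal_verts_instance: "temporal_verts (tdigraph_of J) = set (fst (snd (snd J)))"
proof -
  have "check_instance (\<le>) 0 k J" using J check_instance_iff by blast
  then show ?thesis by (cases J) (auto simp: check_instance_def Let_def temporal_verts_def)
qed

lemma temporal_edges_instance: "temporal_edges (tdigraph_of J) = set (fst (snd (snd (snd J))))"
proof -
  have "check_instance (\<le>) 0 k J" using J check_instance_iff by blast
  then show ?thesis by (cases J) (auto simp: check_instance_def Let_def temporal_edges_def)
qed

lemma check_forest_sound:
  assumes "check_forest J R E"
  shows "\<exists>\<tau> p rk. forest (tdigraph_of J) (set R) \<tau> p rk \<and>
    forest_edges (tdigraph_of J) (set R) \<tau> p \<subseteq> fst ` {e \<in> set E. snd (fst e) \<notin> set R}"
proof -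
  let ?V = "set (fst J)"
  have 1: "\<And>v. v \<in> ?V \<Longrightarrow> \<exists>e. e \<in> set E \<and> fst (snd (fst e)) = v"
    and 2: "\<And>e e'. e \<in> set E \<Longrightarrow> e' \<in> set E \<Longrightarrow> fst (snd (fst e)) = fst (snd (fst e')) \<Longrightarrow> e = e'"
    and 3: "\<And>e. e \<in> set E \<Longrightarrow> snd (fst e) \<in> set (fst (snd (snd J)))"
    and 4: "\<And>e. e \<in> set E \<Longrightarrow> snd (fst e) \<notin> set R \<Longrightarrow> fst e \<in> set (fst (snd (snd (snd J)))) \<and>
        (\<exists>e' \<in> set E. snd (fst e') = fst (fst e) \<and> snd e' < snd e)"
    using assms unfolding check_forest_def Let_def by blast+
  from 1 obtain en where en: "\<And>v. v \<in> ?V \<Longrightarrow> en v \<in> set E \<and> fst (snd (fst (en v))) = v" by metis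
  define \<tau> where "\<tau> v = snd (snd (fst (en v)))" for v
  define p where "p v = fst (fst (fst (en v)))" for v
  define rk where "rk v = snd (en v)" for v
  have sn: "snd (fst (en v)) = (v, \<tau> v)" if "v \<in> ?V" for v
    using en[OF that] by (simp add: \<tau>_def prod_eq_iff)
  have ed: "p v \<in> ?V \<and> rk (p v) < rk v \<and> fst (en v) = ((p v, \<tau> (p v)), (v, \<tau> v)) \<and>
      fst (en v) \<in> set (fst (snd (snd (snd J))))" if v: "v \<in> ?V" "(v, \<tau> v) \<notin> set R" for v
  proof -
    have e: "en v \<in> set E" "snd (fst (en v)) \<notin> set R" using en[OF v(1)] v(2) sn[OF v(1)] by auto
    from 4[OF e] obtain e' where e': "e' \<in> set E" "snd (fst e') = fst (fst (en v))" "snd e' < snd (en v)"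
      "fst (en v) \<in> set (fst (snd (snd (snd J))))" by blast
    have "fst (fst (en v)) \<in> temporal_verts (tdigraph_of J)"
      using 3[OF e'(1)] e'(2) temporal_verts_instance by simp
    then have pv: "p v \<in> ?V" using pverts_instance by (cases "fst (fst (en v))") (auto simp: temporal_verts_def p_def)
    have "e' = en (p v)" using 2[OF e'(1), of "en (p v)"] en[OF pv] e'(2) by (simp add: p_def)
    then show ?thesis using e' pv sn[OF v(1)] sn[OF pv] by (simp add: rk_def prod_eq_iff)
  qed
  have "forest (tdigraph_of J) (set R) \<tau> p rk"
    unfolding forest_def temporal_verts_instance temporal_edges_instance pverts_instance
  proof (intro ballI conjI)
    fix v assume v: "v \<in> ?V"
    show "(v, \<tau> v) \<in> set (fst (snd (snd J)))" using 3 en[OF v] sn[OF v] by metis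
    show "(v, \<tau> v) \<in> set R \<or> p v \<in> ?V \<and> rk (p v) < rk v \<and>
        ((p v, \<tau> (p v)), (v, \<tau> v)) \<in> set (fst (snd (snd (snd J))))"
      using ed[OF v] by metis
  qed
  moreover have "forest_edges (tdigraph_of J) (set R) \<tau> p \<subseteq> fst ` {e \<in> set E. snd (fst e) \<notin> set R}"
  proof
    fix x assume "x \<in> forest_edges (tdigraph_of J) (set R) \<tau> p"
    then obtain v where v: "v \<in> ?V" "(v, \<tau> v) \<notin> set R" "x = ((p v, \<tau> (p v)), (v, \<tau> v))"
      unfolding forest_edges_def pverts_instance by blast
    then show "x \<in> fst ` {e \<in> set E. snd (fst e) \<notin> set R}"
      using ed[OF v(1,2)] en[OF v(1)] sn[OF v(1)] by (intro image_eqI[of _ _ "en v"]) auto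
  qed
  ultimately show ?thesis by blast
qed

text \<open>Ranks are written in unary, so an arbitrary rank is replaced by the number of vertices
  below it, which preserves strict order and is at most the number of listed vertices.\<close>

definition rank_in :: "(nat \<Rightarrow> nat) \<Rightarrow> nat \<Rightarrow> nat" where
  "rank_in rk v = card {u \<in> set (fst J). rk u < rk v}"

lemma rank_in_less: "u \<in> set (fst J) \<Longrightarrow> rk u < rk v \<Longrightarrow> rank_in rk u < rank_in rk v"
  unfolding rank_in_def by (intro psubset_card_mono) auto

lemma rank_in_le: "rank_in rk v \<le> length (fst J)"
proof -
  have "rank_in rk v \<le> card (set (fst J))" unfolding rank_in_def by (intro card_mono) auto
  also have "\<dots> \<le> length (fst J)" by (rule card_length)
  finally show ?thesis .
qed

definition forest_list :: "(nat \<times> nat) list \<Rightarrow> (nat \<Rightarrow> nat) \<Rightarrow> (nat \<Rightarrow> nat) \<Rightarrow> (nat \<Rightarrow> nat) \<Rightarrow> nat forest_list" where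
  "forest_list R \<tau> p rk = map (\<lambda>v. ((if (v, \<tau> v) \<in> set R then (v, \<tau> v) else (p v, \<tau> (p v)), (v, \<tau> v)), rank_in rk v)) (fst J)"

lemma check_forest_complete:
  assumes f: "forest (tdigraph_of J) (set R) \<tau> p rk"
  shows "check_forest J R (forest_list R \<tau> p rk)"
    "fst ` {e \<in> set (forest_list R \<tau> p rk). snd (fst e) \<notin> set R} \<subseteq> forest_edges (tdigraph_of J) (set R) \<tau> p"
proof -
  note f' = f[unfolded forest_def temporal_verts_instance temporal_edges_instance pverts_instance]
  show "check_forest J R (forest_list R \<tau> p rk)"
    unfolding check_forest_def Let_def
  proof (intro conjI ballI impI)
    fix v assume "v \<in> set (fst J)"
    then show "\<exists>e \<in> set (forest_list R \<tau> p rk). fst (snd (fst e)) = v" by (force simp: forest_list_def)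
  next
    fix e e' assume "e \<in> set (forest_list R \<tau> p rk)" "e' \<in> set (forest_list R \<tau> p rk)" "fst (snd (fst e)) = fst (snd (fst e'))"
    then show "e = e'" by (auto simp: forest_list_def)
  next
    fix e assume "e \<in> set (forest_list R \<tau> p rk)"
    then obtain v where v: "v \<in> set (fst J)"
      "e = ((if (v, \<tau> v) \<in> set R then (v, \<tau> v) else (p v, \<tau> (p v)), (v, \<tau> v)), rank_in rk v)"
      by (auto simp: forest_list_def)
    show "snd (fst e) \<in> set (fst (snd (snd J)))" using f' v by simp
    show "snd (fst e) \<in> set R \<or> fst e \<in> set (fst (snd (snd (snd J)))) \<and>
        (\<exists>e' \<in> set (forest_list R \<tau> p rk). snd (fst e') = fst (fst e) \<and> snd e' < snd e)"
    proof (cases "(v, \<tau> v) \<in> set R")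
      case False
      with f' v(1) have p: "p v \<in> set (fst J)" "rk (p v) < rk v"
        "((p v, \<tau> (p v)), (v, \<tau> v)) \<in> set (fst (snd (snd (snd J))))" by auto
      have "\<exists>e' \<in> set (forest_list R \<tau> p rk). snd (fst e') = (p v, \<tau> (p v)) \<and> snd e' = rank_in rk (p v)"
        using p(1) by (force simp: forest_list_def)
      then obtain e' where "e' \<in> set (forest_list R \<tau> p rk)" "snd (fst e') = (p v, \<tau> (p v))"
        "snd e' < rank_in rk v" using rank_in_less[OF p(1,2)] by metis
      then show ?thesis using p(3) v(2) False by auto
    qed (simp add: v)
  qed
  show "fst ` {e \<in> set (forest_list R \<tau> p rk). snd (fst e) \<notin> set R} \<subseteq> forest_edges (tdigraph_of J) (set R) \<tau> p"
    unfolding forest_edges_def pverts_instance by (auto simp: forest_list_def)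
qed

lemma has_lifetime_instance:
  "has_lifetime (tdigraph_of J) 2 \<longleftrightarrow> (\<exists>x \<in> set (fst (snd (snd J))). snd x = 2) \<and>
     (\<forall>x \<in> set (fst (snd (snd J))). snd x = 1 \<or> snd x = 2)"
proof -
  let ?S = "snd ` set (fst (snd (snd J)))"
  have "(\<Union>v \<in> pverts (dg (tdigraph_of J)). gam (tdigraph_of J) v) = snd ` temporal_verts (tdigraph_of J)"
    by (force simp: temporal_verts_def)
  then have eq: "(\<Union>v \<in> pverts (dg (tdigraph_of J)). gam (tdigraph_of J) v) = ?S"
    by (simp add: temporal_verts_instance)
  have "check_instance (\<le>) 0 k J" using J check_instance_iff by blast
  then have pos: "0 \<notin> ?S" by (auto simp: check_instance_def Let_def)
  have "?S \<noteq> {} \<and> Max ?S = 2 \<longleftrightarrow> 2 \<in> ?S \<and> ?S \<subseteq> {1, 2}"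
  proof
    assume h: "?S \<noteq> {} \<and> Max ?S = 2"
    then have "2 \<in> ?S" by (metis List.finite_set Max_in finite_imageI)
    moreover have "x \<in> {1, 2}" if "x \<in> ?S" for x
    proof -
      have "x \<le> 2" using h Max_ge[of ?S x] that by simp
      moreover have "x \<noteq> 0" using that pos by metis
      ultimately show ?thesis by auto
    qed
    ultimately show "2 \<in> ?S \<and> ?S \<subseteq> {1, 2}" by blast
  next
    assume h: "2 \<in> ?S \<and> ?S \<subseteq> {1, 2}"
    then have "Max ?S = 2" by (intro Max_eqI) auto
    moreover have "?S \<noteq> {}" using h by (metis emptyE)
    ultimately show "?S \<noteq> {} \<and> Max ?S = 2" by (rule conjI[rotated])
  qed
  moreover have "2 \<in> ?S \<longleftrightarrow> (\<exists>x \<in> set (fst (snd (snd J))). snd x = 2)" by force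
  moreover have "?S \<subseteq> {1, 2} \<longleftrightarrow> (\<forall>x \<in> set (fst (snd (snd J))). snd x = 1 \<or> snd x = 2)" by auto
  ultimately show ?thesis unfolding has_lifetime_def eq by (simp only:)
qed

lemma check_restricted_sound:
  assumes "check_restricted 1 2 (J, fs, ranks)"
  shows "J \<in> lifetime2_dag"
proof -
  have 1: "\<And>v. v \<in> set (fst J) \<Longrightarrow> \<exists>r. r \<in> set ranks \<and> fst r = v"
    and 2: "\<And>a r r'. a \<in> set (fst (snd J)) \<Longrightarrow> r \<in> set ranks \<Longrightarrow> r' \<in> set ranks \<Longrightarrow>
      fst r = fst a \<Longrightarrow> fst r' = snd a \<Longrightarrow> snd r < snd r'"
    and 3: "has_lifetime (tdigraph_of J) 2"
    using assms unfolding has_lifetime_instance check_restricted_def Let_def fst_conv snd_conv by blast+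
  from 1 obtain r where r: "\<And>v. v \<in> set (fst J) \<Longrightarrow> r v \<in> set ranks \<and> fst (r v) = v" by metis
  have ci: "check_instance (\<le>) 0 k J" using J check_instance_iff by blast
  have "snd (r u) < snd (r v)" if "(u, v) \<in> set (fst (snd J))" for u v
  proof -
    have "u \<in> set (fst J)" "v \<in> set (fst J)" using ci that by (auto simp: check_instance_def Let_def)
    then show ?thesis using 2[OF that, of "r u" "r v"] r by simp
  qed
  moreover have "parcs (dg (tdigraph_of J)) = set (fst (snd J))" by (cases J) simp
  ultimately have "acyclic (parcs (dg (tdigraph_of J)))"
    using acyclicI_order[of "(set (fst (snd J)))\<inverse>" "\<lambda>v. snd (r v)"] by (auto simp: acyclic_converse)
  with 3 show ?thesis by (simp add: lifetime2_dag_def)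
qed

lemma check_restricted_complete:
  assumes "J \<in> lifetime2_dag"
  shows "\<exists>rk. check_restricted 1 2 (J, fs, map (\<lambda>v. (v, rank_in rk v)) (fst J))"
proof -
  let ?A = "set (fst (snd J))"
  have A: "parcs (dg (tdigraph_of J)) = ?A" by (cases J) simp
  then have ac: "acyclic ?A" using assms by (simp add: lifetime2_dag_def)
  \<comment> \<open>The number of proper ancestors increases along an arc from \<open>u\<close> to
    \<open>v\<close>: all ancestors of \<open>u\<close> are ancestors of \<open>v\<close>, and so is
    \<open>u\<close>, which by acyclicity is not an ancestor of itself.\<close>
  define rk where "rk v = card {u. (u, v) \<in> ?A\<^sup>+}" for v
  have fin: "finite {u. (u, v) \<in> ?A\<^sup>+}" for v
    by (rule finite_subset[of _ "fst ` (?A\<^sup>+)"]) (force+)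
  have lt: "rk u < rk v" if "(u, v) \<in> ?A" for u v
    unfolding rk_def
  proof (rule psubset_card_mono[OF fin])
    have "u \<in> {w. (w, v) \<in> ?A\<^sup>+}" "u \<notin> {w. (w, u) \<in> ?A\<^sup>+}"
      using that ac by (auto simp: acyclic_def)
    then show "{w. (w, u) \<in> ?A\<^sup>+} \<subset> {w. (w, v) \<in> ?A\<^sup>+}" using that by (auto intro: trancl.trancl_into_trancl)
  qed
  have ci: "check_instance (\<le>) 0 k J" using J check_instance_iff by blast
  have "check_restricted 1 2 (J, fs, map (\<lambda>v. (v, rank_in rk v)) (fst J))"
    using assms ci rank_in_less lt
    unfolding lifetime2_dag_def mem_Collect_eq has_lifetime_instance check_restricted_def Let_def
    by (auto simp: check_instance_def Let_def)
  then show ?thesis by blast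
qed

end

definition disjointness :: "bool \<Rightarrow> 'v temporal_digraph \<Rightarrow> 'v temporal_digraph \<Rightarrow> 'v temporal_digraph \<Rightarrow> bool" where
  "disjointness b = (if b then edge_disjoint else t_edge_disjoint)"

definition branchings_problem :: "nat \<Rightarrow> bool \<Rightarrow> bool \<Rightarrow> branching_instance set" where
  "branchings_problem k b d = {J \<in> branching_instances k.
     has_disjoint_branchings (disjointness b) (tdigraph_of J) (roots_of J) \<and> (d \<longrightarrow> J \<in> lifetime2_dag)}"

lemma has_disjoint_branchings_iff:
  assumes "temporal_digraph \<G>"
  shows "has_disjoint_branchings (disjointness b) \<G> Rs \<longleftrightarrow>
    (\<exists>\<tau> p rk. (\<forall>i < length Rs. forest \<G> (Rs ! i) (\<tau> i) (p i) (rk i)) \<and>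
     (\<forall>i < length Rs. \<forall>j < length Rs. i \<noteq> j \<longrightarrow>
        (\<forall>e \<in> forest_edges \<G> (Rs ! i) (\<tau> i) (p i). \<forall>e' \<in> forest_edges \<G> (Rs ! j) (\<tau> j) (p j).
           if b then arc_of e \<noteq> arc_of e' else e \<noteq> e')))"
proof -
  have *: "\<pi> ` A \<inter> \<pi> ` B = {} \<longleftrightarrow> (\<forall>e \<in> A. \<forall>e' \<in> B. \<pi> e \<noteq> \<pi> e')" for \<pi> :: "'c \<Rightarrow> 'd" and A B
    by auto
  have **: "A \<inter> B = {} \<longleftrightarrow> (\<forall>e \<in> A. \<forall>e' \<in> B. e \<noteq> e')" for A B :: "'c set"
    by auto
  show ?thesis
    unfolding disjointness_def
    by (cases b) (simp_all add: t_edge_disjoint_forests[OF assms] edge_disjoint_forests[OF assms] forests_def * **)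
qed

lemma roots_of_eq: "roots_of J = map set (snd (snd (snd (snd J))))"
  by (cases J) simp

lemma check_sound:
  assumes "check (\<le>) 0 1 2 k b d n"
  shows "fst n \<in> branchings_problem k b d"
proof -
  obtain J fs ranks where n: "n = (J, fs, ranks)" by (cases n)
  let ?rs = "snd (snd (snd (snd J)))" and ?G = "tdigraph_of J"
  have J: "J \<in> branching_instances k" and rs: "map fst fs = ?rs"
    and f: "\<And>h. h \<in> set fs \<Longrightarrow> check_forest J (fst h) (snd h)"
    and dj0: "\<forall>i \<in> set [0..<length fs]. \<forall>j \<in> set [0..<length fs]. i = j \<or>
        disjoint_forests b (hd (drop i fs)) (hd (drop j fs))"
    and d: "d \<Longrightarrow> check_restricted 1 2 n"
    using assms by (auto simp: check_def n check_instance_iff split: if_splits)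
  have dj: "disjoint_forests b (fs ! i) (fs ! j)" if "i < length fs" "j < length fs" "i \<noteq> j" for i j
    using bspec[OF bspec[OF dj0, of i], of j] that by (simp add: hd_drop_conv_nth)
  have len: "length (roots_of J) = length fs" by (simp add: roots_of_eq flip: rs)
  have nth: "roots_of J ! i = set (fst (fs ! i))" if "i < length fs" for i
    using that by (simp add: roots_of_eq flip: rs)
  define U where "U i = fst ` {e \<in> set (snd (fs ! i)). snd (fst e) \<notin> set (fst (fs ! i))}" for i
  have "\<exists>\<tau> p rk. i < length fs \<longrightarrow> forest ?G (set (fst (fs ! i))) \<tau> p rk \<and>
    forest_edges ?G (set (fst (fs ! i))) \<tau> p \<subseteq> U i" for i
  proof (cases "i < length fs")
    case True
    from check_forest_sound[OF J f[OF nth_mem[OF True]], folded U_def] show ?thesis by (elim exE) (intro exI impI)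
  qed simp
  then obtain \<tau> p rk where "\<And>i. i < length fs \<longrightarrow> forest ?G (set (fst (fs ! i))) (\<tau> i) (p i) (rk i) \<and>
      forest_edges ?G (set (fst (fs ! i))) (\<tau> i) (p i) \<subseteq> U i" by metis
  then have t: "\<And>i. i < length fs \<Longrightarrow> forest ?G (set (fst (fs ! i))) (\<tau> i) (p i) (rk i)"
    and u: "\<And>i. i < length fs \<Longrightarrow> forest_edges ?G (set (fst (fs ! i))) (\<tau> i) (p i) \<subseteq>
      fst ` {e \<in> set (snd (fs ! i)). snd (fst e) \<notin> set (fst (fs ! i))}" unfolding U_def by blast+
  have dju: "if b then arc_of e \<noteq> arc_of e' else e \<noteq> e'"
    if ij: "i < length fs" "j < length fs" "i \<noteq> j"
      and e: "e \<in> forest_edges ?G (set (fst (fs ! i))) (\<tau> i) (p i)" "e' \<in> forest_edges ?G (set (fst (fs ! j))) (\<tau> j) (p j)"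
    for i j e e'
  proof -
    obtain g g' where g: "g \<in> set (snd (fs ! i))" "snd (fst g) \<notin> set (fst (fs ! i))" "e = fst g"
      "g' \<in> set (snd (fs ! j))" "snd (fst g') \<notin> set (fst (fs ! j))" "e' = fst g'"
      using subsetD[OF u[OF ij(1)] e(1)] subsetD[OF u[OF ij(2)] e(2)] by (elim imageE CollectE conjE) simp
    then show ?thesis using dj[OF ij] by (fastforce simp: disjoint_forests_def arc_of_def)
  qed
  have "has_disjoint_branchings (disjointness b) ?G (roots_of J)"
    unfolding has_disjoint_branchings_iff[OF temporal_digraph_instance[OF J]] len
    by (rule exI[of _ \<tau>], rule exI[of _ p], rule exI[of _ rk]) (use t dju in \<open>simp add: nth\<close>)
  moreover have "d \<longrightarrow> J \<in> lifetime2_dag" using check_restricted_sound[OF J] d n by blast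
  ultimately show ?thesis using J by (simp add: branchings_problem_def n)
qed

text \<open>The summand 1 pays for the node that joins a component to the rest, which makes the
  bound pass through pairs and lists. The factor 4 is then forced by a bit, whose tree has size at
  most 3.\<close>

definition size_ok :: "('a::codable \<Rightarrow> bool list) \<Rightarrow> bool" where
  "size_ok e \<longleftrightarrow> (\<forall>x. sz x + 1 \<le> 4 * length (e x))"

lemma size_ok_enc_bit: "size_ok enc_bit"
  by (simp add: size_ok_def enc_bit_def)

lemma size_ok_enc_list:
  assumes "size_ok e"
  shows "size_ok (enc_list e)"
proof -
  have "sz xs + 1 \<le> 4 * length (enc_list e xs)" for xs
  proof (induction xs)
    case (Cons x xs)
    have "sz x + 1 \<le> 4 * length (e x)" using assms by (simp add: size_ok_def)
    then show ?case using Cons by (simp add: enc_list_simps)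
  qed (simp add: enc_list_simps)
  then show ?thesis by (simp add: size_ok_def)
qed

lemma size_ok_enc_pair: "size_ok e \<Longrightarrow> size_ok e' \<Longrightarrow> size_ok (enc_pair e e')"
proof -
  assume a: "size_ok e" "size_ok e'"
  have "sz z + 1 \<le> 4 * length (enc_pair e e' z)" for z
  proof -
    have "sz (fst z) + 1 \<le> 4 * length (e (fst z))" "sz (snd z) + 1 \<le> 4 * length (e' (snd z))"
      using a by (auto simp: size_ok_def)
    then show ?thesis by (cases z) (simp add: enc_pair_def)
  qed
  then show ?thesis by (simp add: size_ok_def)
qed

lemma size_ok_enc_instance: "size_ok (enc_instance_of enc_bits)"
  unfolding enc_instance_of_def Let_def
  by (intro size_ok_enc_pair size_ok_enc_list size_ok_enc_bit)

text \<open>With \<open>X\<close> bounding the instance, an entry of a forest has size at most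
  \<open>4 * X + 3\<close>: a pair of temporal vertices takes \<open>2 * X + 1\<close>, a unary rank
  \<open>2 * X + 1\<close>, and their pairing 1. There are at most \<open>X\<close> entries, which
  gives \<open>E\<close>, for each of the \<open>k\<close> forests; the last summand is the list of
  ranks for acyclicity.\<close>

definition certificate_bound :: "nat \<Rightarrow> nat poly" where
  "certificate_bound k = (let X = [:0, 4:]; E = [:1:] + X * ([:4:] * X + [:4:]) in
     [:3:] + X + ([:1:] + [:k:] * ([:2:] + X + E)) + ([:1:] + X * ([:3:] * X + [:3:])))"

lemma check_complete:
  assumes "J \<in> branchings_problem k b d"
  shows "\<exists>n. fst n = J \<and> check (\<le>) 0 1 2 k b d n \<and>
    sz (map_certificate nat_bits n) \<le> poly (certificate_bound k) (length (enc_instance J))"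
proof -
  let ?rs = "snd (snd (snd (snd J)))" and ?G = "tdigraph_of J"
  have J: "J \<in> branching_instances k" and d: "d \<Longrightarrow> J \<in> lifetime2_dag"
    and "has_disjoint_branchings (disjointness b) ?G (roots_of J)"
    using assms by (auto simp: branchings_problem_def)
  then obtain \<tau> p rk where h: "(\<forall>i < length (roots_of J). forest ?G (roots_of J ! i) (\<tau> i) (p i) (rk i)) \<and>
     (\<forall>i < length (roots_of J). \<forall>j < length (roots_of J). i \<noteq> j \<longrightarrow>
        (\<forall>e \<in> forest_edges ?G (roots_of J ! i) (\<tau> i) (p i). \<forall>e' \<in> forest_edges ?G (roots_of J ! j) (\<tau> j) (p j).
           if b then arc_of e \<noteq> arc_of e' else e \<noteq> e'))"
    unfolding has_disjoint_branchings_iff[OF temporal_digraph_instance[OF J]] by (elim exE)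
  have len: "length (roots_of J) = length ?rs" and nth: "\<And>i. i < length ?rs \<Longrightarrow> roots_of J ! i = set (?rs ! i)"
    by (auto simp: roots_of_eq)
  have k: "length ?rs = k" using J by (simp add: branching_instances_def len)
  note f = conjunct1[OF h, rule_format, unfolded len] and u = conjunct2[OF h, rule_format, unfolded len]
  define E where "E i = forest_list J (?rs ! i) (\<tau> i) (p i) (rk i)" for i
  define fs where "fs = map (\<lambda>i. (?rs ! i, E i)) [0..<length ?rs]"
  have fs: "length fs = length ?rs" "\<And>i. i < length ?rs \<Longrightarrow> fs ! i = (?rs ! i, E i)" by (auto simp: fs_def)
  have c: "check_forest J (?rs ! i) (E i)" "fst ` {e \<in> set (E i). snd (fst e) \<notin> set (?rs ! i)} \<subseteq>
      forest_edges ?G (set (?rs ! i)) (\<tau> i) (p i)" if "i < length ?rs" for i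
    using check_forest_complete[OF J f[OF that, unfolded nth[OF that]]] by (auto simp: E_def)
  have dj: "disjoint_forests b (fs ! i) (fs ! j)" if ij: "i < length ?rs" "j < length ?rs" "i \<noteq> j" for i j
  proof -
    have arc: "if b then arc_of (fst e) \<noteq> arc_of (fst e') else fst e \<noteq> fst e'"
      if "e \<in> set (E i)" "snd (fst e) \<notin> set (?rs ! i)" "e' \<in> set (E j)" "snd (fst e') \<notin> set (?rs ! j)" for e e'
    proof (rule u[OF ij])
      show "fst e \<in> forest_edges ?G (roots_of J ! i) (\<tau> i) (p i)"
        unfolding nth[OF ij(1)] by (rule subsetD[OF c(2)[OF ij(1)]]) (use that in blast)
      show "fst e' \<in> forest_edges ?G (roots_of J ! j) (\<tau> j) (p j)"
        unfolding nth[OF ij(2)] by (rule subsetD[OF c(2)[OF ij(2)]]) (use that in blast)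
    qed
    have *: "if b then \<not> (fst (fst (fst e)) = fst (fst (fst e')) \<and> fst (snd (fst e)) = fst (snd (fst e')))
        else \<not> fst e = fst e'"
      if "e \<in> set (E i)" "snd (fst e) \<notin> set (?rs ! i)" "e' \<in> set (E j)" "snd (fst e') \<notin> set (?rs ! j)" for e e'
      using arc[OF that] by (auto simp: arc_of_def)
    show ?thesis unfolding disjoint_forests_def fs(2)[OF ij(1)] fs(2)[OF ij(2)] fst_conv snd_conv
      using * by blast
  qed
  obtain rk' where rk': "d \<Longrightarrow> check_restricted 1 2 (J, fs, map (\<lambda>v. (v, rank_in J rk' v)) (fst J))"
    using check_restricted_complete[OF J] d by blast
  define n where "n = (J, fs, map (\<lambda>v. (v, rank_in J rk' v)) (fst J))"
  have chk: "check (\<le>) 0 1 2 k b d n"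
    unfolding check_def
  proof (intro conjI)
    show "check_instance (\<le>) 0 k (fst n)" using J by (simp add: n_def check_instance_iff)
    show "map (\<lambda>f. fst f) (fst (snd n)) = snd (snd (snd (snd (fst n))))"
      by (simp add: n_def fs_def comp_def map_nth)
    show "\<forall>f \<in> set (fst (snd n)). check_forest (fst n) (fst f) (snd f)" using c(1) by (auto simp: n_def fs_def)
    show "\<forall>i \<in> set [0..<length (fst (snd n))]. \<forall>j \<in> set [0..<length (fst (snd n))]. i = j \<or>
        disjoint_forests b (hd (drop i (fst (snd n)))) (hd (drop j (fst (snd n))))"
    proof (intro ballI)
      fix i j assume "i \<in> set [0..<length (fst (snd n))]" "j \<in> set [0..<length (fst (snd n))]"
      then show "i = j \<or> disjoint_forests b (hd (drop i (fst (snd n)))) (hd (drop j (fst (snd n))))"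
        using dj[of i j] by (cases "i = j") (auto simp: n_def hd_drop_conv_nth fs(1))
    qed
    show "if d then check_restricted 1 2 n else True" using rk' by (simp add: n_def)
  qed
  let ?f2 = "map_prod nat_bits nat_bits" and ?I = "map_instance nat_bits J"
  define s where "s = 4 * length (enc_instance J)"
  have "sz ?I + 1 \<le> s"
    using size_ok_enc_instance[unfolded size_ok_def, rule_format, of ?I]
    by (simp only: s_def enc_instance_map)
  moreover have I: "?I = (map nat_bits (fst J), map ?f2 (fst (snd J)), map ?f2 (fst (snd (snd J))),
      map (map_prod ?f2 ?f2) (fst (snd (snd (snd J)))), map (map ?f2) ?rs)"
    by (cases J) (simp add: map_instance_def Let_def)
  ultimately have s: "sz (map nat_bits (fst J)) \<le> s" "sz (map ?f2 (fst (snd (snd J)))) \<le> s"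
    "sz (map (map_prod ?f2 ?f2) (fst (snd (snd (snd J))))) \<le> s" "sz (map (map ?f2) ?rs) \<le> s" "sz ?I \<le> s"
    by auto
  have v: "sz (nat_bits x) \<le> s" if "x \<in> set (fst J)" for x
    using sz_mem[of "nat_bits x" "map nat_bits (fst J)"] that s(1) by simp
  have l: "length (fst J) \<le> s" using length_le_sz[of "map nat_bits (fst J)"] s(1) by simp
  have rank: "sz (rank_in J r x) \<le> 2 * s + 1" for r x
    using rank_in_le[OF J, of r x] l by (simp add: sz_nat)
  have E: "sz (map (map_prod (map_prod ?f2 ?f2) (\<lambda>n. n)) (E i)) \<le> 1 + s * (4 * s + 4)" if i: "i < length ?rs" for i
  proof -
    have "sz (map_prod (map_prod ?f2 ?f2) (\<lambda>n. n) e) \<le> 4 * s + 3" if e: "e \<in> set (E i)" for e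
    proof -
      obtain x where x: "x \<in> set (fst J)" "e = ((if (x, \<tau> i x) \<in> set (?rs ! i) then (x, \<tau> i x) else (p i x, \<tau> i (p i x)), (x, \<tau> i x)), rank_in J (rk i) x)"
        using e by (auto simp: E_def forest_list_def[OF J])
      have "snd (fst e) \<in> set (fst (snd (snd J)))" and
        or: "snd (fst e) \<in> set (?rs ! i) \<or> fst e \<in> set (fst (snd (snd (snd J))))"
        using c(1)[OF i] e unfolding check_forest_def Let_def by blast+
      then have "sz (?f2 (snd (fst e))) \<le> s"
        using sz_mem[of "?f2 (snd (fst e))" "map ?f2 (fst (snd (snd J)))"] s(2) by auto
      moreover have "sz (map_prod ?f2 ?f2 (fst e)) \<le> s" if "snd (fst e) \<notin> set (?rs ! i)"
        using or that sz_mem[of "map_prod ?f2 ?f2 (fst e)" "map (map_prod ?f2 ?f2) (fst (snd (snd (snd J))))"] s(3) by auto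
      ultimately show ?thesis using x rank[of "rk i" x] by (auto split: if_splits)
    qed
    then have "sz (map (map_prod (map_prod ?f2 ?f2) (\<lambda>n. n)) (E i)) \<le> 1 + length (E i) * (4 * s + 3 + 1)"
      using sz_list_le[of "map (map_prod (map_prod ?f2 ?f2) (\<lambda>n. n)) (E i)" "4 * s + 3"] by fastforce
    also have "\<dots> \<le> 1 + s * (4 * s + 4)"
    proof -
      have "length (E i) \<le> s" using l by (simp add: E_def forest_list_def[OF J])
      then show ?thesis by (intro add_left_mono mult_le_mono) simp_all
    qed
    finally show ?thesis .
  qed
  let ?g = "map_prod (map ?f2) (map (map_prod (map_prod ?f2 ?f2) (\<lambda>n :: nat. n)))"
  have "sz (?g h) \<le> 1 + s + (1 + s * (4 * s + 4))" if h: "h \<in> set fs" for h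
  proof -
    obtain i where i: "i < length ?rs" "h = (?rs ! i, E i)" using h by (auto simp: fs_def)
    have "sz (map ?f2 (?rs ! i)) \<le> s"
      using sz_mem[of "map ?f2 (?rs ! i)" "map (map ?f2) ?rs"] i s(4) by auto
    then show ?thesis using E[OF i(1)] i(2) by simp
  qed
  then have 1: "sz (map ?g fs) \<le> 1 + k * (2 + s + (1 + s * (4 * s + 4)))"
    using sz_list_le[of "map ?g fs" "1 + s + (1 + s * (4 * s + 4))"] fs(1) k by fastforce
  define rl where "rl = map (map_prod nat_bits (\<lambda>n. n)) (map (\<lambda>v. (v, rank_in J rk' v)) (fst J))"
  have "sz y \<le> 3 * s + 2" if y: "y \<in> set rl" for y
  proof -
    obtain x where "x \<in> set (fst J)" "y = (nat_bits x, rank_in J rk' x)" using y by (auto simp: rl_def)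
    then show ?thesis using v[of x] rank[of rk' x] by simp
  qed
  then have "sz rl \<le> 1 + length rl * (3 * s + 2 + 1)" by (rule sz_list_le)
  also have "\<dots> \<le> 1 + s * (3 * s + 3)"
    using l by (intro add_left_mono mult_le_mono) (simp_all add: rl_def)
  finally have 2: "sz rl \<le> 1 + s * (3 * s + 3)" .
  have "map_certificate nat_bits n = (?I, map ?g fs, rl)"
    by (simp add: map_certificate_def Let_def n_def rl_def)
  then have "sz (map_certificate nat_bits n) \<le> 2 + s + (1 + k * (2 + s + (1 + s * (4 * s + 4)))) + (1 + s * (3 * s + 3))"
    using 1 2 s(5) by simp
  also have "\<dots> \<le> poly (certificate_bound k) (length (enc_instance J))"
    by (simp add: certificate_bound_def Let_def s_def algebra_simps)
  finally show ?thesis using chk by (intro exI[of _ n]) (simp add: n_def)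
qed

text \<open>Since the certificate contains the instance, the input need not be parsed: the guessed
  instance is encoded and compared with it. This also rejects inputs that encode nothing.\<close>

definition verify :: "nat \<Rightarrow> bool \<Rightarrow> bool \<Rightarrow> bool list \<times> bool list \<Rightarrow> bool" where
  "verify k b d z = (let c = map_certificate strip (of_tree (parse_tree (snd z))) in
     enc_instance_of enc_bits (fst c) = fst z \<and> binary_check k b d c)"

lemma pt_verify: "pt (verify k b d)"
proof -
  have "pt (of_tree :: tree \<Rightarrow> bool list certificate)" by (intro pt_intros)
  then have "pt (\<lambda>z :: bool list \<times> bool list. of_tree (parse_tree (snd z)) :: bool list certificate)"
    by (rule cp_comp[rotated]) (intro pt_intros)
  from cp_comp[OF this pt_map_certificate_strip]
  have c: "pt (\<lambda>z :: bool list \<times> bool list. map_certificate strip (of_tree (parse_tree (snd z))))" .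
  show ?thesis unfolding verify_def Let_def
    by (intro pt_intros cp_comp[OF cp_fst[OF c] pt_enc_instance_of[OF pt_enc_bits]] cp_comp[OF c pt_binary_check])
qed

lemma map_certificate_comp: "map_certificate f (map_certificate g c) = map_certificate (\<lambda>x. f (g x)) c"
  by (simp add: map_certificate_def map_instance_comp Let_def prod.map_comp comp_def map_prod_def split_def)

lemma fst_map_certificate: "fst (map_certificate f c) = map_instance f (fst c)"
  by (simp add: map_certificate_def Let_def)

lemma branchings_problem_NP: "enc_instance ` branchings_problem k b d \<in> NP"
proof (rule NP_I[OF pt_verify])
  fix x
  show "x \<in> enc_instance ` branchings_problem k b d \<longleftrightarrow>
    (\<exists>u. length u \<le> poly (certificate_bound k) (length x) \<and> verify k b d (x, u))"
  proof
    assume "x \<in> enc_instance ` branchings_problem k b d"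
    then obtain J where J: "J \<in> branchings_problem k b d" "x = enc_instance J" by blast
    from check_complete[OF J(1)] obtain n where n: "fst n = J" "check (\<le>) 0 1 2 k b d n"
      "sz (map_certificate nat_bits n) \<le> poly (certificate_bound k) (length x)" using J(2) by blast
    let ?u = "bits (tree_of (map_certificate nat_bits n))"
    have s: "strip (nat_bits m) = nat_bits m" for m by (simp flip: nat_bits_bits_value)
    have "map_certificate strip (of_tree (parse_tree ?u)) = map_certificate nat_bits n"
      by (simp add: parse_tree_bits map_certificate_comp s)
    then have "verify k b d (x, ?u)"
      using n J(2) by (simp add: verify_def binary_check_map fst_map_certificate enc_instance_map)
    then show "\<exists>u. length u \<le> poly (certificate_bound k) (length x) \<and> verify k b d (x, u)"
      using n(3) unfolding sz_def by blast
  next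
    assume "\<exists>u. length u \<le> poly (certificate_bound k) (length x) \<and> verify k b d (x, u)"
    then obtain u where u: "verify k b d (x, u)" by blast
    define n where "n = map_certificate bits_value (of_tree (parse_tree u))"
    have "map_certificate strip (of_tree (parse_tree u)) = map_certificate nat_bits n"
      by (simp add: n_def map_certificate_comp nat_bits_bits_value)
    with u have "enc_instance (fst n) = x" "check (\<le>) 0 1 2 k b d n"
      by (simp_all add: verify_def Let_def binary_check_map fst_map_certificate enc_instance_map)
    then show "x \<in> enc_instance ` branchings_problem k b d" using check_sound by blast
  qed
qed

lemma branchings_problem_NP_complete:
  assumes "1 \<le> k"
  shows "NP_complete (enc_instance ` branchings_problem k b d)"
proof -
  have "NP_hard (enc_instance ` branchings_problem k b d)"
  proof (rule NP_hardI[OF assms])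
    fix \<phi> assume "mv_wf \<phi>" "has_lifetime (tdigraph_of (reduced k \<phi>)) 2"
    then show "reduced k \<phi> \<in> branchings_problem k b d \<longleftrightarrow> mv_sat \<phi>"
      using has_disjoint_branchings_reduced[OF _ assms, of \<phi> "disjointness b"] reduced_instance[OF _ assms, of \<phi>]
        acyclic_reduced[of k \<phi>]
      by (auto simp: branchings_problem_def lifetime2_dag_def disjointness_def)
  qed
  then show ?thesis using branchings_problem_NP by (simp add: NP_complete_def)
qed

section \<open>Grouping the variables of a formula\<close>

type_synonym binary_cnf = "(bool \<times> bool list) list list"

text \<open>The formula with its variables as numerals. Unlike the verifier, the reduction from
  3-CNF is given nothing but an encoding and has to decode it.\<close>

definition binary_cnf :: "cnf \<Rightarrow> binary_cnf" where
  "binary_cnf F = map (map (map_prod (\<lambda>b. b) nat_bits)) F"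

definition enc_binary_cnf :: "binary_cnf \<Rightarrow> bool list" where
  "enc_binary_cnf = enc_list (enc_list (enc_pair enc_bit enc_bits))"

lemma enc_binary_cnf: "enc_binary_cnf (binary_cnf F) = enc_cnf F"
proof -
  have "enc_pair enc_bit enc_bits (map_prod (\<lambda>b. b) nat_bits l) = enc_pair enc_bit enc_nat l" for l
    by (simp add: enc_pair_def enc_nat_def)
  then show ?thesis by (simp add: enc_binary_cnf_def binary_cnf_def enc_cnf_def enc_list_map)
qed

text \<open>The states of the parser: 0 and 1 before an element of the list of clauses and of a clause,
  2 before a sign, 3 and 4 before a continuation bit and a digit of a variable, 5 at the end.\<close>

type_synonym parser_state = "nat \<times> binary_cnf \<times> (bool \<times> bool list) list \<times> bool \<times> bool list"

definition parse_step :: "bool \<Rightarrow> parser_state \<Rightarrow> parser_state" where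
  "parse_step b s =
    (let m = fst s; Cs = fst (snd s); C = fst (snd (snd s)); g = fst (snd (snd (snd s))); v = snd (snd (snd (snd s))) in
     if m = 0 then (if b then (1, Cs, C, g, v) else (5, Cs, C, g, v))
     else if m = 1 then (if b then (2, Cs, C, g, v) else (0, rev C # Cs, [], g, v))
     else if m = 2 then (3, Cs, C, b, [])
     else if m = 3 then (if b then (4, Cs, C, g, v) else (1, Cs, (g, rev v) # C, g, []))
     else if m = 4 then (3, Cs, C, g, b # v)
     else s)"

definition parse_cnf :: "bool list \<Rightarrow> binary_cnf" where
  "parse_cnf bs = rev (fst (snd (fold parse_step bs (0, [], [], False, []))))"

lemma parse_bits: "fold parse_step (enc_bits bs @ r) (3, Cs, C, g, v) = fold parse_step r (1, Cs, (g, rev v @ bs) # C, g, [])"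
  by (induction bs arbitrary: v) (auto simp: enc_list_simps enc_bit_def parse_step_def Let_def)

lemma parse_clause:
  "\<exists>g' v'. fold parse_step (enc_list (enc_pair enc_bit enc_bits) D @ r) (1, Cs, C, g, v) =
     fold parse_step r (0, (rev C @ D) # Cs, [], g', v')"
proof (induction D arbitrary: C g v)
  case Nil
  then show ?case by (auto simp: enc_list_simps parse_step_def Let_def)
next
  case (Cons l D)
  have "fold parse_step (enc_list (enc_pair enc_bit enc_bits) (l # D) @ r) (1, Cs, C, g, v) =
      fold parse_step (enc_bits (snd l) @ enc_list (enc_pair enc_bit enc_bits) D @ r) (3, Cs, C, fst l, [])"
    by (simp add: enc_list_simps enc_pair_def enc_bit_def parse_step_def Let_def)
  also have "\<dots> = fold parse_step (enc_list (enc_pair enc_bit enc_bits) D @ r) (1, Cs, l # C, fst l, [])"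
    by (simp only: parse_bits rev.simps append_Nil prod.collapse)
  finally show ?case using Cons.IH[of "l # C" "fst l" "[]"] by simp
qed

lemma parse_clauses:
  "fst (snd (fold parse_step (enc_binary_cnf F) (0, Cs, [], g, v))) = rev F @ Cs"
proof (induction F arbitrary: Cs g v)
  case Nil
  then show ?case by (auto simp: enc_binary_cnf_def enc_list_simps parse_step_def Let_def)
next
  case (Cons D F)
  have "fold parse_step (enc_binary_cnf (D # F)) (0, Cs, [], g, v) =
      fold parse_step (enc_list (enc_pair enc_bit enc_bits) D @ enc_binary_cnf F) (1, Cs, [], g, v)"
    by (simp add: enc_binary_cnf_def enc_list_simps parse_step_def Let_def)
  moreover obtain g' v' where "fold parse_step (enc_list (enc_pair enc_bit enc_bits) D @ enc_binary_cnf F) (1, Cs, [], g, v) =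
     fold parse_step (enc_binary_cnf F) (0, D # Cs, [], g', v')"
    using parse_clause[of D "enc_binary_cnf F" Cs "[]" g v] by auto
  ultimately show ?case using Cons.IH by simp
qed

lemma parse_cnf_enc: "parse_cnf (enc_cnf F) = binary_cnf F"
  by (simp add: parse_cnf_def parse_clauses flip: enc_binary_cnf)

lemma sz_numeral_le: "sz (5 :: nat) = 11" "sz (4 :: nat) = 9" "sz (3 :: nat) = 7" "sz (2 :: nat) = 5"
  by (simp_all add: sz_nat)

lemma cp_parse_cnf [pt_intros]:
  assumes "cp S f"
  shows "cp S (\<lambda>x. parse_cnf (f x))"
proof -
  have "cp S (\<lambda>x. fold parse_step (f x) (0, [], [], False, []))"
  proof (rule cp_fold_linear[where g = "\<lambda>_. 20"])
    show "pt (\<lambda>z :: 'a \<times> bool \<times> parser_state. parse_step (fst (snd z)) (snd (snd z)))"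
      unfolding parse_step_def Let_def by (intro pt_intros)
    show "sz (parse_step b s) \<le> sz s + 20" for b s
      by (cases s) (auto simp: parse_step_def Let_def sz_rev sz_numeral_le)
  qed (intro assms pb_intros cp_const cp_base[OF assms])+
  then show ?thesis unfolding parse_cnf_def by (intro pt_intros)
qed

definition dedup :: "'a list \<Rightarrow> 'a list" where
  "dedup xs = fold (\<lambda>x s. if x \<in> set s then s else x # s) xs []"

lemma dedup_fold:
  "distinct s \<Longrightarrow> distinct (fold (\<lambda>x s. if x \<in> set s then s else x # s) xs s) \<and>
     set (fold (\<lambda>x s. if x \<in> set s then s else x # s) xs s) = set xs \<union> set s"
  by (induction xs arbitrary: s) auto

lemma distinct_dedup: "distinct (dedup xs)" and set_dedup [simp]: "set (dedup xs) = set xs"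
  using dedup_fold[of "[]" xs] by (auto simp: dedup_def)

lemma cp_dedup [pt_intros]:
  assumes eq: "pt (\<lambda>z :: 'b::codable \<times> 'b. fst z = snd z)" and f: "cp S f"
  shows "cp S (\<lambda>x. dedup (f x :: 'b list))"
  unfolding dedup_def
proof (rule cp_fold_linear[where g = "\<lambda>z. 1 + sz (snd z)"])
  show "pt (\<lambda>z :: 'a \<times> 'b \<times> 'b list. if fst (snd z) \<in> set (snd (snd z)) then snd (snd z) else fst (snd z) # snd (snd z))"
    by (intro pt_intros eq)
  show "pb sz (\<lambda>z :: 'a \<times> 'b. 1 + sz (snd z))" by (intro pb_intros pb_sz_snd)
qed (auto intro!: f cp_const cp_base[OF f])

text \<open>Duplicates must go, because the exponent is measured in the number of distinct
  variables.\<close>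

definition variables :: "binary_cnf \<Rightarrow> bool list list" where
  "variables F = dedup (map (\<lambda>l. snd l) (concat F))"

lemma cp_variables [pt_intros]: "cp S f \<Longrightarrow> cp S (\<lambda>x. variables (f x))"
  unfolding variables_def by (intro pt_intros)

text \<open>A group consists of variables and of all assignments to them, given by their sets of true
  variables. The variables are dealt to the groups in turn.\<close>

type_synonym group = "bool list list \<times> bool list list list"

definition deal :: "bool list \<Rightarrow> group list \<Rightarrow> group list" where
  "deal x gs = tl gs @ [(x # fst (hd gs), snd (hd gs) @ map (\<lambda>a. x # a) (snd (hd gs)))]"

text \<open>With \<open>Suc Q\<close> groups there is at least one, whatever \<open>Q\<close>
  is.\<close>

definition groups :: "nat \<Rightarrow> bool list list \<Rightarrow> group list" where
  "groups Q xs = fold deal xs (replicate (Suc Q) ([], [[]]))"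

definition group_ok :: "group \<Rightarrow> bool" where
  "group_ok g \<longleftrightarrow> length (snd g) = 2 ^ length (fst g) \<and>
     (\<forall>a \<in> set (snd g). set a \<subseteq> set (fst g) \<and> length a \<le> length (fst g)) \<and>
     (\<forall>A \<subseteq> set (fst g). \<exists>a \<in> set (snd g). set a = A)"

lemma group_ok_insert:
  assumes "group_ok g"
  shows "group_ok (x # fst g, snd g @ map (\<lambda>a. x # a) (snd g))"
proof -
  have "\<exists>a \<in> set (snd g) \<union> (\<lambda>a. x # a) ` set (snd g). set a = A" if A: "A \<subseteq> insert x (set (fst g))" for A
  proof (cases "x \<in> A")
    case True
    have "A - {x} \<subseteq> set (fst g)" using A by blast
    then obtain a where "a \<in> set (snd g)" "set a = A - {x}" using assms unfolding group_ok_def by metis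
    then show ?thesis using True by (intro bexI[of _ "x # a"]) auto
  next
    case False
    then have "A \<subseteq> set (fst g)" using A by blast
    then show ?thesis using assms unfolding group_ok_def by blast
  qed
  moreover have "set a \<subseteq> set (fst g) \<and> length a \<le> length (fst g)" if "a \<in> set (snd g)" for a
    using assms that by (auto simp: group_ok_def)
  moreover have "length (snd g) = 2 ^ length (fst g)" using assms by (simp add: group_ok_def)
  ultimately show ?thesis unfolding group_ok_def by (auto simp: le_SucI) (meson le_SucI subsetD)+
qed

text \<open>Dealing rotates the list: the head receives a variable and goes to the end. Hence
  position \<open>i\<close> holds the group that is next after the remaining ones before it, and its
  size is the rounded quotient with offset \<open>i\<close>.\<close>

lemma groups_invariant:
  "length (groups Q xs) = Suc Q \<and> (\<forall>g \<in> set (groups Q xs). group_ok g) \<and>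
   (\<Union>g \<in> set (groups Q xs). set (fst g)) = set xs \<and>
   (\<forall>i \<le> Q. length (fst (groups Q xs ! i)) = (length xs + i) div Suc Q)"
proof (induction xs rule: rev_induct)
  case Nil
  have "(\<Union>g \<in> set (replicate (Suc Q) (([], [[]]) :: group)). set (fst g)) = {}" by auto
  moreover have "length (fst (replicate (Suc Q) (([], [[]]) :: group) ! i)) = i div Suc Q" if "i \<le> Q" for i
    using that by (simp del: replicate_Suc)
  ultimately show ?case by (auto simp: groups_def group_ok_def simp del: replicate_Suc)
next
  case (snoc x xs)
  let ?gs = "groups Q xs"
  obtain g gs where gs: "?gs = g # gs" using snoc by (cases ?gs) auto
  have new: "groups Q (xs @ [x]) = gs @ [(x # fst g, snd g @ map (\<lambda>a. x # a) (snd g))]"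
    using gs by (simp add: groups_def deal_def)
  have len: "length gs = Q" using snoc gs by simp
  have "length (fst (groups Q (xs @ [x]) ! i)) = (length (xs @ [x]) + i) div Suc Q" if i: "i \<le> Q" for i
  proof (cases "i < Q")
    case True
    then have "groups Q (xs @ [x]) ! i = ?gs ! Suc i" using len by (simp add: new gs nth_append)
    moreover have "length (fst (?gs ! Suc i)) = (length xs + Suc i) div Suc Q"
      using snoc True by (metis Suc_leI)
    ultimately show ?thesis by simp
  next
    case False
    then have i: "i = Q" using i by simp
    have "length (fst g) = length xs div Suc Q" using snoc gs by (metis add.right_neutral nth_Cons_0 le0)
    moreover have "(length (xs @ [x]) + Q) div Suc Q = (length xs + Suc Q) div Suc Q" by simp
    moreover have "\<dots> = length xs div Suc Q + 1" by (subst div_add_self2) auto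
    ultimately show ?thesis using len i by (simp add: new nth_append)
  qed
  moreover have "\<forall>h \<in> set (groups Q (xs @ [x])). group_ok h"
    using snoc gs group_ok_insert[of g x] by (auto simp: new)
  moreover have "(\<Union>h \<in> set (groups Q (xs @ [x])). set (fst h)) = set (xs @ [x])"
    using snoc gs by (auto simp: new)
  ultimately show ?case using len by (auto simp: new)
qed

lemma group_length:
  assumes "g \<in> set (groups Q xs)"
  shows "length (fst g) \<le> length xs div Suc Q + 1"
proof -
  obtain i where i: "i \<le> Q" "g = groups Q xs ! i"
    using assms groups_invariant[of Q xs] by (metis in_set_conv_nth less_Suc_eq_le)
  then have "length (fst g) = (length xs + i) div Suc Q" using groups_invariant[of Q xs] by blast
  also have "\<dots> \<le> (length xs + Suc Q) div Suc Q" using i by (intro div_le_mono) simp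
  also have "\<dots> = length xs div Suc Q + 1" by (subst div_add_self2) auto
  finally show ?thesis .
qed

text \<open>Listing all assignments to a group is not polynomial in the input. The budget adds a
  bound on their number; all later constructions, including the triples, are polynomial in
  it.\<close>

definition group_budget :: "bool list \<times> nat \<Rightarrow> nat" where
  "group_budget z = sz z + 2 ^ (length (variables (parse_cnf (fst z))) div Suc (snd z) + 1)"

lemma sz_groups:
  assumes "\<And>x. x \<in> set xs \<Longrightarrow> sz x \<le> b"
  shows "sz (groups Q xs) \<le> 1 + Suc Q * (3 + (1 + length xs * (b + 1)) +
    (2 ^ (length xs div Suc Q + 1)) * (1 + length xs * (b + 1) + 1))"
proof -
  have inv: "length (groups Q xs) = Suc Q" "\<And>g. g \<in> set (groups Q xs) \<Longrightarrow> group_ok g"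
    "(\<Union>g \<in> set (groups Q xs). set (fst g)) = set xs"
    using groups_invariant[of Q xs] by auto
  let ?L = "length xs"
  have "sz g \<le> 2 + (1 + ?L * (b + 1)) + (2 ^ (?L div Suc Q + 1)) * (1 + ?L * (b + 1) + 1)"
    if g: "g \<in> set (groups Q xs)" for g
  proof -
    have ok: "group_ok g" by (rule inv(2)[OF g])
    have l: "length (fst g) \<le> ?L"
    proof -
      obtain i where i: "i \<le> Q" "g = groups Q xs ! i"
        using g inv(1) by (metis in_set_conv_nth less_Suc_eq_le)
      then have "length (fst g) = (?L + i) div Suc Q" using groups_invariant[of Q xs] by blast
      also have "\<dots> \<le> ?L"
      proof (cases "?L = 0")
        case True
        then show ?thesis using i by simp
      next
        case False
        have "(?L + i) div Suc Q \<le> (?L + Q) div Suc Q" using i by (intro div_le_mono) simp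
        also have "\<dots> \<le> (?L * Suc Q) div Suc Q"
          using False by (intro div_le_mono) (cases ?L, auto)
        also have "\<dots> = ?L" by (rule nonzero_mult_div_cancel_right) simp
        finally show ?thesis .
      qed
      finally show ?thesis .
    qed
    have s: "sz ys \<le> 1 + ?L * (b + 1)" if "set ys \<subseteq> set (fst g)" "length ys \<le> length (fst g)" for ys
    proof -
      have "sz y \<le> b" if "y \<in> set ys" for y
        using that \<open>set ys \<subseteq> _\<close> g inv(3) by (intro assms) blast
      then have "sz ys \<le> 1 + length ys * (b + 1)" by (rule sz_list_le)
      also have "\<dots> \<le> 1 + ?L * (b + 1)" using \<open>length ys \<le> _\<close> l by (intro add_left_mono mult_le_mono) auto
      finally show ?thesis .
    qed
    have "sz a \<le> 1 + ?L * (b + 1)" if "a \<in> set (snd g)" for a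
      using ok that by (intro s) (auto simp: group_ok_def)
    then have "sz (snd g) \<le> 1 + length (snd g) * (1 + ?L * (b + 1) + 1)" by (rule sz_list_le)
    also have "\<dots> \<le> 1 + 2 ^ (?L div Suc Q + 1) * (1 + ?L * (b + 1) + 1)"
    proof (intro add_left_mono mult_le_mono order_refl)
      have "length (snd g) = 2 ^ length (fst g)" using ok by (simp add: group_ok_def)
      then show "length (snd g) \<le> 2 ^ (?L div Suc Q + 1)"
        using power_increasing[OF group_length[OF g], of "2 :: nat"] by simp
    qed
    finally have "sz (snd g) \<le> 1 + 2 ^ (?L div Suc Q + 1) * (1 + ?L * (b + 1) + 1)" .
    moreover have "sz (fst g) \<le> 1 + ?L * (b + 1)" by (intro s) auto
    ultimately show ?thesis by (cases g) simp
  qed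
  then have "sz (groups Q xs) \<le> 1 + length (groups Q xs) *
      (2 + (1 + ?L * (b + 1)) + (2 ^ (?L div Suc Q + 1)) * (1 + ?L * (b + 1) + 1) + 1)" by (rule sz_list_le)
  then show ?thesis by (simp add: inv(1) algebra_simps)
qed

lemma cp_mono:
  assumes f: "cp S f" and S: "\<And>x. S x \<le> S' x"
  shows "cp S' f"
proof -
  obtain P c where P: "regs P \<subseteq> {2, 3, 4, 5}"
    "\<And>x s r. clean s \<Longrightarrow> s 2 = bits (tree_of x) @ r \<Longrightarrow> exec P s ((S x + 2) ^ c) (s(2 := bits (tree_of (f x)) @ r))"
    using f unfolding cp_def by blast
  have "exec P s ((S' x + 2) ^ c) (s(2 := bits (tree_of (f x)) @ r))" if "clean s" "s 2 = bits (tree_of x) @ r" for x s r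
    using exec_mono[OF P(2)[OF that]] S[of x] by (meson add_le_mono1 power_mono zero_le)
  moreover have "sz x \<le> S' x" for x using cp_base[OF f, of x] S[of x] by linarith
  ultimately show ?thesis using P(1) unfolding cp_def by blast
qed

lemma cp_groups: "cp group_budget (\<lambda>z. groups (snd z) (variables (parse_cnf (fst z))))"
proof -
  have up: "cp group_budget f" if "pt f" for f :: "bool list \<times> nat \<Rightarrow> 'c::codable"
    by (rule cp_mono[OF that]) (simp add: group_budget_def)
  let ?xs = "\<lambda>z :: bool list \<times> nat. variables (parse_cnf (fst z))"
  let ?B = "\<lambda>z. 1 + Suc (snd z) * (3 + (1 + length (?xs z) * (sz (?xs z) + 1)) +
    (2 ^ (length (?xs z) div Suc (snd z) + 1)) * (1 + length (?xs z) * (sz (?xs z) + 1) + 1))"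
  have xs: "pt ?xs" by (intro pt_intros)
  show ?thesis unfolding groups_def
  proof (rule cp_fold[where B = ?B])
    show "pt (\<lambda>z :: (bool list \<times> nat) \<times> bool list \<times> group list. deal (fst (snd z)) (snd (snd z)))"
      unfolding deal_def by (intro pt_intros)
    show "cp group_budget ?xs" by (rule up[OF xs])
    show "cp group_budget (\<lambda>z. replicate (Suc (snd z)) ([], [[]]) :: group list)" by (intro up pt_intros)
    have "pb group_budget (\<lambda>z. 2 ^ (length (?xs z) div Suc (snd z) + 1))"
      by (rule pb_mono[OF pb_self]) (simp add: group_budget_def)
    moreover have "pb group_budget (\<lambda>z. Suc (snd z))"
      by (rule pb_mono[OF pb_add[OF pb_self pb_const[of _ 1]]]) (auto simp: group_budget_def sz_nat)
    ultimately show "pb group_budget ?B"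
      by (intro pb_intros pb_length[OF up[OF xs]] pb_sz[OF up[OF xs]])
    fix z n assume n: "n \<le> length (?xs z)"
    let ?ys = "take n (?xs z)"
    have "sz x \<le> sz (?xs z)" if "x \<in> set ?ys" for x
      using that by (auto dest: in_set_takeD intro: sz_mem)
    then have "sz (groups (snd z) ?ys) \<le> 1 + Suc (snd z) * (3 + (1 + length ?ys * (sz (?xs z) + 1)) +
      (2 ^ (length ?ys div Suc (snd z) + 1)) * (1 + length ?ys * (sz (?xs z) + 1) + 1))" by (rule sz_groups)
    also have "\<dots> \<le> ?B z"
      by (intro add_mono mult_le_mono order_refl power_increasing div_le_mono) auto
    finally show "sz (fold deal (take n (?xs z)) (replicate (Suc (snd z)) ([], [[]]))) \<le> ?B z"
      unfolding groups_def .
  qed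
qed

section \<open>Three-literal formulas with few variables\<close>

definition variable_name :: "bool list \<Rightarrow> bool list" where
  "variable_name x = False # x"

definition group_name :: "group \<Rightarrow> bool list" where
  "group_name m = True # enc_pair (enc_list enc_bits) (enc_list (enc_list enc_bits)) m"

definition group_value :: "bool list list \<Rightarrow> bool list" where
  "group_value a = enc_list enc_bits a"

definition locally_true :: "binary_cnf \<Rightarrow> bool list list \<Rightarrow> bool list list \<Rightarrow> bool" where
  "locally_true F V a \<longleftrightarrow> (\<forall>C \<in> set F. (\<forall>l \<in> set C. snd l \<in> set V) \<longrightarrow> (\<exists>l \<in> set C. (snd l \<in> set a) = fst l))"

text \<open>The groups need not be distinct, so that clauses meeting fewer than three groups are
  covered. If a group occurs twice, the union of two sets of true variables is again an assignment
  to it.\<close>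

definition triple :: "binary_cnf \<Rightarrow> group \<Rightarrow> group \<Rightarrow> group \<Rightarrow> group" where
  "triple F g1 g2 g3 = (fst g1 @ fst g2 @ fst g3,
     filter (\<lambda>a. locally_true F (fst g1 @ fst g2 @ fst g3) a)
       (concat (map (\<lambda>a1. concat (map (\<lambda>a2. map (\<lambda>a3. a1 @ a2 @ a3) (snd g3)) (snd g2))) (snd g1))))"

definition triples :: "binary_cnf \<Rightarrow> group list \<Rightarrow> group list" where
  "triples F gs = concat (map (\<lambda>g1. concat (map (\<lambda>g2. map (\<lambda>g3. triple F g1 g2 g3) gs) gs)) gs)"

text \<open>Taken for both \<open>b\<close>, the clauses say that \<open>x\<close> has the value
  given to it by the value of \<open>m\<close>: for that \<open>b\<close>, all literals on
  \<open>m\<close> fail. However many literals there are, they concern just two variables, so that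
  the clause contributes at most two arcs to the digraph.\<close>

definition consistency_clause :: "group \<Rightarrow> bool list \<Rightarrow> bool \<Rightarrow> literal list" where
  "consistency_clause m x b = (variable_name x, truth_value b) #
     map (\<lambda>a. (group_name m, group_value a)) (filter (\<lambda>a. (x \<in> set a) \<noteq> b) (snd m))"

text \<open>The clauses of the original formula are checked inside the triples of groups, so that the number
  of clauses of the multivalued formula is linear in the number of variables.\<close>

definition grouped_formula :: "binary_cnf \<times> group list \<Rightarrow> mv_formula" where
  "grouped_formula z = (let F = fst z; M = triples F (snd z); xs = variables F in
     (map (\<lambda>x. variable_name x) xs @ map (\<lambda>m. group_name m) M,
      concat (map (\<lambda>x. [(variable_name x, truth_value False), (variable_name x, truth_value True)]) xs) @
        concat (map (\<lambda>m. map (\<lambda>a. (group_name m, group_value a)) (snd m)) M),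
      concat (map (\<lambda>m. concat (map (\<lambda>x. map (\<lambda>b. consistency_clause m x b) [False, True]) (fst m))) M)))"

lemma pt_grouped_formula: "pt grouped_formula"
  unfolding grouped_formula_def triples_def triple_def locally_true_def consistency_clause_def
    variable_name_def group_name_def group_value_def truth_value_def Let_def
  by (intro pt_intros cp_comp[OF _ pt_enc_bits] cp_comp[OF _ pt_enc_list[OF pt_enc_bits]]
      cp_comp[OF _ pt_enc_pair[OF pt_enc_list[OF pt_enc_bits] pt_enc_list[OF pt_enc_list[OF pt_enc_bits]]]])

lemma names_inj [simp]:
  "variable_name x = variable_name y \<longleftrightarrow> x = y" "group_name m = group_name m' \<longleftrightarrow> m = m'"
  "group_value a = group_value a' \<longleftrightarrow> a = a'" "variable_name x \<noteq> group_name m" "group_name m \<noteq> variable_name x"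
  using prefix_free_inj[OF prefix_free_enc_pair[OF prefix_free_enc_list[OF prefix_free_enc_bits]
        prefix_free_enc_list[OF prefix_free_enc_list[OF prefix_free_enc_bits]]]]
    prefix_free_inj[OF prefix_free_enc_list[OF prefix_free_enc_bits]]
  by (auto simp: variable_name_def group_name_def group_value_def inj_eq)

lemma in_triples:
  assumes "m \<in> set (triples F (groups Q (variables F)))"
  shows "set (fst m) \<subseteq> set (variables F)" "a \<in> set (snd m) \<Longrightarrow> locally_true F (fst m) a"
    "length (fst m) \<le> 3 * (length (variables F) + 1)"
    "(\<And>C. C \<in> set F \<Longrightarrow> \<exists>l \<in> set C. \<alpha> (snd l) = fst l) \<Longrightarrow>
      \<exists>a \<in> set (snd m). \<forall>x \<in> set (fst m). x \<in> set a \<longleftrightarrow> \<alpha> x"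
proof -
  let ?gs = "groups Q (variables F)"
  obtain g1 g2 g3 where g: "g1 \<in> set ?gs" "g2 \<in> set ?gs" "g3 \<in> set ?gs" and m: "m = triple F g1 g2 g3"
    using assms by (auto simp: triples_def)
  have ok: "group_ok g1" "group_ok g2" "group_ok g3" and un: "(\<Union>g \<in> set ?gs. set (fst g)) = set (variables F)"
    using groups_invariant[of Q "variables F"] g by auto
  show "set (fst m) \<subseteq> set (variables F)" using g un by (auto simp: m triple_def)
  show "locally_true F (fst m) a" if "a \<in> set (snd m)" using that by (simp add: m triple_def)
  have "length (fst g) \<le> length (variables F) + 1" if "g \<in> set ?gs" for g
    using group_length[OF that] div_le_dividend[of "length (variables F)" "Suc Q"] by linarith
  from this[OF g(1)] this[OF g(2)] this[OF g(3)]
  show "length (fst m) \<le> 3 * (length (variables F) + 1)" by (simp add: m triple_def)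
  assume true: "\<And>C. C \<in> set F \<Longrightarrow> \<exists>l \<in> set C. \<alpha> (snd l) = fst l"
  have "\<exists>a \<in> set (snd g). set a = {x \<in> set (fst g). \<alpha> x}" if "group_ok g" for g
    using that unfolding group_ok_def by auto
  then obtain a1 a2 a3 where a: "a1 \<in> set (snd g1)" "set a1 = {x \<in> set (fst g1). \<alpha> x}"
    "a2 \<in> set (snd g2)" "set a2 = {x \<in> set (fst g2). \<alpha> x}"
    "a3 \<in> set (snd g3)" "set a3 = {x \<in> set (fst g3). \<alpha> x}" using ok by meson
  let ?a = "a1 @ a2 @ a3"
  have eq: "x \<in> set ?a \<longleftrightarrow> \<alpha> x" if "x \<in> set (fst m)" for x using that a by (auto simp: m triple_def)
  have "locally_true F (fst m) ?a"
    unfolding locally_true_def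
  proof (intro ballI impI)
    fix C assume C: "C \<in> set F" "\<forall>l \<in> set C. snd l \<in> set (fst m)"
    from true[OF C(1)] obtain l where l: "l \<in> set C" "\<alpha> (snd l) = fst l" by blast
    then show "\<exists>l \<in> set C. (snd l \<in> set ?a) = fst l" using eq C(2) by blast
  qed
  then have "?a \<in> set (snd m)" using a(1,3,5) by (auto simp: m triple_def)
  with eq show "\<exists>a \<in> set (snd m). \<forall>x \<in> set (fst m). x \<in> set a \<longleftrightarrow> \<alpha> x" by blast
qed

lemma triple_in_triples:
  "g1 \<in> set gs \<Longrightarrow> g2 \<in> set gs \<Longrightarrow> g3 \<in> set gs \<Longrightarrow> triple F g1 g2 g3 \<in> set (triples F gs)"
  unfolding triples_def by simp (rule bexI[of _ g1], rule bexI[of _ g2], rule imageI)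

text \<open>At most three literals lie in at most three groups; this is the reason for taking
  triples.\<close>

lemma clause_in_triple:
  assumes "C \<in> set F" "length C \<le> 3"
  shows "\<exists>m \<in> set (triples F (groups Q (variables F))). \<forall>l \<in> set C. snd l \<in> set (fst m)"
proof -
  let ?gs = "groups Q (variables F)"
  have ne: "?gs \<noteq> []" and un: "(\<Union>g \<in> set ?gs. set (fst g)) = set (variables F)"
    using groups_invariant[of Q "variables F"] by auto
  have "\<exists>g. g \<in> set ?gs \<and> (l \<in> set C \<longrightarrow> snd l \<in> set (fst g))" for l
  proof (cases "l \<in> set C")
    case True
    then have "snd l \<in> set (variables F)" using assms(1) by (force simp: variables_def)
    then show ?thesis unfolding un[symmetric] by blast
  next
    case False
    then show ?thesis using ne by (metis list.set_sel(1))
  qed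
  then obtain G where G: "\<And>l. G l \<in> set ?gs \<and> (l \<in> set C \<longrightarrow> snd l \<in> set (fst (G l)))" by metis
  obtain l1 l2 l3 where "set C \<subseteq> {l1, l2, l3}"
  proof (cases C)
    case (Cons l1 C1)
    show ?thesis
    proof (cases C1)
      case (Cons l2 C2)
      then show ?thesis using that[of l1 l2 "hd C2"] \<open>C = _\<close> assms(2) by (cases C2) auto
    qed (use that[of l1 l1 l1] Cons in auto)
  qed (use that in auto)
  then have "\<forall>l \<in> set C. snd l \<in> set (fst (triple F (G l1) (G l2) (G l3)))"
    using G by (fastforce simp: triple_def)
  moreover have "triple F (G l1) (G l2) (G l3) \<in> set (triples F ?gs)"
    using G by (intro triple_in_triples) auto
  ultimately show ?thesis by blast
qed

context
  fixes F :: binary_cnf and Q :: nat and \<phi> :: mv_formula and M :: "group list"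
  defines "M \<equiv> triples F (groups Q (variables F))" and "\<phi> \<equiv> grouped_formula (F, groups Q (variables F))"
begin

lemma grouped_simps:
  "fst \<phi> = map variable_name (variables F) @ map group_name M"
  "set (fst (snd \<phi>)) = {(variable_name x, truth_value b) | x b. x \<in> set (variables F)} \<union>
     {(group_name m, group_value a) | m a. m \<in> set M \<and> a \<in> set (snd m)}"
  "set (snd (snd \<phi>)) = {consistency_clause m x b | m x b. m \<in> set M \<and> x \<in> set (fst m)}"
proof -
  have tv: "truth_value b = truth_value False \<or> truth_value b = truth_value True" for b by (cases b) auto
  show "fst \<phi> = map variable_name (variables F) @ map group_name M"
    by (simp add: \<phi>_def M_def grouped_formula_def Let_def)
  show "set (fst (snd \<phi>)) = {(variable_name x, truth_value b) | x b. x \<in> set (variables F)} \<union>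
     {(group_name m, group_value a) | m a. m \<in> set M \<and> a \<in> set (snd m)}"
    using tv by (auto simp: \<phi>_def M_def grouped_formula_def Let_def)
  have "set (snd (snd \<phi>)) = (\<Union>m \<in> set M. \<Union>x \<in> set (fst m). consistency_clause m x ` UNIV)"
    by (simp add: \<phi>_def M_def grouped_formula_def Let_def UNIV_bool)
  also have "\<dots> = {consistency_clause m x b | m x b. m \<in> set M \<and> x \<in> set (fst m)}" by blast
  finally show "set (snd (snd \<phi>)) = {consistency_clause m x b | m x b. m \<in> set M \<and> x \<in> set (fst m)}" .
qed

lemma mv_wf_grouped: "mv_wf \<phi>"
  unfolding mv_wf_def
proof (intro conjI ballI)
  show "fst ` set (fst (snd \<phi>)) \<subseteq> set (fst \<phi>)"
    unfolding grouped_simps by auto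
  fix C assume "C \<in> set (snd (snd \<phi>))"
  then obtain m x b where C: "m \<in> set M" "x \<in> set (fst m)" "C = consistency_clause m x b"
    unfolding grouped_simps by blast
  then have x: "x \<in> set (variables F)" using in_triples(1)[of m F Q] unfolding M_def by blast
  show "set C \<subseteq> set (fst (snd \<phi>))"
  proof
    fix l assume "l \<in> set C"
    then consider "l = (variable_name x, truth_value b)" | a where "a \<in> set (snd m)" "l = (group_name m, group_value a)"
      by (auto simp: C(3) consistency_clause_def)
    then show "l \<in> set (fst (snd \<phi>))" unfolding grouped_simps using C(1) x by cases blast+
  qed
qed

lemma mv_sat_grouped:
  assumes "\<forall>C \<in> set F. length C \<le> 3"
  shows "mv_sat \<phi> \<longleftrightarrow> (\<exists>\<alpha>. \<forall>C \<in> set F. \<exists>l \<in> set C. \<alpha> (snd l) = fst l)"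
proof
  assume "mv_sat \<phi>"
  then obtain \<tau> where t1: "\<And>i. i \<in> set (fst \<phi>) \<Longrightarrow> (i, \<tau> i) \<in> set (fst (snd \<phi>))"
    and t2: "\<And>C. C \<in> set (snd (snd \<phi>)) \<Longrightarrow> \<exists>l \<in> set C. \<tau> (fst l) = snd l" unfolding mv_sat_def by blast
  let ?\<alpha> = "\<lambda>x. \<tau> (variable_name x) = truth_value True"
  have "\<exists>l \<in> set C. ?\<alpha> (snd l) = fst l" if C: "C \<in> set F" for C
  proof -
    obtain m where m: "m \<in> set M" "\<forall>l \<in> set C. snd l \<in> set (fst m)"
      using clause_in_triple[OF C, of Q] assms C unfolding M_def by blast
    have "group_name m \<in> set (fst \<phi>)" using m(1) by (simp add: grouped_simps)
    from t1[OF this] obtain a where a: "a \<in> set (snd m)" "\<tau> (group_name m) = group_value a"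
      unfolding grouped_simps by auto
    have eq: "?\<alpha> x \<longleftrightarrow> x \<in> set a" if "x \<in> set (fst m)" for x
    proof -
      \<comment> \<open>With this choice of \<open>b\<close> the literals on \<open>m\<close> name
        only values other than \<open>a\<close>, so that the literal on \<open>x\<close> must
        hold.\<close>
      have "consistency_clause m x (x \<in> set a) \<in> set (snd (snd \<phi>))" using m(1) that unfolding grouped_simps by blast
      from t2[OF this] a(2) have "\<tau> (variable_name x) = truth_value (x \<in> set a)"
        by (auto simp: consistency_clause_def)
      then show ?thesis by simp
    qed
    have "locally_true F (fst m) a" using in_triples(2)[of m F Q] m(1) a(1) unfolding M_def by blast
    then have "\<exists>l \<in> set C. (snd l \<in> set a) = fst l" using C m(2) unfolding locally_true_def by blast
    then obtain l where l: "l \<in> set C" "(snd l \<in> set a) = fst l" by blast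
    have "?\<alpha> (snd l) = fst l" using eq[of "snd l"] m(2) l by simp
    with l(1) show ?thesis by (rule bexI[rotated])
  qed
  then show "\<exists>\<alpha>. \<forall>C \<in> set F. \<exists>l \<in> set C. \<alpha> (snd l) = fst l" by (intro exI[of _ ?\<alpha>] ballI)
next
  assume "\<exists>\<alpha>. \<forall>C \<in> set F. \<exists>l \<in> set C. \<alpha> (snd l) = fst l"
  then obtain \<alpha> where \<alpha>: "\<And>C. C \<in> set F \<Longrightarrow> \<exists>l \<in> set C. \<alpha> (snd l) = fst l" by blast
  have "\<exists>a. m \<in> set M \<longrightarrow> a \<in> set (snd m) \<and> (\<forall>x \<in> set (fst m). x \<in> set a \<longleftrightarrow> \<alpha> x)" for m
  proof (cases "m \<in> set M")
    case True
    from in_triples(4)[OF True[unfolded M_def], of \<alpha>] \<alpha> show ?thesis by blast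
  qed simp
  then obtain A where A: "\<And>m. m \<in> set M \<Longrightarrow> A m \<in> set (snd m)"
    "\<And>m x. m \<in> set M \<Longrightarrow> x \<in> set (fst m) \<Longrightarrow> x \<in> set (A m) \<longleftrightarrow> \<alpha> x" by metis
  have inv: "inv variable_name (variable_name x) = x" "inv group_name (group_name m) = m" for x m
    by (intro inv_f_f injI, simp)+
  define \<tau> where "\<tau> i = (if i \<in> range variable_name then truth_value (\<alpha> (inv variable_name i))
    else group_value (A (inv group_name i)))" for i
  have t: "\<tau> (variable_name x) = truth_value (\<alpha> x)" "\<tau> (group_name m) = group_value (A m)" for x m
    by (auto simp: \<tau>_def inv)
  show "mv_sat \<phi>"
    unfolding mv_sat_def
  proof (intro exI[of _ \<tau>] conjI ballI)
    fix i assume "i \<in> set (fst \<phi>)"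
    then show "(i, \<tau> i) \<in> set (fst (snd \<phi>))" unfolding grouped_simps using A(1) t by auto
  next
    fix C assume "C \<in> set (snd (snd \<phi>))"
    then obtain m x b where C: "m \<in> set M" "x \<in> set (fst m)" "C = consistency_clause m x b"
      unfolding grouped_simps by blast
    show "\<exists>l \<in> set C. \<tau> (fst l) = snd l"
      using A(1)[OF C(1)] A(2)[OF C(1,2)] by (cases "\<alpha> x = b") (auto simp: C(3) consistency_clause_def t)
  qed
qed

text \<open>There are \<open>Suc Q ^ 3\<close> triples with at most \<open>3 * (n + 1)\<close>
  variables each, two clauses for each of these and two arcs for each clause. The estimates are
  generous because only linearity in the number of variables matters for fixed
  \<open>Q\<close>.\<close>

lemma order_plus_size_grouped:
  "order_plus_size (reduced k \<phi>) \<le> 20 * Suc Q ^ 3 * (length (variables F) + 1)"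
proof -
  let ?n = "length (variables F)"
  have lM: "length M = Suc Q ^ 3"
    using groups_invariant[of Q "variables F"]
    by (simp add: M_def triples_def length_concat comp_def sum_list_triv power3_eq_cube)
  have "length (snd (snd \<phi>)) = (\<Sum>m \<leftarrow> M. 2 * length (fst m))"
    by (simp add: \<phi>_def M_def grouped_formula_def Let_def length_concat comp_def sum_list_triv mult_2)
  also have "\<dots> \<le> (\<Sum>m \<leftarrow> M. 6 * (?n + 1))"
    using in_triples(3)[of _ F Q] unfolding M_def by (intro sum_list_mono) fastforce
  also have "\<dots> = Suc Q ^ 3 * (6 * (?n + 1))" by (simp add: sum_list_triv lM)
  finally have lC: "card (set (snd (snd \<phi>))) \<le> Suc Q ^ 3 * (6 * (?n + 1))"
    using card_length[of "snd (snd \<phi>)"] by linarith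
  have "card (pverts (dg (tdigraph_of (reduced k \<phi>)))) \<le>
      card (source_vertex ` set (fst \<phi>)) + card (clause_vertex ` set (snd (snd \<phi>)))"
    unfolding reduced_graph by (rule card_Un_le)
  also have "\<dots> \<le> length (fst \<phi>) + card (set (snd (snd \<phi>)))"
    by (intro add_mono card_image_le order_trans[OF card_image_le card_length]) auto
  also have "length (fst \<phi>) = ?n + Suc Q ^ 3" by (simp add: grouped_simps lM)
  finally have v: "card (pverts (dg (tdigraph_of (reduced k \<phi>)))) \<le> ?n + Suc Q ^ 3 + Suc Q ^ 3 * (6 * (?n + 1))"
    using lC by linarith
  let ?arcs = "\<lambda>C. (\<lambda>l. (source_vertex (fst l), clause_vertex C)) ` set C"
  have two: "card (?arcs C) \<le> 2" if CC: "C \<in> set (snd (snd \<phi>))" for C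
  proof -
    obtain m x b where C: "C = consistency_clause m x b" using CC unfolding grouped_simps by blast
    have "?arcs C \<subseteq> {(source_vertex (variable_name x), clause_vertex C), (source_vertex (group_name m), clause_vertex C)}"
      by (auto simp: C consistency_clause_def)
    from card_mono[OF _ this] show ?thesis by (rule order_trans) (auto simp: card_insert_if)
  qed
  have "parcs (dg (tdigraph_of (reduced k \<phi>))) = (\<Union>C \<in> set (snd (snd \<phi>)). ?arcs C)"
    unfolding reduced_graph by (force simp: clause_literals_def)
  then have "card (parcs (dg (tdigraph_of (reduced k \<phi>)))) \<le> (\<Sum>C \<in> set (snd (snd \<phi>)). card (?arcs C))"
    by (simp add: card_UN_le)
  also have "\<dots> \<le> of_nat (card (set (snd (snd \<phi>)))) * 2" by (rule sum_bounded_above) (rule two)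
  also have "\<dots> \<le> 2 * (Suc Q ^ 3 * (6 * (?n + 1)))" using lC by simp
  finally have a: "card (parcs (dg (tdigraph_of (reduced k \<phi>)))) \<le> 2 * (Suc Q ^ 3 * (6 * (?n + 1)))" .
  define c where "c = Suc Q ^ 3"
  have "?n \<le> c * ?n" by (simp add: c_def)
  moreover have "order_plus_size (reduced k \<phi>) \<le> ?n + c + 18 * (c * ?n) + 18 * c"
    using v a unfolding order_plus_size_def c_def[symmetric] by (simp add: algebra_simps)
  ultimately have "order_plus_size (reduced k \<phi>) \<le> c * ?n + c + 18 * (c * ?n) + 18 * c" by linarith
  also have "\<dots> \<le> 20 * c * (?n + 1)" by (simp add: algebra_simps)
  finally show ?thesis by (simp add: c_def)
qed

end

text \<open>The parameter is written into the program, which pushes it as a constant. The time bound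
  is a single function of input and parameter, chosen before \<open>Q\<close>; this order of
  quantifiers allows \<open>Q\<close> to depend on the exponent of the running time.\<close>

lemma cp_parameter_prog:
  fixes G :: "bool list \<times> nat \<Rightarrow> bool list"
  assumes "cp S G"
  obtains T where "pb S T"
    "\<And>Q. \<exists>P. regs P \<subseteq> {..<7} \<and> (\<forall>x. exec P (inputs [x]) (T (x, Q)) ((\<lambda>_. [])(6 := G (x, Q))))"
proof -
  obtain P T where P: "regs P \<subseteq> {2, 3, 4, 5}" "pb S T"
    "\<And>x s r. clean s \<Longrightarrow> s 2 = bits (tree_of x) @ r \<Longrightarrow> exec P s (T x) (s(2 := bits (tree_of (G x)) @ r))"
    using assms by (rule cpE) blast
  let ?T = "\<lambda>z. 2 * sz z + ((20 * sz z + 4) + (2 + (T z + (17 * length (G z) + 3))))"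
  have "\<exists>P'. regs P' \<subseteq> {..<7} \<and> (\<forall>x. exec P' (inputs [x]) (?T (x, Q)) ((\<lambda>_. [])(6 := G (x, Q))))" for Q
  proof (intro exI conjI allI)
    let ?P = "pushes (bits (tree_of Q)) ;; load 0 ;; Push 2 True ;; P ;; unload"
    show "regs ?P \<subseteq> {..<7}"
      using P(1) regs_pushes[of "bits (tree_of Q)"] by (auto simp: load_def unload_def move_def)
    fix x :: "bool list"
    have l: "20 * length x + 4 \<le> 20 * sz (x, Q) + 4" using length_le_sz[of x] by simp
    have q: "2 * length (bits (tree_of Q)) \<le> 2 * sz (x, Q)" by (simp add: sz_def)
    show "exec ?P (inputs [x]) (?T (x, Q)) ((\<lambda>_. [])(6 := G (x, Q)))"
      by (rule exec.Seq[OF exec_mono[OF exec_pushes q] exec.Seq[OF exec_load[OF _ _ refl, where r = 0 and n = "20 * sz (x, Q) + 4"]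
            exec.Seq[OF exec.Push[OF order_refl refl] exec.Seq[OF P(3)[of _ "(x, Q)" "[]"]
              exec_unload[where r = "[]" and ys = "G (x, Q)"] order_refl] order_refl] order_refl]])
        (use l in \<open>auto simp: inputs_def clean_def fun_eq_iff\<close>)
  qed
  moreover have "pb S ?T" by (intro pb_intros P(2) pb_length[OF assms] cp_pb_sz[OF assms])
  ultimately show ?thesis using that by blast
qed

text \<open>The additive constant pays for the finitely many \<open>N\<close> at which the
  asymptotic bound is not yet valid.\<close>

lemma smallo_bound:
  assumes "f \<in> o(\<lambda>N. real N)" "0 < \<eta>"
  obtains C where "\<And>N. \<bar>f N\<bar> \<le> \<eta> * real N + C"
proof -
  have "eventually (\<lambda>N. \<bar>f N\<bar> \<le> \<eta> * real N) sequentially"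
    using landau_o.smallD[OF assms] by simp
  then obtain N0 where N0: "\<And>N. N0 \<le> N \<Longrightarrow> \<bar>f N\<bar> \<le> \<eta> * real N"
    unfolding eventually_sequentially by blast
  have "\<bar>f N\<bar> \<le> \<eta> * real N + (\<Sum>i < N0. \<bar>f i\<bar>)" for N
  proof (cases "N0 \<le> N")
    case True
    have "0 \<le> (\<Sum>i < N0. \<bar>f i\<bar>)" by (simp add: sum_nonneg)
    then show ?thesis using N0[OF True] by linarith
  next
    case False
    then have "\<bar>f N\<bar> \<le> (\<Sum>i < N0. \<bar>f i\<bar>)" by (intro member_le_sum) auto
    then show ?thesis using assms(2) by (simp add: add_increasing)
  qed
  then show ?thesis using that by blast
qed

section \<open>The lower bound under the Exponential Time Hypothesis\<close>

definition cnf_instance :: "nat \<Rightarrow> nat \<Rightarrow> cnf \<Rightarrow> branching_instance" where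
  "cnf_instance k Q F = reduced k (grouped_formula (binary_cnf F, groups Q (variables (binary_cnf F))))"

definition encoded_cnf_instance :: "nat \<Rightarrow> bool list \<times> nat \<Rightarrow> bool list" where
  "encoded_cnf_instance k z = enc_instance (reduced k
     (grouped_formula (parse_cnf (fst z), groups (snd z) (variables (parse_cnf (fst z))))))"

lemma encoded_cnf_instance_enc: "encoded_cnf_instance k (enc_cnf F, Q) = enc_instance (cnf_instance k Q F)"
  by (simp add: encoded_cnf_instance_def cnf_instance_def parse_cnf_enc)

lemma cp_encoded_cnf_instance: "cp group_budget (encoded_cnf_instance k)"
proof -
  have "pt (\<lambda>z :: bool list \<times> nat. parse_cnf (fst z))" by (intro pt_intros)
  then have "cp group_budget (\<lambda>z. parse_cnf (fst z))" by (rule cp_mono) (simp add: group_budget_def)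
  from cp_comp[OF cp_comp[OF cp_pair[OF this cp_groups] pt_grouped_formula] pt_enc_reduced]
  show ?thesis by (simp add: encoded_cnf_instance_def[abs_def])
qed

lemma length_variables: "length (variables (binary_cnf F)) = card (cnf_vars F)"
proof -
  have "set (variables (binary_cnf F)) = nat_bits ` cnf_vars F"
    by (force simp: variables_def binary_cnf_def cnf_vars_def)
  moreover have "distinct (variables (binary_cnf F))" by (simp add: variables_def distinct_dedup)
  ultimately show ?thesis
    using distinct_card card_image[of nat_bits "cnf_vars F"] nat_bits_inj by (metis inj_on_subset subset_UNIV)
qed

lemma satisfiable_binary_cnf:
  "satisfiable F \<longleftrightarrow> (\<exists>\<alpha>. \<forall>C \<in> set (binary_cnf F). \<exists>l \<in> set C. \<alpha> (snd l) = fst l)"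
proof
  assume "satisfiable F"
  then obtain \<alpha> where a: "\<forall>C \<in> set F. \<exists>(b, x) \<in> set C. \<alpha> x = b" unfolding satisfiable_def by blast
  have "\<exists>l \<in> set (map (map_prod (\<lambda>b. b) nat_bits) C). \<alpha> (bits_value (snd l)) = fst l" if C: "C \<in> set F" for C
  proof -
    obtain l where "l \<in> set C" "\<alpha> (snd l) = fst l" using bspec[OF a C] by auto
    then show ?thesis by (intro bexI[of _ "map_prod (\<lambda>b. b) nat_bits l"]) auto
  qed
  then show "\<exists>\<alpha>. \<forall>C \<in> set (binary_cnf F). \<exists>l \<in> set C. \<alpha> (snd l) = fst l"
    by (intro exI[of _ "\<lambda>v. \<alpha> (bits_value v)"]) (simp add: binary_cnf_def)
next
  assume "\<exists>\<alpha>. \<forall>C \<in> set (binary_cnf F). \<exists>l \<in> set C. \<alpha> (snd l) = fst l"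
  then obtain \<alpha> where "\<forall>C \<in> set F. \<exists>l \<in> set C. \<alpha> (nat_bits (snd l)) = fst l" by (auto simp: binary_cnf_def)
  then show "satisfiable F" unfolding satisfiable_def
    by (intro exI[of _ "\<lambda>x. \<alpha> (nat_bits x)"]) (auto simp: split_def)
qed

lemma cnf_instance_correct:
  assumes "F \<in> cnf3" "1 \<le> k"
  shows "cnf_instance k Q F \<in> branching_instances k"
    "cnf_instance k Q F \<in> branchings_problem k b False \<longleftrightarrow> satisfiable F"
    "order_plus_size (cnf_instance k Q F) \<le> 20 * Suc Q ^ 3 * (card (cnf_vars F) + 1)"
proof -
  note wf = mv_wf_grouped[of "binary_cnf F" Q]
  show i: "cnf_instance k Q F \<in> branching_instances k"
    unfolding cnf_instance_def by (rule reduced_instance[OF wf assms(2)])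
  have "\<forall>C \<in> set (binary_cnf F). length C \<le> 3" using assms(1) by (auto simp: cnf3_def binary_cnf_def)
  from mv_sat_grouped[OF this, of Q] has_disjoint_branchings_reduced[OF wf assms(2), of "disjointness b"] i
  show "cnf_instance k Q F \<in> branchings_problem k b False \<longleftrightarrow> satisfiable F"
    by (auto simp: branchings_problem_def cnf_instance_def disjointness_def satisfiable_binary_cnf)
  show "order_plus_size (cnf_instance k Q F) \<le> 20 * Suc Q ^ 3 * (card (cnf_vars F) + 1)"
    using order_plus_size_grouped[of k "binary_cnf F" Q] by (simp add: cnf_instance_def length_variables)
qed

text \<open>All summands of the budget and the rounding of the group size only cost a factor linear
  in the length of the input, for fixed \<open>Q\<close>.\<close>

lemma group_budget_bound:
  "real (group_budget (enc_cnf F, Q) + 2) \<le>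
     real (4 * length (enc_cnf F) + 2 * Q + 7) * 2 powr (real (card (cnf_vars F)) / real (Suc Q))"
proof -
  let ?L = "length (enc_cnf F)" and ?n = "card (cnf_vars F)"
  let ?B = "2 powr (real ?n / real (Suc Q))"
  have "real (?n div Suc Q) \<le> real ?n / real (Suc Q)" by (rule of_nat_div_le_of_nat)
  then have "2 powr real (?n div Suc Q) \<le> ?B" by simp
  then have d: "real (2 ^ (?n div Suc Q)) \<le> ?B" by (simp add: powr_realpow)
  have one: "1 \<le> ?B" by (rule ge_one_powr_ge_zero) auto
  have "sz (enc_cnf F, Q) \<le> 4 * ?L + 2 * Q + 3" using sz_bool_list[of "enc_cnf F"] by (simp add: sz_nat)
  then have "group_budget (enc_cnf F, Q) + 2 \<le> (4 * ?L + 2 * Q + 5) + 2 * 2 ^ (?n div Suc Q)"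
    by (simp add: group_budget_def parse_cnf_enc length_variables)
  then have "real (group_budget (enc_cnf F, Q) + 2) \<le> real (4 * ?L + 2 * Q + 5) + 2 * real (2 ^ (?n div Suc Q))"
    using of_nat_mono[where 'a = real] by fastforce
  also have "\<dots> \<le> real (4 * ?L + 2 * Q + 5) * ?B + 2 * ?B"
    using d one by (intro add_mono mult_left_mono mult_le_cancel_left1[THEN iffD2]) auto
  also have "\<dots> = real (4 * ?L + 2 * Q + 7) * ?B" by (simp add: algebra_simps)
  finally show ?thesis .
qed

text \<open>The exponent \<open>\<delta>\<close> is split in halves. One pays for the
  \<open>e\<close>-th power of the budget, where \<open>e\<close> accounts for the reduction and for
  the polynomial factor of the given algorithm; the other pays for its subexponential factor on the
  reduced instance.\<close>

lemma cnf3_solvable: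
  assumes k: "1 \<le> k" and sub: "subexponential k (branchings_problem k b False)" and \<delta>: "0 < \<delta>"
  shows "solvable_Ostar_exp enc_cnf cnf3 {F \<in> cnf3. satisfiable F} (\<lambda>F. \<delta> * real (card (cnf_vars F)))"
proof -
  let ?G = "encoded_cnf_instance k" and ?S = group_budget
  obtain f M and p :: "nat poly" where f: "f \<in> o(\<lambda>N. real N)" and wf: "wf_tm M"
    and M: "\<And>I. I \<in> branching_instances k \<Longrightarrow> \<exists>t. real t \<le> 2 powr f (order_plus_size I) * real (poly p (length (enc_instance I)))
      \<and> answers M [enc_instance I] t (I \<in> branchings_problem k b False)"
    using sub unfolding subexponential_def solvable_Ostar_exp_def solves_in_time_def by blast
  obtain T where T: "pb ?S T"
    "\<And>Q. \<exists>P. regs P \<subseteq> {..<7} \<and> (\<forall>x. exec P (inputs [x]) (T (x, Q)) ((\<lambda>_. [])(6 := ?G (x, Q))))"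
    using cp_encoded_cnf_instance by (rule cp_parameter_prog) blast
  have "pb ?S (\<lambda>z. T z + 1 + poly p (length (?G z)))"
    by (intro pb_intros T(1) pb_poly pb_length cp_encoded_cnf_instance)
  then obtain e where e: "\<And>z. T z + 1 + poly p (length (?G z)) \<le> (?S z + 2) ^ e" unfolding pb_def by blast
  \<comment> \<open>This many groups make the exponential factor of the \<open>e\<close>-th power of
    the budget at most 2 to the power \<open>\<delta> / 2\<close> times the number of
    variables.\<close>
  define Q where "Q = nat \<lceil>2 * real e / \<delta>\<rceil>"
  have "2 * real e / \<delta> \<le> real Q" unfolding Q_def by (rule real_nat_ceiling_ge)
  then have "2 * real e / \<delta> \<le> real (Suc Q)" by simp
  then have Q: "real e / real (Suc Q) \<le> \<delta> / 2" using \<delta> by (simp add: field_simps)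
  \<comment> \<open>The number of vertices and arcs is at most \<open>c * (n + 1)\<close> for
    \<open>n\<close> variables, so that the slope \<open>\<delta> / (2 * c)\<close> in the bound on
    \<open>f\<close> yields the second half of the exponent.\<close>
  define c where "c = 20 * real (Suc Q) ^ 3"
  have c: "0 < c" unfolding c_def by simp
  obtain C where C: "\<And>N. \<bar>f N\<bar> \<le> \<delta> / (2 * c) * real N + C"
    using smallo_bound[OF f, of "\<delta> / (2 * c)"] \<delta> c by auto
  \<comment> \<open>A natural number above the factor \<open>2 powr (\<delta> / 2 + C)\<close>,
    which does not depend on the formula and can thus become a coefficient of the polynomial
    \<open>r\<close>.\<close>
  define K where "K = nat \<lceil>2 powr (\<delta> / 2 + C + 1)\<rceil>"
  have K: "2 powr (\<delta> / 2 + C + 1) \<le> real K" unfolding K_def by (rule real_nat_ceiling_ge)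
  obtain P where P: "regs P \<subseteq> {..<7}" "\<And>x. exec P (inputs [x]) (T (x, Q)) ((\<lambda>_. [])(6 := ?G (x, Q)))"
    using T(2) by blast
  have M1: "1 \<le> tapes M" using wf by (simp add: wf_tm_def)
  have "{..<7} \<subseteq> {..<6 + tapes M}" using M1 by auto
  with P(1) have regs: "regs P \<subseteq> {..<6 + tapes M}" by (rule order_trans)
  define r where "r = [:K:] * [:2 * Q + 7, 4:] ^ e"
  have "solves_in_time (then_machine 6 P M) enc_cnf cnf3 {F \<in> cnf3. satisfiable F}
      (\<lambda>F. 2 powr (\<delta> * real (card (cnf_vars F))) * real (poly r (length (enc_cnf F))))"
    unfolding solves_in_time_def
  proof (intro conjI ballI)
    show "wf_tm (then_machine 6 P M)" by (rule wf_then_machine[OF regs wf])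
    fix F assume F: "F \<in> cnf3"
    let ?I = "cnf_instance k Q F" and ?x = "enc_cnf F" and ?n = "real (card (cnf_vars F))"
    note inst = cnf_instance_correct[OF F k, of Q]
    obtain t where t: "real t \<le> 2 powr f (order_plus_size ?I) * real (poly p (length (enc_instance ?I)))"
      "answers M [enc_instance ?I] t (?I \<in> branchings_problem k b False)"
      using M[OF inst(1)] by blast
    have "\<exists>t' \<le> T (?x, Q) + 1 + t. answers (then_machine 6 P M) [?x] t' (?I \<in> branchings_problem k b False)"
    proof (rule answers_then_machine[OF P(2) regs wf inputs_def _ t(2)])
      show "((\<lambda>_. [])(6 := ?G (?x, Q))) (6 + j) = (if j = 0 then enc_instance ?I else [])" for j :: nat
        by (simp add: encoded_cnf_instance_enc)
    qed
    then obtain t' where t': "t' \<le> T (?x, Q) + 1 + t" "answers (then_machine 6 P M) [?x] t' (satisfiable F)"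
      unfolding inst(2) by (elim exE conjE)
    let ?f = "\<bar>f (order_plus_size ?I)\<bar>" and ?W = "real (4 * length ?x + 2 * Q + 7)"
    have "real (order_plus_size ?I) \<le> real (20 * Suc Q ^ 3 * (card (cnf_vars F) + 1))"
      using inst(3) by (rule of_nat_mono)
    then have "real (order_plus_size ?I) \<le> c * (?n + 1)" by (simp add: c_def distrib_left)
    then have "\<delta> / (2 * c) * real (order_plus_size ?I) \<le> \<delta> / (2 * c) * (c * (?n + 1))"
      using \<delta> c by (intro mult_left_mono) auto
    also have "\<delta> / (2 * c) * (c * (?n + 1)) = \<delta> / 2 * (?n + 1)" using c by simp
    finally have fb: "?f \<le> \<delta> / 2 * (?n + 1) + C" using C[of "order_plus_size ?I"] by linarith
    have one: "1 \<le> 2 powr ?f" by (rule ge_one_powr_ge_zero) auto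
    have "real t' \<le> real (T (?x, Q) + 1) + real t" using t'(1) by linarith
    also have "\<dots> \<le> real (T (?x, Q) + 1) + 2 powr ?f * real (poly p (length (enc_instance ?I)))"
      by (intro add_left_mono order_trans[OF t(1)] mult_right_mono) auto
    also have "\<dots> \<le> 2 powr ?f * real (T (?x, Q) + 1) + 2 powr ?f * real (poly p (length (enc_instance ?I)))"
      using mult_right_mono[OF one, of "real (T (?x, Q) + 1)"] by simp
    also have "\<dots> = 2 powr ?f * real (T (?x, Q) + 1 + poly p (length (?G (?x, Q))))"
      by (simp add: encoded_cnf_instance_enc algebra_simps)
    also have "\<dots> \<le> 2 powr ?f * real ((?S (?x, Q) + 2) ^ e)"
      by (intro mult_left_mono of_nat_mono e) auto
    also have "\<dots> = 2 powr ?f * real (?S (?x, Q) + 2) ^ e" by simp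
    also have "\<dots> \<le> 2 powr ?f * (?W * 2 powr (?n / real (Suc Q))) ^ e"
      by (intro mult_left_mono power_mono group_budget_bound) auto
    also have "\<dots> = 2 powr ?f * 2 powr (real e / real (Suc Q) * ?n) * ?W ^ e"
      by (simp add: power_mult_distrib powr_power mult.commute)
    also have "\<dots> \<le> 2 powr (\<delta> / 2 * (?n + 1) + C) * 2 powr (\<delta> / 2 * ?n) * ?W ^ e"
      using fb Q by (intro mult_right_mono mult_mono powr_mono) auto
    also have "\<dots> = 2 powr (\<delta> * ?n) * (2 powr (\<delta> / 2 + C) * ?W ^ e)"
      by (simp add: powr_add[symmetric] algebra_simps)
    also have "\<dots> \<le> 2 powr (\<delta> * ?n) * (real K * ?W ^ e)"
      by (intro mult_left_mono mult_right_mono order_trans[OF _ K]) auto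
    also have "real K * ?W ^ e = real (poly r (length ?x))"
      by (simp add: r_def poly_power algebra_simps)
    finally show "\<exists>t. real t \<le> 2 powr (\<delta> * ?n) * real (poly r (length ?x)) \<and>
        answers (then_machine 6 P M) [?x] t (F \<in> {F \<in> cnf3. satisfiable F})"
      using t'(2) F by auto
  qed
  then show ?thesis unfolding solvable_Ostar_exp_def by blast
qed

theorem theorem5:
  fixes k :: nat
  assumes "k \<ge> 2"
  shows
    "NP_complete (enc_instance ` t_edge_disjoint_branchings k) \<and>
     NP_complete (enc_instance ` edge_disjoint_branchings k) \<and>
     NP_complete (enc_instance ` (t_edge_disjoint_branchings k \<inter> lifetime2_dag)) \<and>
     NP_complete (enc_instance ` (edge_disjoint_branchings k \<inter> lifetime2_dag)) \<and>
     (ETH \<longrightarrow>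
        \<not> subexponential k (t_edge_disjoint_branchings k) \<and>
        \<not> subexponential k (edge_disjoint_branchings k))"
proof -
  have k: "1 \<le> k" using assms by simp
  have eq: "t_edge_disjoint_branchings k = branchings_problem k False False"
    "edge_disjoint_branchings k = branchings_problem k True False"
    "branchings_problem k b False \<inter> lifetime2_dag = branchings_problem k b True" for b
    by (auto simp: t_edge_disjoint_branchings_def edge_disjoint_branchings_def branchings_problem_def disjointness_def)
  have "\<not> subexponential k (branchings_problem k b False)" if ETH for b
    using that cnf3_solvable[OF k] unfolding ETH_def by blast
  then show ?thesis unfolding eq using branchings_problem_NP_complete[OF k] by blast
qed

end
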